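(* Let $G$ be a Lie group, $\mathcal J$ a left-invariant skew-symmetric generalized complex structure on $G$, and $D^c$ the (flat) left-invariant connection on $G$ given by $D^c_XY=[X,Y]$ for any left-invariant vector fields $X,Y$. Then $\mathcal J$ is Courant integrable if and only if the almost complex structure $J^{\mathcal J,D^c}$ on $T^*G$ is integrable.
   Context: For a manifold $M$ let $\mathbb TM=TM\oplus T^*M$ with the metric $g_{\mathrm{can}}(X+\xi,Y+\eta)=\frac12(\xi(Y)+\eta(X))$. A skew-symmetric generalized complex structure on $M$ is a smooth field $\mathcal J$ of $g_{\mathrm{can}}$-skew-symmetric endomorphisms of $\mathbb TM$ with $\mathcal J^2=-\mathrm{Id}$ (no integrability assumed). Its holomorphic bundle is its $i$-eigenbundle $L\subset\mathbb T^{\mathbb C}M$. $\mathcal J$ is Courant integrable if $\Gamma(L)$ is closed under the (complex bilinear extension of the) Courant bracket $[X+\xi,Y+\eta]=[X,Y]+L_X\eta-L_Y\xi+\frac12d(\xi(Y)-\eta(X))$. A linear connection $D$ on $M$, acting on $\pi:T^*M\to M$, induces a decomposition $T(T^*M)=H^D\oplus T^{\mathrm{vert}}(T^*M)\cong\pi^*(TM)\oplus\pi^*(T^*M)=\pi^*(\mathbb TM)$ into horizontal and vertical bundles; $J^{\mathcal J,D}:=\pi^*(\mathcal J)$ under this identification, an almost complex structure on the manifold $T^*M$. A connection $D$ on a Lie group is left-invariant if $D_XY$ is left-invariant whenever $X,Y$ are. *)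

theory Defs
  imports "HOL-Analysis.Analysis" "HOL-Algebra.Group" "HOL-Library.Function_Algebras"
begin

text \<open>
  Tangent vectors are real-valued functions of functions, and cotangent vectors are real-valued
  functions of tangent vectors. The additive structure on them is the pointwise one of
  \<^theory>\<open>HOL-Library.Function_Algebras\<close> (on pairs: componentwise); scalar multiplication is
  \<open>fscale\<close>.
\<close>

definition fscale :: "real \<Rightarrow> ('x \<Rightarrow> real) \<Rightarrow> 'x \<Rightarrow> real"
  where "fscale c v = (\<lambda>x. c * v x)"

definition pscale :: "real \<Rightarrow> ('x \<Rightarrow> real) \<times> ('y \<Rightarrow> real) \<Rightarrow> ('x \<Rightarrow> real) \<times> ('y \<Rightarrow> real)"
  where "pscale c u = (fscale c (fst u), fscale c (snd u))"


section \<open>Model spaces and smooth maps between them\<close>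

text \<open>
  Model spaces are finite-dimensional inner product spaces. Unlike \<open>euclidean_space\<close>, this class
  does not exclude dimension zero, that is, discrete Lie groups. The axiom (some finite set has
  trivial orthogonal complement) is phrased without \<open>span\<close> since the latter is not available in the
  class specification; see \<open>findim_span\<close>.
\<close>

class findim_inner = real_inner +
  assumes findim: "\<exists>B. finite B \<and> (\<forall>x. (\<forall>b\<in>B. inner x b = 0) \<longrightarrow> x = 0)"

lemma finite_span_projection:
  fixes B :: "'a::real_inner set"
  assumes "finite B"
  shows "\<exists>y\<in>span B. \<forall>b\<in>B. (x - y) \<bullet> b = 0"
  using assms
proof (induction B arbitrary: x)
  case empty
  then show ?case by (auto intro: span_zero)
next
  case (insert a B)
  obtain z where z: "z \<in> span B" "\<forall>b\<in>B. (a - z) \<bullet> b = 0"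
    using insert.IH by blast
  obtain y where y: "y \<in> span B" "\<forall>b\<in>B. (x - y) \<bullet> b = 0"
    using insert.IH by blast
  define a' where "a' = a - z"
  define y' where "y' = y + (((x - y) \<bullet> a') / (a' \<bullet> a')) *\<^sub>R a'"
  have sub: "span B \<subseteq> span (insert a B)"
    by (rule span_mono) auto
  have "a' \<in> span (insert a B)"
    unfolding a'_def using z sub by (intro span_diff) (auto intro: span_base)
  then have y': "y' \<in> span (insert a B)"
    unfolding y'_def using y sub by (auto intro!: span_add span_scale)
  have orthB: "(x - y') \<bullet> b = 0" if "b \<in> B" for b
    using y z that by (simp add: y'_def a'_def inner_diff_left inner_add_left)
  have "(x - y') \<bullet> w = 0" if "w \<in> span B" for w
    using that
  proof (induction rule: span_induct)
    case base
    then show ?case using orthB by (auto simp: subspace_def inner_add_right)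
  qed (use orthB in auto)
  then have "(x - y') \<bullet> z = 0" using z by blast
  moreover have "(x - y') \<bullet> a' = 0"
    by (cases "a' = 0") (auto simp: y'_def inner_diff_left inner_add_left)
  moreover have "a = a' + z"
    by (simp add: a'_def)
  ultimately have "(x - y') \<bullet> a = 0"
    by (simp only: inner_add_right)
  then show ?case using y' orthB by auto
qed

lemma findim_span: "\<exists>B::'a::findim_inner set. finite B \<and> span B = UNIV"
proof -
  obtain B :: "'a set" where B: "finite B" "\<And>x. (\<forall>b\<in>B. x \<bullet> b = 0) \<Longrightarrow> x = 0"
    using findim by blast
  have "x \<in> span B" for x
  proof -
    obtain y where y: "y \<in> span B" "\<forall>b\<in>B. (x - y) \<bullet> b = 0"
      using finite_span_projection[OF B(1)] by blast
    then have "x - y = 0" using B(2) by blast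
    then show ?thesis using y by simp
  qed
  then show ?thesis using B(1) by blast
qed

instance euclidean_space \<subseteq> findim_inner
proof
  show "\<exists>B::'a set. finite B \<and> (\<forall>x. (\<forall>b\<in>B. x \<bullet> b = 0) \<longrightarrow> x = 0)"
    using euclidean_all_zero_iff finite_Basis by blast
qed

instance prod :: (findim_inner, findim_inner) findim_inner
proof
  obtain B :: "'a set" where B: "finite B" "\<And>x. (\<forall>b\<in>B. x \<bullet> b = 0) \<Longrightarrow> x = 0"
    using findim by blast
  obtain C :: "'b set" where C: "finite C" "\<And>x. (\<forall>b\<in>C. x \<bullet> b = 0) \<Longrightarrow> x = 0"
    using findim by blast
  let ?S = "(\<lambda>x. (x, 0::'b)) ` B \<union> (\<lambda>y. (0::'a, y)) ` C"
  have "z = 0" if z: "\<forall>b\<in>?S. z \<bullet> b = 0" for z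
  proof -
    have "\<forall>b\<in>B. fst z \<bullet> b = 0" "\<forall>b\<in>C. snd z \<bullet> b = 0"
      using z by (force simp: inner_prod_def)+
    then show ?thesis using B(2) C(2) by (simp add: prod_eq_iff)
  qed
  moreover have "finite ?S" using B C by simp
  ultimately show "\<exists>B::('a \<times> 'b) set. finite B \<and> (\<forall>x. (\<forall>b\<in>B. x \<bullet> b = 0) \<longrightarrow> x = 0)"
    by blast
qed

text \<open>\<open>S\<close> is always an open set here. As the domain is finite-dimensional, continuity of all
  iterated directional derivatives is continuity of the iterated derivatives.\<close>

primrec Ck_on :: "nat \<Rightarrow> 'e::findim_inner set \<Rightarrow> ('e \<Rightarrow> 'b::real_normed_vector) \<Rightarrow> bool" where
  "Ck_on 0 S f \<longleftrightarrow> continuous_on S f"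
| "Ck_on (Suc k) S f \<longleftrightarrow> (\<forall>x\<in>S. f differentiable (at x)) \<and>
     (\<forall>v. Ck_on k S (\<lambda>x. frechet_derivative f (at x) v))"

definition smooth_on :: "'e::findim_inner set \<Rightarrow> ('e \<Rightarrow> 'b::real_normed_vector) \<Rightarrow> bool"
  where "smooth_on S f \<longleftrightarrow> (\<forall>k. Ck_on k S f)"


section \<open>Smooth manifolds\<close>

text \<open>
  A manifold is given by an atlas, a set of charts \<open>(U, \<phi>)\<close>; its points and its topology are
  determined by the atlas. Atlases need not be maximal.
\<close>

type_synonym ('a, 'e) atlas = "('a set \<times> ('a \<Rightarrow> 'e)) set"

definition points :: "('a, 'e) atlas \<Rightarrow> 'a set"
  where "points A = \<Union> (fst ` A)"

definition mopen :: "('a, 'e::findim_inner) atlas \<Rightarrow> 'a set \<Rightarrow> bool"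
  where "mopen A W \<longleftrightarrow> W \<subseteq> points A \<and> (\<forall>(U, \<phi>)\<in>A. open (\<phi> ` (W \<inter> U)))"

definition manifold_topology :: "('a, 'e::findim_inner) atlas \<Rightarrow> 'a topology"
  where "manifold_topology A = topology (mopen A)"

definition smooth_manifold :: "('a, 'e::findim_inner) atlas \<Rightarrow> bool"
  where "smooth_manifold A \<longleftrightarrow>
    (\<forall>(U, \<phi>)\<in>A. inj_on \<phi> U \<and> open (\<phi> ` U)) \<and>
    (\<forall>(U, \<phi>)\<in>A. \<forall>(V, \<psi>)\<in>A.
       open (\<phi> ` (U \<inter> V)) \<and> smooth_on (\<phi> ` (U \<inter> V)) (\<psi> \<circ> inv_into U \<phi>)) \<and>
    Hausdorff_space (manifold_topology A) \<and> second_countable (manifold_topology A)"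

lemma openin_manifold_topology:
  assumes "smooth_manifold A"
  shows "openin (manifold_topology A) = mopen A"
proof -
  have inj: "inj_on \<phi> U" if "(U, \<phi>) \<in> A" for U \<phi>
    using assms that unfolding smooth_manifold_def by blast
  have "istopology (mopen A)"
    unfolding istopology_def
  proof (intro conjI allI impI)
    fix S T assume ST: "mopen A S" "mopen A T"
    have "open (\<phi> ` (S \<inter> T \<inter> U))" if U: "(U, \<phi>) \<in> A" for U \<phi>
    proof -
      have "\<phi> ` (S \<inter> T \<inter> U) = \<phi> ` (S \<inter> U) \<inter> \<phi> ` (T \<inter> U)"
        using inj_on_image_Int[OF inj[OF U], of "S \<inter> U" "T \<inter> U"]
        by (simp add: Int_ac)
      then show ?thesis using ST U by (auto simp: mopen_def)
    qed
    then show "mopen A (S \<inter> T)" using ST by (auto simp: mopen_def)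
  next
    fix K assume K: "\<forall>S\<in>K. mopen A S"
    have "open (\<phi> ` (\<Union>K \<inter> U))" if U: "(U, \<phi>) \<in> A" for U \<phi>
    proof -
      have "\<phi> ` (\<Union>K \<inter> U) = (\<Union>S\<in>K. \<phi> ` (S \<inter> U))" by auto
      moreover have "open (\<phi> ` (S \<inter> U))" if "S \<in> K" for S
        using K U that by (auto simp: mopen_def)
      ultimately show ?thesis by (simp add: open_UN)
    qed
    then show "mopen A (\<Union>K)" using K by (auto simp: mopen_def)
  qed
  then show ?thesis
    by (simp add: manifold_topology_def topology_inverse')
qed

definition smooth_fun :: "('a, 'e::findim_inner) atlas \<Rightarrow> 'a set \<Rightarrow> ('a \<Rightarrow> real) \<Rightarrow> bool"
  where "smooth_fun A W f \<longleftrightarrow>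
    mopen A W \<and> (\<forall>(U, \<phi>)\<in>A. smooth_on (\<phi> ` (W \<inter> U)) (f \<circ> inv_into U \<phi>))"

definition smooth_at :: "('a, 'e::findim_inner) atlas \<Rightarrow> 'a \<Rightarrow> ('a \<Rightarrow> real) \<Rightarrow> bool"
  where "smooth_at A p f \<longleftrightarrow> (\<exists>W. p \<in> W \<and> smooth_fun A W f)"

definition smooth_map ::
  "('a, 'e::findim_inner) atlas \<Rightarrow> ('b, 'f::findim_inner) atlas \<Rightarrow> ('a \<Rightarrow> 'b) \<Rightarrow> bool"
  where "smooth_map A B F \<longleftrightarrow> F ` points A \<subseteq> points B \<and>
    (\<forall>(U, \<phi>)\<in>A. \<forall>(V, \<psi>)\<in>B. open (\<phi> ` (U \<inter> F -` V)) \<and>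
       smooth_on (\<phi> ` (U \<inter> F -` V)) (\<psi> \<circ> F \<circ> inv_into U \<phi>))"

definition prod_atlas ::
  "('a, 'e) atlas \<Rightarrow> ('b, 'f) atlas \<Rightarrow> ('a \<times> 'b, 'e \<times> 'f) atlas"
  where "prod_atlas A B = {(U \<times> V, map_prod \<phi> \<psi>) | U \<phi> V \<psi>. (U, \<phi>) \<in> A \<and> (V, \<psi>) \<in> B}"


section \<open>Tangent and cotangent vectors\<close>

type_synonym 'a tvec = "('a \<Rightarrow> real) \<Rightarrow> real"
type_synonym 'a cvec = "'a tvec \<Rightarrow> real"

text \<open>
  Tangent vectors at \<open>p\<close> are the derivations at \<open>p\<close> of the functions that are smooth near \<open>p\<close>.
  The value \<open>0\<close> on all other functions is a convention which makes equality of tangent vectors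
  equality of functions; the same applies to cotangent vectors. Locality need not be required: by
  the Leibniz rule \<open>v f\<close> depends only on the germ of \<open>f\<close>.
\<close>

definition tangent_space :: "('a, 'e::findim_inner) atlas \<Rightarrow> 'a \<Rightarrow> 'a tvec set"
  where "tangent_space A p = {v.
    (\<forall>f g. smooth_at A p f \<and> smooth_at A p g \<longrightarrow>
       v (f + g) = v f + v g \<and> v (f * g) = f p * v g + g p * v f) \<and>
    (\<forall>c f. smooth_at A p f \<longrightarrow> v (fscale c f) = c * v f) \<and>
    (\<forall>f. \<not> smooth_at A p f \<longrightarrow> v f = 0)}"

definition cotangent_space :: "('a, 'e::findim_inner) atlas \<Rightarrow> 'a \<Rightarrow> 'a cvec set"
  where "cotangent_space A p = {\<xi>.
    (\<forall>v\<in>tangent_space A p. \<forall>w\<in>tangent_space A p. \<xi> (v + w) = \<xi> v + \<xi> w) \<and>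
    (\<forall>c. \<forall>v\<in>tangent_space A p. \<xi> (fscale c v) = c * \<xi> v) \<and>
    (\<forall>v. v \<notin> tangent_space A p \<longrightarrow> \<xi> v = 0)}"

definition coord_vec ::
  "('a, 'e::findim_inner) atlas \<Rightarrow> 'a set \<Rightarrow> ('a \<Rightarrow> 'e) \<Rightarrow> 'a \<Rightarrow> 'e \<Rightarrow> 'a tvec"
  where "coord_vec A U \<phi> p b = (\<lambda>f. if smooth_at A p f
    then frechet_derivative (f \<circ> inv_into U \<phi>) (at (\<phi> p)) b else 0)"

definition differential ::
  "('a, 'e::findim_inner) atlas \<Rightarrow> ('b, 'f::findim_inner) atlas \<Rightarrow> ('a \<Rightarrow> 'b) \<Rightarrow> 'a
     \<Rightarrow> 'a tvec \<Rightarrow> 'b tvec"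
  where "differential A B F p v = (\<lambda>f. if smooth_at B (F p) f then v (f \<circ> F) else 0)"


section \<open>Vector fields and one-forms\<close>

definition vector_field ::
  "('a, 'e::findim_inner) atlas \<Rightarrow> 'a set \<Rightarrow> ('a \<Rightarrow> 'a tvec) \<Rightarrow> bool"
  where "vector_field A W X \<longleftrightarrow> mopen A W \<and> (\<forall>p\<in>W. X p \<in> tangent_space A p) \<and>
    (\<forall>V f. V \<subseteq> W \<and> smooth_fun A V f \<longrightarrow> smooth_fun A V (\<lambda>p. X p f))"

definition one_form ::
  "('a, 'e::findim_inner) atlas \<Rightarrow> 'a set \<Rightarrow> ('a \<Rightarrow> 'a cvec) \<Rightarrow> bool"
  where "one_form A W \<xi> \<longleftrightarrow> mopen A W \<and> (\<forall>p\<in>W. \<xi> p \<in> cotangent_space A p) \<and>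
    (\<forall>V X. V \<subseteq> W \<and> vector_field A V X \<longrightarrow> smooth_fun A V (\<lambda>p. \<xi> p (X p)))"

definition lie_bracket ::
  "('a, 'e::findim_inner) atlas \<Rightarrow> ('a \<Rightarrow> 'a tvec) \<Rightarrow> ('a \<Rightarrow> 'a tvec) \<Rightarrow> 'a \<Rightarrow> 'a tvec"
  where "lie_bracket A X Y p = (\<lambda>f. if smooth_at A p f
    then X p (\<lambda>q. Y q f) - Y p (\<lambda>q. X q f) else 0)"

definition fun_differential ::
  "('a, 'e::findim_inner) atlas \<Rightarrow> ('a \<Rightarrow> real) \<Rightarrow> 'a \<Rightarrow> 'a cvec"
  where "fun_differential A f p = (\<lambda>v. if v \<in> tangent_space A p then v f else 0)"

text \<open>\<open>(L\<^sub>X \<eta>)(Y) = X (\<eta>(Y)) - \<eta>([X, Y])\<close> is tensorial in \<open>Y\<close>, so the choice of the local vector field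
  \<open>Y\<close> extending \<open>v\<close> does not matter.\<close>

definition lie_derivative ::
  "('a, 'e::findim_inner) atlas \<Rightarrow> ('a \<Rightarrow> 'a tvec) \<Rightarrow> ('a \<Rightarrow> 'a cvec) \<Rightarrow> 'a \<Rightarrow> 'a cvec"
  where "lie_derivative A X \<eta> p = (\<lambda>v. if v \<in> tangent_space A p
    then let Y = (SOME Y. (\<exists>W. p \<in> W \<and> vector_field A W Y) \<and> Y p = v)
         in X p (\<lambda>q. \<eta> q (Y q)) - \<eta> p (lie_bracket A X Y p)
    else 0)"


section \<open>Generalized complex structures\<close>

type_synonym 'a gvec = "'a tvec \<times> 'a cvec"

definition gen_tangent :: "('a, 'e::findim_inner) atlas \<Rightarrow> 'a \<Rightarrow> 'a gvec set"
  where "gen_tangent A p = tangent_space A p \<times> cotangent_space A p"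

definition g_can :: "'a gvec \<Rightarrow> 'a gvec \<Rightarrow> real"
  where "g_can u w = (1/2) * (snd u (fst w) + snd w (fst u))"

definition gen_section ::
  "('a, 'e::findim_inner) atlas \<Rightarrow> 'a set \<Rightarrow> ('a \<Rightarrow> 'a gvec) \<Rightarrow> bool"
  where "gen_section A W s \<longleftrightarrow> vector_field A W (fst \<circ> s) \<and> one_form A W (snd \<circ> s)"

definition skew_gen_complex_structure ::
  "('a, 'e::findim_inner) atlas \<Rightarrow> ('a \<Rightarrow> 'a gvec \<Rightarrow> 'a gvec) \<Rightarrow> bool"
  where "skew_gen_complex_structure A \<J> \<longleftrightarrow>
    (\<forall>p\<in>points A.
       (\<forall>u\<in>gen_tangent A p. \<J> p u \<in> gen_tangent A p) \<and>
       (\<forall>u\<in>gen_tangent A p. \<forall>w\<in>gen_tangent A p. \<J> p (u + w) = \<J> p u + \<J> p w) \<and>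
       (\<forall>c. \<forall>u\<in>gen_tangent A p. \<J> p (pscale c u) = pscale c (\<J> p u)) \<and>
       (\<forall>u\<in>gen_tangent A p. \<forall>w\<in>gen_tangent A p. g_can (\<J> p u) w = - g_can u (\<J> p w)) \<and>
       (\<forall>u\<in>gen_tangent A p. \<J> p (\<J> p u) = - u)) \<and>
    (\<forall>W s. gen_section A W s \<longrightarrow> gen_section A W (\<lambda>p. \<J> p (s p)))"

definition courant_bracket ::
  "('a, 'e::findim_inner) atlas \<Rightarrow> ('a \<Rightarrow> 'a gvec) \<Rightarrow> ('a \<Rightarrow> 'a gvec) \<Rightarrow> 'a \<Rightarrow> 'a gvec"
  where "courant_bracket A s t p =
    (let X = fst \<circ> s; \<xi> = snd \<circ> s; Y = fst \<circ> t; \<eta> = snd \<circ> t in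
     (lie_bracket A X Y p,
      lie_derivative A X \<eta> p - lie_derivative A Y \<xi> p
        + fscale (1/2) (fun_differential A (\<lambda>q. \<xi> q (Y q) - \<eta> q (X q)) p)))"

text \<open>An element \<open>a + i b\<close> of the complexified generalized tangent bundle is the pair \<open>(a, b)\<close>.\<close>

definition i_times :: "'a gvec \<times> 'a gvec \<Rightarrow> 'a gvec \<times> 'a gvec"
  where "i_times z = (- snd z, fst z)"

definition holomorphic_bundle ::
  "('a, 'e::findim_inner) atlas \<Rightarrow> ('a \<Rightarrow> 'a gvec \<Rightarrow> 'a gvec) \<Rightarrow> 'a \<Rightarrow> ('a gvec \<times> 'a gvec) set"
  where "holomorphic_bundle A \<J> p =
    {z \<in> gen_tangent A p \<times> gen_tangent A p. map_prod (\<J> p) (\<J> p) z = i_times z}"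

definition holomorphic_section ::
  "('a, 'e::findim_inner) atlas \<Rightarrow> ('a \<Rightarrow> 'a gvec \<Rightarrow> 'a gvec) \<Rightarrow> ('a \<Rightarrow> 'a gvec \<times> 'a gvec) \<Rightarrow> bool"
  where "holomorphic_section A \<J> s \<longleftrightarrow>
    gen_section A (points A) (fst \<circ> s) \<and> gen_section A (points A) (snd \<circ> s) \<and>
    (\<forall>p\<in>points A. s p \<in> holomorphic_bundle A \<J> p)"

definition complex_courant_bracket ::
  "('a, 'e::findim_inner) atlas \<Rightarrow> ('a \<Rightarrow> 'a gvec \<times> 'a gvec) \<Rightarrow> ('a \<Rightarrow> 'a gvec \<times> 'a gvec)
     \<Rightarrow> 'a \<Rightarrow> 'a gvec \<times> 'a gvec"
  where "complex_courant_bracket A s t p =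
    (courant_bracket A (fst \<circ> s) (fst \<circ> t) p - courant_bracket A (snd \<circ> s) (snd \<circ> t) p,
     courant_bracket A (fst \<circ> s) (snd \<circ> t) p + courant_bracket A (snd \<circ> s) (fst \<circ> t) p)"

definition courant_integrable ::
  "('a, 'e::findim_inner) atlas \<Rightarrow> ('a \<Rightarrow> 'a gvec \<Rightarrow> 'a gvec) \<Rightarrow> bool"
  where "courant_integrable A \<J> \<longleftrightarrow>
    (\<forall>s t. holomorphic_section A \<J> s \<and> holomorphic_section A \<J> t \<longrightarrow>
       holomorphic_section A \<J> (complex_courant_bracket A s t))"


section \<open>Almost complex structures\<close>

definition almost_complex_structure ::
  "('a, 'e::findim_inner) atlas \<Rightarrow> ('a \<Rightarrow> 'a tvec \<Rightarrow> 'a tvec) \<Rightarrow> bool"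
  where "almost_complex_structure A J \<longleftrightarrow>
    (\<forall>p\<in>points A.
       (\<forall>v\<in>tangent_space A p. J p v \<in> tangent_space A p) \<and>
       (\<forall>v\<in>tangent_space A p. \<forall>w\<in>tangent_space A p. J p (v + w) = J p v + J p w) \<and>
       (\<forall>c. \<forall>v\<in>tangent_space A p. J p (fscale c v) = fscale c (J p v)) \<and>
       (\<forall>v\<in>tangent_space A p. J p (J p v) = - v)) \<and>
    (\<forall>W X. vector_field A W X \<longrightarrow> vector_field A W (\<lambda>p. J p (X p)))"

definition nijenhuis ::
  "('a, 'e::findim_inner) atlas \<Rightarrow> ('a \<Rightarrow> 'a tvec \<Rightarrow> 'a tvec)
     \<Rightarrow> ('a \<Rightarrow> 'a tvec) \<Rightarrow> ('a \<Rightarrow> 'a tvec) \<Rightarrow> 'a \<Rightarrow> 'a tvec"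
  where "nijenhuis A J X Y p =
    (let JX = (\<lambda>q. J q (X q)); JY = (\<lambda>q. J q (Y q)) in
     lie_bracket A JX JY p - J p (lie_bracket A JX Y p) - J p (lie_bracket A X JY p)
       - lie_bracket A X Y p)"

definition integrable_almost_complex_structure ::
  "('a, 'e::findim_inner) atlas \<Rightarrow> ('a \<Rightarrow> 'a tvec \<Rightarrow> 'a tvec) \<Rightarrow> bool"
  where "integrable_almost_complex_structure A J \<longleftrightarrow> almost_complex_structure A J \<and>
    (\<forall>X Y. vector_field A (points A) X \<and> vector_field A (points A) Y \<longrightarrow>
       (\<forall>p\<in>points A. nijenhuis A J X Y p = 0))"


section \<open>Linear connections and the cotangent bundle\<close>

definition linear_connection ::
  "('a, 'e::findim_inner) atlas \<Rightarrow> (('a \<Rightarrow> 'a tvec) \<Rightarrow> ('a \<Rightarrow> 'a tvec) \<Rightarrow> ('a \<Rightarrow> 'a tvec)) \<Rightarrow> bool"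
  where "linear_connection A D \<longleftrightarrow>
    (\<forall>X Y. vector_field A (points A) X \<and> vector_field A (points A) Y \<longrightarrow>
       vector_field A (points A) (D X Y) \<and>
       (\<forall>Z. vector_field A (points A) Z \<longrightarrow> (\<forall>p\<in>points A.
          D (X + Z) Y p = D X Y p + D Z Y p \<and>
          D X (Y + Z) p = D X Y p + D X Z p)) \<and>
       (\<forall>f. smooth_fun A (points A) f \<longrightarrow> (\<forall>p\<in>points A.
          D (\<lambda>q. fscale (f q) (X q)) Y p = fscale (f p) (D X Y p) \<and>
          D X (\<lambda>q. fscale (f q) (Y q)) p = fscale (X p f) (Y p) + fscale (f p) (D X Y p))))"

text \<open>The action on one-forms: \<open>dual_connection D X \<sigma> Y p\<close> is the value of \<open>(D\<^sub>X \<sigma>)(Y)\<close> at \<open>p\<close>.\<close>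

definition dual_connection ::
  "(('a \<Rightarrow> 'a tvec) \<Rightarrow> ('a \<Rightarrow> 'a tvec) \<Rightarrow> ('a \<Rightarrow> 'a tvec))
     \<Rightarrow> ('a \<Rightarrow> 'a tvec) \<Rightarrow> ('a \<Rightarrow> 'a cvec) \<Rightarrow> ('a \<Rightarrow> 'a tvec) \<Rightarrow> 'a \<Rightarrow> real"
  where "dual_connection D X \<sigma> Y p = X p (\<lambda>q. \<sigma> q (Y q)) - \<sigma> p (D X Y p)"

text \<open>The chart of the cotangent bundle over \<open>(U, \<phi>)\<close> is \<open>(p, \<xi>) \<mapsto> (\<phi> p, w)\<close>, where \<open>w\<close> is the
  coordinate covector of \<open>\<xi>\<close>, identified with a vector by the inner product of the model space.\<close>

definition cotangent_chart ::
  "('a, 'e::findim_inner) atlas \<Rightarrow> 'a set \<Rightarrow> ('a \<Rightarrow> 'e) \<Rightarrow> 'a \<times> 'a cvec \<Rightarrow> 'e \<times> 'e"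
  where "cotangent_chart A U \<phi> = (\<lambda>(p, \<xi>). (\<phi> p, THE w. \<forall>b. w \<bullet> b = \<xi> (coord_vec A U \<phi> p b)))"

definition cotangent_bundle ::
  "('a, 'e::findim_inner) atlas \<Rightarrow> ('a \<times> 'a cvec, 'e \<times> 'e) atlas"
  where "cotangent_bundle A =
    {(Sigma U (cotangent_space A), cotangent_chart A U \<phi>) | U \<phi>. (U, \<phi>) \<in> A}"

text \<open>The horizontal space at \<open>(p, \<xi>)\<close> consists of the tangent vectors to the one-forms, viewed as
  sections of the cotangent bundle, that pass through \<open>\<xi>\<close> and are parallel at \<open>p\<close>.\<close>

definition horizontal_space ::
  "('a, 'e::findim_inner) atlas \<Rightarrow> (('a \<Rightarrow> 'a tvec) \<Rightarrow> ('a \<Rightarrow> 'a tvec) \<Rightarrow> ('a \<Rightarrow> 'a tvec))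
     \<Rightarrow> 'a \<times> 'a cvec \<Rightarrow> ('a \<times> 'a cvec) tvec set"
  where "horizontal_space A D x =
    {differential A (cotangent_bundle A) (\<lambda>q. (q, \<sigma> q)) (fst x) v | \<sigma> v.
       one_form A (points A) \<sigma> \<and> \<sigma> (fst x) = snd x \<and>
       (\<forall>X Y. vector_field A (points A) X \<and> vector_field A (points A) Y \<longrightarrow>
          dual_connection D X \<sigma> Y (fst x) = 0) \<and>
       v \<in> tangent_space A (fst x)}"

definition horizontal_lift ::
  "('a, 'e::findim_inner) atlas \<Rightarrow> (('a \<Rightarrow> 'a tvec) \<Rightarrow> ('a \<Rightarrow> 'a tvec) \<Rightarrow> ('a \<Rightarrow> 'a tvec))
     \<Rightarrow> 'a \<times> 'a cvec \<Rightarrow> 'a tvec \<Rightarrow> ('a \<times> 'a cvec) tvec"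
  where "horizontal_lift A D x v =
    (THE w. w \<in> horizontal_space A D x \<and> differential (cotangent_bundle A) A fst x w = v)"

definition vertical_lift ::
  "('a, 'e::findim_inner) atlas \<Rightarrow> 'a \<times> 'a cvec \<Rightarrow> 'a cvec \<Rightarrow> ('a \<times> 'a cvec) tvec"
  where "vertical_lift A x \<eta> = (\<lambda>f. if smooth_at (cotangent_bundle A) x f
    then deriv (\<lambda>t. f (fst x, snd x + fscale t \<eta>)) 0 else 0)"

text \<open>The isomorphism from \<open>gen_tangent A (fst x)\<close>, the fibre at \<open>x\<close> of the pulled-back generalized
  tangent bundle, to the tangent space of the cotangent bundle at \<open>x\<close>.\<close>

definition lift_iso ::
  "('a, 'e::findim_inner) atlas \<Rightarrow> (('a \<Rightarrow> 'a tvec) \<Rightarrow> ('a \<Rightarrow> 'a tvec) \<Rightarrow> ('a \<Rightarrow> 'a tvec))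
     \<Rightarrow> 'a \<times> 'a cvec \<Rightarrow> 'a gvec \<Rightarrow> ('a \<times> 'a cvec) tvec"
  where "lift_iso A D x u = horizontal_lift A D x (fst u) + vertical_lift A x (snd u)"

definition cotangent_acs ::
  "('a, 'e::findim_inner) atlas \<Rightarrow> ('a \<Rightarrow> 'a gvec \<Rightarrow> 'a gvec)
     \<Rightarrow> (('a \<Rightarrow> 'a tvec) \<Rightarrow> ('a \<Rightarrow> 'a tvec) \<Rightarrow> ('a \<Rightarrow> 'a tvec))
     \<Rightarrow> 'a \<times> 'a cvec \<Rightarrow> ('a \<times> 'a cvec) tvec \<Rightarrow> ('a \<times> 'a cvec) tvec"
  where "cotangent_acs A \<J> D x w =
    lift_iso A D x (\<J> (fst x) (inv_into (gen_tangent A (fst x)) (lift_iso A D x) w))"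


section \<open>Lie groups and left-invariant structures\<close>

definition lie_group :: "('g, 'm) monoid_scheme \<Rightarrow> ('g, 'e::findim_inner) atlas \<Rightarrow> bool"
  where "lie_group G A \<longleftrightarrow> group G \<and> smooth_manifold A \<and> carrier G = points A \<and>
    smooth_map (prod_atlas A A) A (\<lambda>(g, h). g \<otimes>\<^bsub>G\<^esub> h) \<and>
    smooth_map A A (\<lambda>g. inv\<^bsub>G\<^esub> g)"

definition left_push ::
  "('g, 'm) monoid_scheme \<Rightarrow> ('g, 'e::findim_inner) atlas \<Rightarrow> 'g \<Rightarrow> 'g \<Rightarrow> 'g tvec \<Rightarrow> 'g tvec"
  where "left_push G A g h = differential A A (\<lambda>k. g \<otimes>\<^bsub>G\<^esub> k) h"

text \<open>The action of the left translation by \<open>g\<close> on generalized tangent vectors at \<open>h\<close>: on covectors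
  it is the pullback along the left translation by the inverse of \<open>g\<close>.\<close>

definition left_gen_push ::
  "('g, 'm) monoid_scheme \<Rightarrow> ('g, 'e::findim_inner) atlas \<Rightarrow> 'g \<Rightarrow> 'g \<Rightarrow> 'g gvec \<Rightarrow> 'g gvec"
  where "left_gen_push G A g h u =
    (left_push G A g h (fst u),
     \<lambda>w. if w \<in> tangent_space A (g \<otimes>\<^bsub>G\<^esub> h)
          then snd u (left_push G A (inv\<^bsub>G\<^esub> g) (g \<otimes>\<^bsub>G\<^esub> h) w) else 0)"

definition left_invariant_field ::
  "('g, 'm) monoid_scheme \<Rightarrow> ('g, 'e::findim_inner) atlas \<Rightarrow> ('g \<Rightarrow> 'g tvec) \<Rightarrow> bool"
  where "left_invariant_field G A X \<longleftrightarrow> vector_field A (points A) X \<and>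
    (\<forall>g\<in>carrier G. \<forall>h\<in>carrier G. X (g \<otimes>\<^bsub>G\<^esub> h) = left_push G A g h (X h))"

definition left_invariant_gcs ::
  "('g, 'm) monoid_scheme \<Rightarrow> ('g, 'e::findim_inner) atlas \<Rightarrow> ('g \<Rightarrow> 'g gvec \<Rightarrow> 'g gvec) \<Rightarrow> bool"
  where "left_invariant_gcs G A \<J> \<longleftrightarrow>
    (\<forall>g\<in>carrier G. \<forall>h\<in>carrier G. \<forall>u\<in>gen_tangent A h.
       \<J> (g \<otimes>\<^bsub>G\<^esub> h) (left_gen_push G A g h u) = left_gen_push G A g h (\<J> h u))"

definition left_invariant_connection ::
  "('g, 'm) monoid_scheme \<Rightarrow> ('g, 'e::findim_inner) atlas
     \<Rightarrow> (('g \<Rightarrow> 'g tvec) \<Rightarrow> ('g \<Rightarrow> 'g tvec) \<Rightarrow> ('g \<Rightarrow> 'g tvec)) \<Rightarrow> bool"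
  where "left_invariant_connection G A D \<longleftrightarrow> linear_connection A D \<and>
    (\<forall>X Y. left_invariant_field G A X \<and> left_invariant_field G A Y \<longrightarrow>
       left_invariant_field G A (D X Y))"

end

(*
  In the left-invariant trivialization a left-invariant generalized complex structure is a constant
  endomorphism j of g + g*. Left-invariant sections of the generalized tangent bundle and their lifts
  to the cotangent bundle (horizontal for vectors, vertical for covectors) both satisfy the brackets
  of the semidirect product g + g* with the coadjoint action. Courant integrability and the vanishing
  of the Nijenhuis tensor are both tensorial (for the Courant bracket because j is skew), hence both
  are equivalent to the vanishing of the Nijenhuis expression of j on g + g*.

  No bump functions are used: left-invariant fields and forms are global frames, and since
  right-invariant one-forms are parallel for the connection, they provide the global parallel
  sections that define the horizontal spaces.
*)

theory Submission
  imports Defs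
begin

section \<open>Calculus on finite-dimensional inner product spaces\<close>

text \<open>The obstacle is that \<open>horizontal_lift\<close> is a definite description over
  tangent vectors of parallel forms, which cannot be computed with directly. Tangent vectors of the
  cotangent bundle are therefore identified by their action on two kinds of functions: those pulled
  back from the group, and the momenta \<open>mom c\<close>, which send (p, \<xi>) to \<xi> (E c p).
  Parallelism of a form \<sigma> says E_a (\<sigma> (E_c)) = \<sigma> ([E_a, E_c]), so the
  horizontal lift of E_a sends \<open>mom c\<close> to \<open>mom (br a c)\<close>. Curvature would
  show up as a vertical part in the brackets of horizontal lifts; the Jacobi identity is what
  removes it.

  On the other side, the exact term of the Courant bracket vanishes on left-invariant sections
  because \<theta>_w (E_a) is constant. A holomorphic section is determined by its imaginary part s,
  its real part being J s, so closure of these sections is a real Nijenhuis condition.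

  That right-invariant forms are parallel comes down to the product rule, the derivative of
  inversion and the symmetry of mixed derivatives, the last by Hadamard's lemma.\<close>

lemma onb_exists:
  "\<exists>B::'e::findim_inner set. finite B \<and> (\<forall>b\<in>B. \<forall>c\<in>B. b \<bullet> c = (if b = c then 1 else 0)) \<and> span B = UNIV"
proof -
  obtain B :: "'e set" where B: "finite B" "span B = UNIV"
    using findim_span by blast
  obtain C :: "'e set" where C: "finite C" "span C = span B" "pairwise orthogonal C"
    using basis_orthogonal[OF B(1)] by blast
  \<comment> \<open>\<open>basis_orthogonal\<close> gives pairwise orthogonality only, so
    \<open>C\<close> may contain 0, which has to be removed before normalizing.\<close>
  define N where "N = (\<lambda>x::'e. x /\<^sub>R norm x) ` (C - {0})"
  have "x \<in> span N" if "x \<in> C" for x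
  proof (cases "x = 0")
    case False
    then have "x = norm x *\<^sub>R (x /\<^sub>R norm x)" by simp
    moreover have "x /\<^sub>R norm x \<in> N" using False that by (auto simp: N_def)
    ultimately show ?thesis by (metis span_base span_scale)
  qed (simp add: span_zero)
  then have "span N = UNIV"
    using C B span_minimal[of C "span N"] by (auto simp: subspace_span)
  moreover have "b \<bullet> c = (if b = c then 1 else 0)" if "b \<in> N" "c \<in> N" for b c
  proof -
    obtain x where "x \<in> C" "x \<noteq> 0" "b = x /\<^sub>R norm x" using \<open>b \<in> N\<close> by (auto simp: N_def)
    moreover obtain y where "y \<in> C" "y \<noteq> 0" "c = y /\<^sub>R norm y" using \<open>c \<in> N\<close> by (auto simp: N_def)
    ultimately have xy: "x \<in> C" "x \<noteq> 0" "y \<in> C" "y \<noteq> 0" "b = x /\<^sub>R norm x" "c = y /\<^sub>R norm y"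
      by auto
    show ?thesis
    proof (cases "x = y")
      case True
      then show ?thesis using xy
        by (simp add: dot_square_norm power2_eq_square)
    next
      case False
      then have o: "x \<bullet> y = 0" using C(3) xy by (auto simp: pairwise_def orthogonal_def)
      have "b \<noteq> c"
      proof
        assume "b = c"
        then have "b \<bullet> b = 0" using o xy(5,6) by (metis inner_scaleR_left inner_scaleR_right mult_zero_right)
        then show False using xy by simp
      qed
      then show ?thesis using o xy by simp
    qed
  qed
  moreover have "finite N" using C by (simp add: N_def)
  ultimately show ?thesis by blast
qed

text \<open>One orthonormal basis fixed for each model space, in the role of \<open>Basis\<close>;
  in dimension zero it is the empty set.\<close>

definition onb :: "'e::findim_inner set" where
  "onb = (SOME B. finite B \<and> (\<forall>b\<in>B. \<forall>c\<in>B. b \<bullet> c = (if b = c then 1 else 0)) \<and> span B = UNIV)"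

lemma onb:
  "finite (onb :: 'e::findim_inner set) \<and> (\<forall>b\<in>(onb :: 'e set). \<forall>c\<in>onb. b \<bullet> c = (if b = c then 1 else 0)) \<and>
    span (onb :: 'e set) = UNIV"
  unfolding onb_def by (rule someI_ex[OF onb_exists])

lemma finite_onb [simp]: "finite onb"
  and inner_onb: "b \<in> onb \<Longrightarrow> c \<in> onb \<Longrightarrow> b \<bullet> c = (if b = c then 1 else 0)"
  and span_onb: "span onb = UNIV"
  using onb by blast+

lemma inner_sum_onb: "c \<in> onb \<Longrightarrow> (\<Sum>b\<in>onb. f b *\<^sub>R b) \<bullet> c = f c"
proof -
  assume c: "c \<in> onb"
  have "(\<Sum>b\<in>onb. f b *\<^sub>R b) \<bullet> c = (\<Sum>b\<in>onb. f b * (b \<bullet> c))"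
    by (simp add: inner_sum_left)
  also have "\<dots> = (\<Sum>b\<in>onb. if b = c then f b else 0)"
    using c by (intro sum.cong) (auto simp: inner_onb)
  also have "\<dots> = f c" using c by simp
  finally show ?thesis .
qed

lemma onb_eqI: "(\<And>b. b \<in> onb \<Longrightarrow> x \<bullet> b = y \<bullet> b) \<Longrightarrow> x = y"
proof -
  assume a: "\<And>b. b \<in> onb \<Longrightarrow> x \<bullet> b = y \<bullet> b"
  have "(x - y) \<bullet> w = 0" if "w \<in> span onb" for w
    using that
  proof (induction rule: span_induct)
    case base
    then show ?case by (auto simp: subspace_def inner_add_right)
  qed (simp add: a inner_diff_left)
  then show "x = y" using span_onb by (metis UNIV_I inner_eq_zero_iff right_minus_eq)
qed

lemma onb_expand: "(\<Sum>b\<in>onb. (x \<bullet> b) *\<^sub>R b) = x"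
  by (rule onb_eqI) (simp add: inner_sum_onb)

lemma linear_onb: "linear f \<Longrightarrow> f x = (\<Sum>b\<in>onb. (x \<bullet> b) *\<^sub>R f b)"
  by (subst (1) onb_expand[symmetric]) (simp add: linear_sum linear_scale)

text \<open>Differentiation under the integral sign, used in
  \<open>integral_parameter_smooth\<close>, takes place over a complete parameter space.\<close>

instance findim_inner \<subseteq> banach
proof
  fix X :: "nat \<Rightarrow> 'a"
  assume X: "Cauchy X"
  have "convergent (\<lambda>n. X n \<bullet> b)" for b
    using bounded_linear.Cauchy[OF bounded_linear_inner_left X] by (simp add: Cauchy_convergent_iff)
  then have "(\<lambda>n. X n \<bullet> b) \<longlonglongrightarrow> lim (\<lambda>n. X n \<bullet> b)" for b
    by (simp add: convergent_LIMSEQ_iff)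
  then have "(\<lambda>n. \<Sum>b\<in>onb. (X n \<bullet> b) *\<^sub>R b) \<longlonglongrightarrow> (\<Sum>b\<in>onb. lim (\<lambda>n. X n \<bullet> b) *\<^sub>R b)"
    by (intro tendsto_intros)
  then show "convergent X" by (auto simp: onb_expand convergent_def)
qed

section \<open>Functions of class C^k\<close>

lemma Ck_on_cong:
  assumes "open S" "\<And>x. x \<in> S \<Longrightarrow> f x = g x" "Ck_on k S f"
  shows "Ck_on k S g"
  using assms(2,3)
proof (induction k arbitrary: f g)
  case 0
  then show ?case by (metis Ck_on.simps(1) continuous_on_cong)
next
  case (Suc k)
  have d: "(g has_derivative frechet_derivative f (at x)) (at x)" if "x \<in> S" for x
    using has_derivative_transform_within_open[OF _ assms(1) that, of f "frechet_derivative f (at x)" UNIV g]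
      Suc.prems that by (auto simp: frechet_derivative_works)
  then have e: "frechet_derivative g (at x) = frechet_derivative f (at x)" if "x \<in> S" for x
    using that frechet_derivative_at by metis
  have "Ck_on k S (\<lambda>x. frechet_derivative g (at x) v)" for v
    by (rule Suc.IH[of "\<lambda>x. frechet_derivative f (at x) v"]) (use e Suc.prems in auto)
  then show ?case using d by (auto simp: differentiable_def)
qed

text \<open>Derivatives at points of an open set are unique, so any family \<open>f'\<close> of
  derivatives may stand for \<open>frechet_derivative\<close>. The closure properties below are
  inductions through this rule.\<close>

lemma Ck_on_Suc_I:
  assumes "open S" "\<And>x. x \<in> S \<Longrightarrow> (f has_derivative f' x) (at x)" "\<And>v. Ck_on k S (\<lambda>x. f' x v)"
  shows "Ck_on (Suc k) S f"
proof -
  have e: "frechet_derivative f (at x) = f' x" if "x \<in> S" for x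
    using that assms frechet_derivative_at by metis
  have "Ck_on k S (\<lambda>x. frechet_derivative f (at x) v)" for v
    by (rule Ck_on_cong[OF assms(1) _ assms(3)[of v]]) (use e in auto)
  then show ?thesis using assms(2) by (auto simp: differentiable_def)
qed

lemma Ck_on_Suc_D:
  assumes "Ck_on (Suc k) S f" "x \<in> S"
  shows "(f has_derivative frechet_derivative f (at x)) (at x)"
  using assms by (auto simp: frechet_derivative_works)

lemma Ck_on_subset: "Ck_on k S f \<Longrightarrow> T \<subseteq> S \<Longrightarrow> Ck_on k T f"
  by (induction k arbitrary: f) (auto intro: continuous_on_subset)

lemma Ck_on_local:
  assumes "\<And>x. x \<in> S \<Longrightarrow> \<exists>T. open T \<and> x \<in> T \<and> Ck_on k T f"
  shows "Ck_on k S f"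
  using assms
proof (induction k arbitrary: f)
  case 0
  have "continuous (at x) f" if "x \<in> S" for x
    using 0[OF that] by (auto simp: continuous_on_eq_continuous_at)
  then show ?case by (simp add: continuous_at_imp_continuous_on)
next
  case (Suc k)
  have "Ck_on k S (\<lambda>x. frechet_derivative f (at x) v)" for v
    by (rule Suc.IH) (use Suc.prems in force)
  moreover have "f differentiable (at x)" if "x \<in> S" for x
    using Suc.prems[OF that] by auto
  ultimately show ?case by simp
qed

lemma Ck_on_Suc_imp: "Ck_on (Suc k) S f \<Longrightarrow> Ck_on k S f"
proof (induction k arbitrary: f)
  case 0
  then show ?case
    by (auto intro!: continuous_at_imp_continuous_on differentiable_imp_continuous_within)
next
  case (Suc k)
  then show ?case by (metis Ck_on.simps(2))
qed

lemma Ck_on_const: "Ck_on k S (\<lambda>x. c)"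
proof (induction k arbitrary: c)
  case (Suc k)
  then show ?case by (simp add: frechet_derivative_const)
qed simp

lemma Ck_on_add:
  "open S \<Longrightarrow> Ck_on k S f \<Longrightarrow> Ck_on k S g \<Longrightarrow> Ck_on k S (\<lambda>x. f x + g x)"
proof (induction k arbitrary: f g)
  case 0
  then show ?case by (simp add: continuous_on_add)
next
  case (Suc k)
  show ?case
    by (rule Ck_on_Suc_I[where f' = "\<lambda>x v. frechet_derivative f (at x) v + frechet_derivative g (at x) v"])
       (use Suc in \<open>auto intro!: has_derivative_add Ck_on_Suc_D\<close>)
qed

lemma Ck_on_sum:
  "open S \<Longrightarrow> (\<And>i. i \<in> I \<Longrightarrow> Ck_on k S (f i)) \<Longrightarrow> Ck_on k S (\<lambda>x. \<Sum>i\<in>I. f i x)"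
  by (induction I rule: infinite_finite_induct) (auto intro: Ck_on_add Ck_on_const)

lemma Ck_on_scaleR:
  "open S \<Longrightarrow> Ck_on k S f \<Longrightarrow> Ck_on k S g \<Longrightarrow> Ck_on k S (\<lambda>x. f x *\<^sub>R g x)"
proof (induction k arbitrary: f g)
  case 0
  then show ?case by (simp add: continuous_on_scaleR)
next
  case (Suc k)
  show ?case
  proof (rule Ck_on_Suc_I[where f' = "\<lambda>x v. f x *\<^sub>R frechet_derivative g (at x) v + frechet_derivative f (at x) v *\<^sub>R g x"])
    show "Ck_on k S (\<lambda>x. f x *\<^sub>R frechet_derivative g (at x) v + frechet_derivative f (at x) v *\<^sub>R g x)" for v
      using Suc by (intro Ck_on_add Suc.IH) (auto intro: Ck_on_Suc_imp simp del: Ck_on.simps, auto)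
  qed (use Suc in \<open>auto intro!: has_derivative_scaleR Ck_on_Suc_D simp del: Ck_on.simps\<close>)
qed

lemma Ck_on_linear_comp:
  assumes "bounded_linear h"
  shows "open S \<Longrightarrow> Ck_on k S f \<Longrightarrow> Ck_on k S (\<lambda>x. h (f x))"
proof (induction k arbitrary: f)
  case 0
  then show ?case using bounded_linear.continuous_on[OF assms] by simp
next
  case (Suc k)
  show ?case
    by (rule Ck_on_Suc_I[where f' = "\<lambda>x v. h (frechet_derivative f (at x) v)"])
       (use Suc in \<open>auto intro!: bounded_linear.has_derivative[OF assms] Ck_on_Suc_D\<close>)
qed

lemma Ck_on_ident: "open S \<Longrightarrow> Ck_on k S (\<lambda>x. x)"
  by (cases k) (auto intro: Ck_on_const)

lemma Ck_on_comp:
  fixes f :: "'e::findim_inner \<Rightarrow> 'f::findim_inner"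
  shows "open S \<Longrightarrow> Ck_on k S f \<Longrightarrow> Ck_on k T g \<Longrightarrow> f ` S \<subseteq> T \<Longrightarrow> Ck_on k S (\<lambda>x. g (f x))"
proof (induction k arbitrary: g)
  case 0
  then show ?case by (auto intro: continuous_on_compose2)
next
  case (Suc k)
  define g' where "g' y = frechet_derivative g (at y)" for y
  define f' where "f' x = frechet_derivative f (at x)" for x
  have df: "(f has_derivative f' x) (at x)" if "x \<in> S" for x
    using Suc.prems that Ck_on_Suc_D unfolding f'_def by metis
  have dg: "(g has_derivative g' (f x)) (at (f x))" if "x \<in> S" for x
    unfolding g'_def by (rule Ck_on_Suc_D[OF Suc.prems(3)]) (use Suc.prems that in auto)
  \<comment> \<open>In g' (f x) (f' x v) the direction depends on x, while the induction hypothesis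
    handles fixed directions only. Expanding over \<open>onb\<close> turns the derivative into a sum
    of products of C^k functions.\<close>
  show ?case
  proof (rule Ck_on_Suc_I[where f' = "\<lambda>x v. \<Sum>b\<in>onb. (f' x v \<bullet> b) *\<^sub>R g' (f x) b"])
    fix x assume x: "x \<in> S"
    have "((\<lambda>x. g (f x)) has_derivative (\<lambda>v. g' (f x) (f' x v))) (at x)"
      by (rule has_derivative_compose[OF df[OF x] dg[OF x]])
    moreover have "linear (g' (f x))" using dg[OF x] has_derivative_linear by blast
    ultimately show "((\<lambda>x. g (f x)) has_derivative (\<lambda>v. \<Sum>b\<in>onb. (f' x v \<bullet> b) *\<^sub>R g' (f x) b)) (at x)"
      by (simp add: linear_onb[symmetric])
  next
    fix v
    have "Ck_on k S (\<lambda>x. f' x v \<bullet> b)" for b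
      by (rule Ck_on_linear_comp[OF bounded_linear_inner_left Suc.prems(1)])
         (use Suc.prems in \<open>auto simp: f'_def\<close>)
    moreover have "Ck_on k S (\<lambda>x. g' (f x) b)" for b
      by (rule Suc.IH) (use Suc.prems in \<open>auto simp: g'_def simp del: Ck_on.simps intro: Ck_on_Suc_imp\<close>, auto)
    ultimately show "Ck_on k S (\<lambda>x. \<Sum>b\<in>onb. (f' x v \<bullet> b) *\<^sub>R g' (f x) b)"
      by (intro Ck_on_sum Ck_on_scaleR Suc.prems)
  qed (use Suc.prems in auto)
qed

lemma smooth_on_subset: "smooth_on S f \<Longrightarrow> T \<subseteq> S \<Longrightarrow> smooth_on T f"
  by (auto simp: smooth_on_def intro: Ck_on_subset)

lemma smooth_on_differentiable:
  assumes "smooth_on S f" "x \<in> S"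
  shows "(f has_derivative frechet_derivative f (at x)) (at x)"
  using assms Ck_on_Suc_D[of 0 S f x] by (auto simp: smooth_on_def simp del: Ck_on.simps)

lemma smooth_on_frechet_derivative:
  "smooth_on S f \<Longrightarrow> smooth_on S (\<lambda>x. frechet_derivative f (at x) v)"
  unfolding smooth_on_def by (metis Ck_on.simps(2))

lemma smooth_on_continuous: "smooth_on S f \<Longrightarrow> continuous_on S f"
  unfolding smooth_on_def by (metis Ck_on.simps(1))

text \<open>Smoothness near a point, so that domains need not be tracked.\<close>

definition smooth_near :: "'e::findim_inner \<Rightarrow> ('e \<Rightarrow> 'b::real_normed_vector) \<Rightarrow> bool"
  where "smooth_near x f \<longleftrightarrow> (\<exists>S. open S \<and> x \<in> S \<and> smooth_on S f)"

lemma smooth_on_iff_near: "open S \<Longrightarrow> smooth_on S f \<longleftrightarrow> (\<forall>x\<in>S. smooth_near x f)"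
  unfolding smooth_near_def smooth_on_def by (meson Ck_on_local)

lemma smooth_near_cong:
  assumes "smooth_near x f" "open S" "x \<in> S" "\<And>y. y \<in> S \<Longrightarrow> f y = g y"
  shows "smooth_near x g"
proof -
  obtain T where "open T" "x \<in> T" "smooth_on T f" using assms by (auto simp: smooth_near_def)
  then have "open (S \<inter> T)" "x \<in> S \<inter> T" "smooth_on (S \<inter> T) g"
    using assms Ck_on_cong[of "S \<inter> T" f g] Ck_on_subset[of _ T f "S \<inter> T"]
    by (auto simp: smooth_on_def)
  then show ?thesis by (auto simp: smooth_near_def)
qed

lemma smooth_near_2:
  assumes "smooth_near x f" "smooth_near x g"
  obtains S where "open S" "x \<in> S" "smooth_on S f" "smooth_on S g"
proof -
  obtain S T where "open S" "x \<in> S" "smooth_on S f" "open T" "x \<in> T" "smooth_on T g"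
    using assms by (auto simp: smooth_near_def)
  then show ?thesis using that[of "S \<inter> T"] by (auto intro: smooth_on_subset)
qed

section \<open>Closure properties of smoothness near a point\<close>

lemma smooth_near_const: "smooth_near x (\<lambda>_. c)"
  by (auto simp: smooth_near_def smooth_on_def intro!: exI[of _ UNIV] Ck_on_const)

lemma smooth_near_linear: "bounded_linear h \<Longrightarrow> smooth_near x h"
  unfolding smooth_near_def smooth_on_def
  by (intro exI[of _ UNIV]) (auto intro: Ck_on_linear_comp[of h UNIV _ "\<lambda>x. x"] Ck_on_ident)

lemma smooth_near_add: "smooth_near x f \<Longrightarrow> smooth_near x g \<Longrightarrow> smooth_near x (\<lambda>y. f y + g y)"
  by (erule (1) smooth_near_2) (auto simp: smooth_near_def smooth_on_def intro!: Ck_on_add)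

lemma smooth_near_scaleR:
  "smooth_near x f \<Longrightarrow> smooth_near x g \<Longrightarrow> smooth_near x (\<lambda>y. f y *\<^sub>R g y)"
  by (erule (1) smooth_near_2) (auto simp: smooth_near_def smooth_on_def intro!: Ck_on_scaleR)

lemma smooth_near_mult:
  "smooth_near x f \<Longrightarrow> smooth_near x g \<Longrightarrow> smooth_near x (\<lambda>y. f y * g y :: real)"
  using smooth_near_scaleR[of x f g] by simp

lemma smooth_near_sum:
  "(\<And>i. i \<in> I \<Longrightarrow> smooth_near x (f i)) \<Longrightarrow> smooth_near x (\<lambda>y. \<Sum>i\<in>I. f i y)"
  by (induction I rule: infinite_finite_induct) (auto intro: smooth_near_add smooth_near_const)

lemma smooth_near_comp:
  fixes f :: "'e::findim_inner \<Rightarrow> 'f::findim_inner"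
  assumes "smooth_near x f" "smooth_near (f x) g"
  shows "smooth_near x (\<lambda>y. g (f y))"
proof -
  obtain S where S: "open S" "x \<in> S" "smooth_on S f" using assms by (auto simp: smooth_near_def)
  obtain T where T: "open T" "f x \<in> T" "smooth_on T g" using assms by (auto simp: smooth_near_def)
  have o: "open (S \<inter> f -` T)"
    using S T smooth_on_continuous continuous_on_open_vimage[OF S(1), of f] by (metis Int_commute)
  have "smooth_on (S \<inter> f -` T) (\<lambda>y. g (f y))"
    unfolding smooth_on_def
    by (intro allI Ck_on_comp[OF o, of _ f T g]) (use S T in \<open>auto simp: smooth_on_def intro: Ck_on_subset\<close>)
  then show ?thesis unfolding smooth_near_def using o S T by blast
qed

text \<open>Reduces maps into a model space to real-valued functions, which are the ones that
  \<open>smooth_at\<close> speaks about.\<close>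

lemma smooth_near_components:
  fixes f :: "'e::findim_inner \<Rightarrow> 'f::findim_inner"
  shows "smooth_near x f \<longleftrightarrow> (\<forall>b\<in>onb. smooth_near x (\<lambda>y. f y \<bullet> b))"
proof
  assume "smooth_near x f"
  then show "\<forall>b\<in>onb. smooth_near x (\<lambda>y. f y \<bullet> b)"
    using smooth_near_comp[OF _ smooth_near_linear[OF bounded_linear_inner_left]] by blast
next
  assume "\<forall>b\<in>onb. smooth_near x (\<lambda>y. f y \<bullet> b)"
  then have "smooth_near x (\<lambda>y. \<Sum>b\<in>onb. (f y \<bullet> b) *\<^sub>R b)"
    by (intro smooth_near_sum smooth_near_scaleR smooth_near_const) auto
  then show "smooth_near x f" by (simp add: onb_expand)
qed

lemma smooth_near_Pair:
  fixes f :: "'e::findim_inner \<Rightarrow> 'f::findim_inner" and g :: "'e \<Rightarrow> 'g::findim_inner"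
  assumes "smooth_near x f" "smooth_near x g"
  shows "smooth_near x (\<lambda>y. (f y, g y))"
proof -
  have "smooth_near x (\<lambda>y. (f y, 0::'g) + (0::'f, g y))"
    by (intro smooth_near_add smooth_near_comp[OF assms(1) smooth_near_linear]
         smooth_near_comp[OF assms(2) smooth_near_linear])
       (auto intro!: bounded_linear_intros)
  then show ?thesis by simp
qed

lemma smooth_near_frechet_derivative:
  "smooth_near x f \<Longrightarrow> smooth_near x (\<lambda>y. frechet_derivative f (at y) v)"
  by (auto simp: smooth_near_def intro: smooth_on_frechet_derivative)

lemma smooth_near_differentiable:
  "smooth_near x f \<Longrightarrow> (f has_derivative frechet_derivative f (at x)) (at x)"
  by (auto simp: smooth_near_def intro: smooth_on_differentiable)

lemma frechet_derivative_cong_open: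
  assumes "smooth_near x f" "open S" "x \<in> S" "\<And>y. y \<in> S \<Longrightarrow> f y = g y"
  shows "frechet_derivative g (at x) = frechet_derivative f (at x)"
  using has_derivative_transform_within_open[OF smooth_near_differentiable[OF assms(1)] assms(2,3,4)]
    frechet_derivative_at by metis

subsection \<open>Hadamard's lemma\<close>

text \<open>Differentiation under the integral sign. The weight t^j closes the induction: the chain
  rule contributes one more factor t, so a directional derivative is the same kind of integral with
  j + 1 and with f replaced by its derivative in that direction.\<close>

lemma integral_parameter_smooth:
  fixes f :: "'e::findim_inner \<Rightarrow> real"
  assumes S: "open S" "convex S" "x0 \<in> S"
  shows "smooth_on S f \<Longrightarrow> Ck_on k S (\<lambda>x. integral {0..1} (\<lambda>t. t ^ j * f (x0 + t *\<^sub>R (x - x0))))"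
proof (induction k arbitrary: f j)
  have mem: "x0 + t *\<^sub>R (x - x0) \<in> S" if "x \<in> S" "t \<in> {0..1}" for x t
    using convexD_alt[OF S(2,3) that(1), of t] that by (simp add: algebra_simps)
  have cont: "continuous_on (S \<times> {0..1}) (\<lambda>(x, t). t ^ j * f (x0 + t *\<^sub>R (x - x0)))"
    if "smooth_on S f" for f :: "'e \<Rightarrow> real" and j :: nat
    unfolding split_beta
    by (intro continuous_intros continuous_on_compose2[OF smooth_on_continuous[OF that]]) (use mem in auto)
  {
    case 0
    have "continuous_on S (\<lambda>x. integral (cbox 0 1) (\<lambda>t. t ^ j * f (x0 + t *\<^sub>R (x - x0))))"
      by (rule integral_continuous_on_param) (use cont[OF 0] in simp)
    then show ?case by simp
  next
    case (Suc k)
    define f' where "f' x = frechet_derivative f (at x)" for x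
    have df: "(f has_derivative f' x) (at x)" if "x \<in> S" for x
      using that Suc.prems unfolding f'_def by (auto intro: smooth_on_differentiable)
    have sm: "smooth_on S (\<lambda>x. f' x v)" for v
      using Suc.prems unfolding f'_def by (rule smooth_on_frechet_derivative)
    \<comment> \<open>The derivative in x as a bounded linear map. Writing it with the functionals
      of \<open>onb\<close> reduces its joint continuity in (x, t) to that of finitely many real
      functions.\<close>
    define fx where "fx x t = (\<Sum>b\<in>onb. (t ^ Suc j * f' (x0 + t *\<^sub>R (x - x0)) b) *\<^sub>R blinfun_inner_right (b::'e))" for x t
    have fx: "blinfun_apply (fx x t) v = t ^ Suc j * f' (x0 + t *\<^sub>R (x - x0)) v" if "x \<in> S" "t \<in> {0..1}" for x t v
    proof -
      have "linear (f' (x0 + t *\<^sub>R (x - x0)))"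
        using df[OF mem[OF that]] has_derivative_linear by blast
      then have "f' (x0 + t *\<^sub>R (x - x0)) v = (\<Sum>b\<in>onb. (v \<bullet> b) *\<^sub>R f' (x0 + t *\<^sub>R (x - x0)) b)"
        by (rule linear_onb)
      then show ?thesis
        by (simp add: fx_def blinfun.sum_left blinfun.scaleR_left sum_distrib_left inner_commute algebra_simps)
    qed
    have cfx: "continuous_on (S \<times> {0..1}) (\<lambda>(x, t). fx x t)"
    proof -
      have "continuous_on (S \<times> {0..1}) (\<lambda>z. snd z ^ Suc j * f' (x0 + snd z *\<^sub>R (fst z - x0)) b)" for b
        using cont[OF sm, of "Suc j" b] by (simp add: split_beta)
      then show ?thesis unfolding fx_def split_beta
        by (intro continuous_on_sum continuous_on_scaleR continuous_on_const)
    qed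
    show ?case
    proof (rule Ck_on_Suc_I[OF S(1), where f' = "\<lambda>x v. integral {0..1} (\<lambda>t. t ^ Suc j * f' (x0 + t *\<^sub>R (x - x0)) v)"])
      fix x assume x: "x \<in> S"
      have D: "((\<lambda>x. integral (cbox 0 1) (\<lambda>t. t ^ j * f (x0 + t *\<^sub>R (x - x0)))) has_derivative
          integral (cbox 0 1) (fx x)) (at x within S)"
      proof (rule leibniz_rule[where fx = fx])
        fix x and t :: real assume xt: "x \<in> S" "t \<in> cbox 0 1"
        then have m: "x0 + t *\<^sub>R (x - x0) \<in> S" using mem by simp
        have aff: "((\<lambda>x. x0 + t *\<^sub>R (x - x0)) has_derivative (\<lambda>v. t *\<^sub>R v)) (at x within S)"
          by (rule derivative_eq_intros refl | simp)+
        have "((\<lambda>x. f (x0 + t *\<^sub>R (x - x0))) has_derivative (\<lambda>v. f' (x0 + t *\<^sub>R (x - x0)) (t *\<^sub>R v))) (at x within S)"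
          by (rule has_derivative_compose[where g = f, OF aff df[OF m]])
        then have "((\<lambda>x. t ^ j * f (x0 + t *\<^sub>R (x - x0))) has_derivative (\<lambda>v. t ^ j * f' (x0 + t *\<^sub>R (x - x0)) (t *\<^sub>R v))) (at x within S)"
          by (rule has_derivative_mult_right)
        moreover have "linear (f' (x0 + t *\<^sub>R (x - x0)))"
          using df[OF m] has_derivative_linear by blast
        then have "(\<lambda>v. t ^ j * f' (x0 + t *\<^sub>R (x - x0)) (t *\<^sub>R v)) = blinfun_apply (fx x t)"
          using fx xt by (auto simp: fun_eq_iff linear_scale)
        ultimately show "((\<lambda>x. t ^ j * f (x0 + t *\<^sub>R (x - x0))) has_derivative blinfun_apply (fx x t)) (at x within S)"
          by simp
      next
        fix x assume "x \<in> S"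
        then have "continuous_on {0..1} (\<lambda>t. t ^ j * f (x0 + t *\<^sub>R (x - x0)))"
          by (intro continuous_intros continuous_on_compose2[OF smooth_on_continuous[OF Suc.prems]]) (use mem in auto)
        then show "(\<lambda>t. t ^ j * f (x0 + t *\<^sub>R (x - x0))) integrable_on cbox 0 1"
          by (simp add: integrable_continuous_real)
      qed (use x S cfx in auto)
      have I: "integral (cbox 0 1) (fx x) v = integral {0..1} (\<lambda>t. t ^ Suc j * f' (x0 + t *\<^sub>R (x - x0)) v)" for v
      proof -
        have "continuous_on {0..1} (\<lambda>t. fx x t)"
          by (rule continuous_on_compose2[OF cfx, where f = "\<lambda>t. (x, t)", simplified]) (use x in \<open>auto intro!: continuous_intros\<close>)
        then have "fx x integrable_on cbox 0 1" by (simp add: integrable_continuous_real)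
        then have "integral (cbox 0 1) (fx x) v = integral (cbox 0 1) (\<lambda>t. fx x t v)"
          by (rule blinfun_apply_integral)
        also have "\<dots> = integral {0..1} (\<lambda>t. t ^ Suc j * f' (x0 + t *\<^sub>R (x - x0)) v)"
          unfolding cbox_interval by (intro integral_cong) (use fx x in auto)
        finally show ?thesis .
      qed
      show "((\<lambda>x. integral {0..1} (\<lambda>t. t ^ j * f (x0 + t *\<^sub>R (x - x0)))) has_derivative
          (\<lambda>v. integral {0..1} (\<lambda>t. t ^ Suc j * f' (x0 + t *\<^sub>R (x - x0)) v))) (at x)"
        using D[unfolded cbox_interval] unfolding ext[OF I[unfolded cbox_interval]] at_within_open[OF x S(1)] .
    next
      show "Ck_on k S (\<lambda>x. integral {0..1} (\<lambda>t. t ^ Suc j * f' (x0 + t *\<^sub>R (x - x0)) v))" for v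
        by (rule Suc.IH[OF sm])
    qed
  }
qed

text \<open>h_b x is the mean of the b-th partial derivative over the segment from x0 to x, and the
  expansion is the fundamental theorem of calculus on that segment. Both the coordinate form of
  derivations and the symmetry of mixed derivatives come from here.\<close>

lemma Hadamard:
  fixes f :: "'e::findim_inner \<Rightarrow> real"
  assumes "smooth_near x0 f"
  obtains S h where "open S" "x0 \<in> S" "\<And>b. smooth_near x0 (h b)"
    "\<And>x. x \<in> S \<Longrightarrow> f x = f x0 + (\<Sum>b\<in>onb. ((x - x0) \<bullet> b) * h b x)"
    "\<And>b. h b x0 = frechet_derivative f (at x0) b"
proof -
  obtain S0 where S0: "open S0" "x0 \<in> S0" "smooth_on S0 f"
    using assms by (auto simp: smooth_near_def)
  then obtain e where e: "e > 0" "ball x0 e \<subseteq> S0" by (meson openE)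
  \<comment> \<open>A ball is convex, so the segments from x0 stay inside.\<close>
  define S where "S = ball x0 e"
  have S: "open S" "convex S" "x0 \<in> S" "smooth_on S f"
    using e S0 by (auto simp: S_def intro: smooth_on_subset)
  define f' where "f' x = frechet_derivative f (at x)" for x
  have df: "(f has_derivative f' x) (at x)" if "x \<in> S" for x
    using that S unfolding f'_def by (auto intro: smooth_on_differentiable)
  have sm: "smooth_on S (\<lambda>x. f' x v)" for v
    using S unfolding f'_def by (auto intro: smooth_on_frechet_derivative)
  \<comment> \<open>The factor t ^ 0 matches the shape of
    \<open>integral_parameter_smooth\<close>.\<close>
  define h where "h b x = integral {0..1} (\<lambda>t. t ^ 0 * f' (x0 + t *\<^sub>R (x - x0)) b)" for b x
  show ?thesis
  proof (rule that[OF S(1,3)])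
    show "smooth_near x0 (h b)" for b
      unfolding smooth_near_def smooth_on_def h_def
      using integral_parameter_smooth[OF S(1-3) sm] S by blast
    show "h b x0 = frechet_derivative f (at x0) b" for b
      by (simp add: h_def f'_def)
    fix x assume x: "x \<in> S"
    have mem: "x0 + t *\<^sub>R (x - x0) \<in> S" if "t \<in> {0..1}" for t
      using convexD_alt[OF S(2,3) x, of t] that by (simp add: algebra_simps)
    have "((\<lambda>t. f' (x0 + t *\<^sub>R (x - x0)) (x - x0)) has_integral (f (x0 + 1 *\<^sub>R (x - x0)) - f (x0 + 0 *\<^sub>R (x - x0)))) {0..1}"
    proof (rule fundamental_theorem_of_calculus)
      fix t :: real assume t: "t \<in> {0..1}"
      have aff: "((\<lambda>t. x0 + t *\<^sub>R (x - x0)) has_derivative (\<lambda>s. s *\<^sub>R (x - x0))) (at t within {0..1})"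
        by (rule derivative_eq_intros refl | simp)+
      have "((\<lambda>t. f (x0 + t *\<^sub>R (x - x0))) has_derivative (\<lambda>s. f' (x0 + t *\<^sub>R (x - x0)) (s *\<^sub>R (x - x0)))) (at t within {0..1})"
        by (rule has_derivative_compose[where g = f, OF aff df[OF mem[OF t]]])
      moreover have "linear (f' (x0 + t *\<^sub>R (x - x0)))"
        using df[OF mem[OF t]] has_derivative_linear by blast
      ultimately show "((\<lambda>t. f (x0 + t *\<^sub>R (x - x0))) has_vector_derivative f' (x0 + t *\<^sub>R (x - x0)) (x - x0)) (at t within {0..1})"
        by (simp add: has_vector_derivative_def linear_scale)
    qed simp
    then have "f x - f x0 = integral {0..1} (\<lambda>t. f' (x0 + t *\<^sub>R (x - x0)) (x - x0))"
      by (simp add: integral_unique)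
    also have "\<dots> = integral {0..1} (\<lambda>t. \<Sum>b\<in>onb. ((x - x0) \<bullet> b) * f' (x0 + t *\<^sub>R (x - x0)) b)"
    proof (rule integral_cong)
      fix t :: real assume t: "t \<in> {0..1}"
      have "linear (f' (x0 + t *\<^sub>R (x - x0)))"
        using df[OF mem[OF t]] has_derivative_linear by blast
      from linear_onb[OF this, of "x - x0"]
      show "f' (x0 + t *\<^sub>R (x - x0)) (x - x0) = (\<Sum>b\<in>onb. ((x - x0) \<bullet> b) * f' (x0 + t *\<^sub>R (x - x0)) b)"
        by simp
    qed
    also have "\<dots> = (\<Sum>b\<in>onb. ((x - x0) \<bullet> b) * h b x)"
    proof -
      have c: "continuous_on {0..1} (\<lambda>t. f' (x0 + t *\<^sub>R (x - x0)) b)" for b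
        by (intro continuous_on_compose2[OF smooth_on_continuous[OF sm]]) (use mem in \<open>auto intro!: continuous_intros\<close>)
      have "(\<lambda>t. ((x - x0) \<bullet> b) * f' (x0 + t *\<^sub>R (x - x0)) b) integrable_on {0..1}" for b
        by (intro integrable_continuous_real continuous_on_mult_left c)
      then show ?thesis
        by (subst integral_sum) (auto simp: h_def)
    qed
    finally show "f x = f x0 + (\<Sum>b\<in>onb. ((x - x0) \<bullet> b) * h b x)" by simp
  qed
qed

section \<open>Manifolds\<close>

lemma sum_fun_apply: "(\<Sum>i\<in>I. g i) x = (\<Sum>i\<in>I. g i x)"
  by (induction I rule: infinite_finite_induct) auto

text \<open>Isolates the axioms on charts, which are what gets verified to turn products and
  cotangent bundles into instances of the same theory.\<close>

locale mfd =
  fixes A :: "('a, 'e::findim_inner) atlas"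
  assumes inj_chart: "(U, \<phi>) \<in> A \<Longrightarrow> inj_on \<phi> U"
    and open_chart: "(U, \<phi>) \<in> A \<Longrightarrow> open (\<phi> ` U)"
    and open_overlap: "(U, \<phi>) \<in> A \<Longrightarrow> (V, \<psi>) \<in> A \<Longrightarrow> open (\<phi> ` (U \<inter> V))"
    and smooth_transition:
      "(U, \<phi>) \<in> A \<Longrightarrow> (V, \<psi>) \<in> A \<Longrightarrow> smooth_on (\<phi> ` (U \<inter> V)) (\<psi> \<circ> inv_into U \<phi>)"

lemma smooth_manifold_mfd: "smooth_manifold A \<Longrightarrow> mfd A"
  unfolding smooth_manifold_def mfd_def by blast

context mfd
begin

subsection \<open>Topology and smooth functions\<close>

lemma inv_chart [simp]: "(U, \<phi>) \<in> A \<Longrightarrow> p \<in> U \<Longrightarrow> inv_into U \<phi> (\<phi> p) = p"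
  using inj_chart by (simp add: inv_into_f_f)

lemma points_chart: "p \<in> points A \<Longrightarrow> \<exists>U \<phi>. (U, \<phi>) \<in> A \<and> p \<in> U"
  by (force simp: points_def)

lemma chart_points: "(U, \<phi>) \<in> A \<Longrightarrow> p \<in> U \<Longrightarrow> p \<in> points A"
  by (force simp: points_def)

lemma transition_near:
  assumes "(U, \<phi>) \<in> A" "(V, \<psi>) \<in> A" "p \<in> U" "p \<in> V"
  shows "smooth_near (\<phi> p) (\<psi> \<circ> inv_into U \<phi>)"
  using smooth_transition[OF assms(1,2)] open_overlap[OF assms(1,2)] assms
  by (auto simp: smooth_on_iff_near)

lemma mopen_subset: "mopen A W \<Longrightarrow> p \<in> W \<Longrightarrow> p \<in> points A"
  by (auto simp: mopen_def)

lemma mopen_image: "mopen A W \<Longrightarrow> (U, \<phi>) \<in> A \<Longrightarrow> open (\<phi> ` (W \<inter> U))"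
  by (auto simp: mopen_def)

lemma mopen_Int: "mopen A S \<Longrightarrow> mopen A T \<Longrightarrow> mopen A (S \<inter> T)"
proof -
  assume ST: "mopen A S" "mopen A T"
  have "open (\<phi> ` (S \<inter> T \<inter> U))" if U: "(U, \<phi>) \<in> A" for U \<phi>
  proof -
    have "\<phi> ` (S \<inter> T \<inter> U) = \<phi> ` (S \<inter> U) \<inter> \<phi> ` (T \<inter> U)"
      using inj_on_image_Int[OF inj_chart[OF U], of "S \<inter> U" "T \<inter> U"]
      by (simp add: Int_ac)
    then show ?thesis using ST U by (auto simp: mopen_def)
  qed
  then show "mopen A (S \<inter> T)" using ST by (auto simp: mopen_def)
qed

lemma mopen_points: "mopen A (points A)"
proof -
  have "points A \<inter> U = U" if "(U, \<phi>) \<in> A" for U and \<phi> :: "'a \<Rightarrow> 'e"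
    using that by (force simp: points_def)
  then show ?thesis by (auto simp: mopen_def open_chart)
qed

lemma mopen_chart: "(U, \<phi>) \<in> A \<Longrightarrow> mopen A U"
  using open_overlap by (force simp: mopen_def points_def Int_commute)

text \<open>Charts are continuous for the topology of the atlas: read in another chart, the set is
  the preimage of T under a transition map.\<close>

lemma mopen_chart_preimage:
  assumes "(U, \<phi>) \<in> A" "open T"
  shows "mopen A {q \<in> U. \<phi> q \<in> T}"
proof -
  have "open (\<psi> ` ({q \<in> U. \<phi> q \<in> T} \<inter> V))" if V: "(V, \<psi>) \<in> A" for V \<psi>
  proof -
    have "\<psi> ` ({q \<in> U. \<phi> q \<in> T} \<inter> V) = (\<phi> \<circ> inv_into V \<psi>) -` T \<inter> \<psi> ` (V \<inter> U)"
      using V by auto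
    moreover have "open \<dots>"
      using continuous_on_open_vimage[OF open_overlap[OF V assms(1)]]
        smooth_on_continuous[OF smooth_transition[OF V assms(1)]] assms(2) by blast
    ultimately show ?thesis by simp
  qed
  then show ?thesis using chart_points[OF assms(1)] by (auto simp: mopen_def)
qed

text \<open>A single chart suffices to test smoothness at a point, because composition with the
  transition maps carries it to all other charts on a whole neighbourhood.\<close>

lemma smooth_at_chart:
  assumes U: "(U, \<phi>) \<in> A" "p \<in> U"
  shows "smooth_at A p f \<longleftrightarrow> smooth_near (\<phi> p) (f \<circ> inv_into U \<phi>)"
proof
  assume "smooth_at A p f"
  then obtain W where W: "p \<in> W" "mopen A W" "smooth_on (\<phi> ` (W \<inter> U)) (f \<circ> inv_into U \<phi>)"
    using U by (fastforce simp: smooth_at_def smooth_fun_def)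
  then show "smooth_near (\<phi> p) (f \<circ> inv_into U \<phi>)"
    using mopen_image[OF W(2) U(1)] U(2) by (auto simp: smooth_near_def)
next
  assume "smooth_near (\<phi> p) (f \<circ> inv_into U \<phi>)"
  then obtain T where T: "open T" "\<phi> p \<in> T" "smooth_on T (f \<circ> inv_into U \<phi>)"
    by (auto simp: smooth_near_def)
  define W where "W = {q \<in> U. \<phi> q \<in> T}"
  have W: "mopen A W" "p \<in> W"
    using mopen_chart_preimage[OF U(1) T(1)] U T by (auto simp: W_def)
  have "smooth_on (\<psi> ` (W \<inter> V)) (f \<circ> inv_into V \<psi>)" if V: "(V, \<psi>) \<in> A" for V \<psi>
  proof -
    have "smooth_near (\<psi> q) (f \<circ> inv_into V \<psi>)" if q: "q \<in> W" "q \<in> V" for q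
    proof (rule smooth_near_cong[OF _ open_overlap[OF V U(1)]])
      have qU: "q \<in> U" using q by (auto simp: W_def)
      have "smooth_near (\<phi> q) (f \<circ> inv_into U \<phi>)"
        using q T by (auto simp: W_def smooth_near_def)
      then show "smooth_near (\<psi> q) (\<lambda>y. (f \<circ> inv_into U \<phi>) ((\<phi> \<circ> inv_into V \<psi>) y))"
        using smooth_near_comp[OF transition_near[OF V U(1) q(2) qU], of "f \<circ> inv_into U \<phi>"] V q by simp
      show "\<psi> q \<in> \<psi> ` (V \<inter> U)" using q qU by auto
      fix y assume "y \<in> \<psi> ` (V \<inter> U)"
      then show "(f \<circ> inv_into U \<phi>) ((\<phi> \<circ> inv_into V \<psi>) y) = (f \<circ> inv_into V \<psi>) y"
        using U V by auto
    qed
    then show ?thesis using mopen_image[OF W(1) V] by (auto simp: smooth_on_iff_near)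
  qed
  then have "smooth_fun A W f" using W by (auto simp: smooth_fun_def)
  then show "smooth_at A p f" using W by (auto simp: smooth_at_def)
qed

lemma smooth_fun_iff: "smooth_fun A W f \<longleftrightarrow> mopen A W \<and> (\<forall>p\<in>W. smooth_at A p f)"
proof
  assume "smooth_fun A W f"
  then show "mopen A W \<and> (\<forall>p\<in>W. smooth_at A p f)"
    by (auto simp: smooth_at_def smooth_fun_def)
next
  assume W: "mopen A W \<and> (\<forall>p\<in>W. smooth_at A p f)"
  have "smooth_on (\<phi> ` (W \<inter> U)) (f \<circ> inv_into U \<phi>)" if U: "(U, \<phi>) \<in> A" for U \<phi>
    using W mopen_image[OF _ U, of W] smooth_at_chart[OF U] by (auto simp: smooth_on_iff_near)
  then show "smooth_fun A W f" using W by (auto simp: smooth_fun_def)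
qed

lemma smooth_at_points: "smooth_at A p f \<Longrightarrow> p \<in> points A"
  by (auto simp: smooth_at_def smooth_fun_def mopen_def)

lemma smooth_at_nbhd: "smooth_at A p f \<Longrightarrow> \<exists>W. mopen A W \<and> p \<in> W \<and> (\<forall>q\<in>W. smooth_at A q f)"
  unfolding smooth_at_def by (metis smooth_fun_iff smooth_at_def)

lemma smooth_at_cong:
  assumes "smooth_at A p f" "mopen A W" "p \<in> W" "\<And>q. q \<in> W \<Longrightarrow> f q = g q"
  shows "smooth_at A p g"
proof -
  obtain U \<phi> where U: "(U, \<phi>) \<in> A" "p \<in> U" using points_chart smooth_at_points assms(1) by blast
  have "smooth_near (\<phi> p) (g \<circ> inv_into U \<phi>)"
    by (rule smooth_near_cong[OF assms(1)[unfolded smooth_at_chart[OF U]] mopen_image[OF assms(2) U(1)]])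
       (use assms U in auto)
  then show ?thesis using smooth_at_chart[OF U] by simp
qed

lemma smooth_at_const: "p \<in> points A \<Longrightarrow> smooth_at A p (\<lambda>_. c)"
  using points_chart[of p] smooth_at_chart[of _ _ p "\<lambda>_. c"]
  by (auto simp: o_def intro: smooth_near_const)

lemma smooth_at_add: "smooth_at A p f \<Longrightarrow> smooth_at A p g \<Longrightarrow> smooth_at A p (\<lambda>q. f q + g q)"
  using points_chart[of p] smooth_at_chart[of _ _ p] smooth_at_points[of p f]
  by (auto simp: o_def intro: smooth_near_add)

lemma smooth_at_mult: "smooth_at A p f \<Longrightarrow> smooth_at A p g \<Longrightarrow> smooth_at A p (\<lambda>q. f q * g q)"
  using points_chart[of p] smooth_at_chart[of _ _ p] smooth_at_points[of p f]
  by (auto simp: o_def intro: smooth_near_mult)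

lemma smooth_at_cmult: "smooth_at A p f \<Longrightarrow> smooth_at A p (\<lambda>q. c * f q)"
  by (intro smooth_at_mult smooth_at_const) (auto intro: smooth_at_points)

lemma smooth_at_diff: "smooth_at A p f \<Longrightarrow> smooth_at A p g \<Longrightarrow> smooth_at A p (\<lambda>q. f q - g q)"
  using smooth_at_add[of p f "\<lambda>q. (-1) * g q"] smooth_at_cmult[of p g "-1"] by simp

lemma smooth_at_sum:
  "p \<in> points A \<Longrightarrow> (\<And>i. i \<in> I \<Longrightarrow> smooth_at A p (f i)) \<Longrightarrow> smooth_at A p (\<lambda>q. \<Sum>i\<in>I. f i q)"
  by (induction I rule: infinite_finite_induct) (auto intro: smooth_at_const smooth_at_add)

lemma smooth_at_chart_comp:
  assumes "(U, \<phi>) \<in> A" "p \<in> U" "smooth_near (\<phi> p) g"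
  shows "smooth_at A p (\<lambda>q. g (\<phi> q))"
  unfolding smooth_at_chart[OF assms(1,2)]
  by (rule smooth_near_cong[OF assms(3) open_chart[OF assms(1)]]) (use assms in auto)

lemma smooth_at_coord: "(U, \<phi>) \<in> A \<Longrightarrow> p \<in> U \<Longrightarrow> smooth_at A p (\<lambda>q. \<phi> q \<bullet> b)"
  by (rule smooth_at_chart_comp) (auto intro: smooth_near_linear bounded_linear_inner_left)

lemma smooth_at_preimage:
  assumes "smooth_at A p f" "open T" "f p \<in> T"
  shows "\<exists>W. mopen A W \<and> p \<in> W \<and> (\<forall>q\<in>W. f q \<in> T)"
proof -
  obtain U \<phi> where U: "(U, \<phi>) \<in> A" "p \<in> U" using points_chart smooth_at_points assms(1) by blast
  obtain S where S: "open S" "\<phi> p \<in> S" "smooth_on S (f \<circ> inv_into U \<phi>)"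
    using assms smooth_at_chart[OF U] by (auto simp: smooth_near_def)
  have "open ((f \<circ> inv_into U \<phi>) -` T \<inter> S)"
    using continuous_on_open_vimage[OF S(1)] smooth_on_continuous[OF S(3)] assms(2) by blast
  then have "mopen A {q \<in> U. \<phi> q \<in> (f \<circ> inv_into U \<phi>) -` T \<inter> S}"
    by (rule mopen_chart_preimage[OF U(1)])
  moreover have "p \<in> {q \<in> U. \<phi> q \<in> (f \<circ> inv_into U \<phi>) -` T \<inter> S}"
    using U S(2) assms(3) by simp
  moreover have "f q \<in> T" if "q \<in> {q \<in> U. \<phi> q \<in> (f \<circ> inv_into U \<phi>) -` T \<inter> S}" for q
    using that inv_chart[OF U(1)] by auto
  ultimately show ?thesis by blast
qed

subsection \<open>Tangent vectors\<close>

lemma tv_add: "v \<in> tangent_space A p \<Longrightarrow> smooth_at A p f \<Longrightarrow> smooth_at A p g \<Longrightarrow> v (\<lambda>q. f q + g q) = v f + v g"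
proof -
  have "(\<lambda>q. f q + g q) = f + g" by auto
  then show "v \<in> tangent_space A p \<Longrightarrow> smooth_at A p f \<Longrightarrow> smooth_at A p g \<Longrightarrow> v (\<lambda>q. f q + g q) = v f + v g"
    by (simp add: tangent_space_def)
qed

lemma tv_mult:
  "v \<in> tangent_space A p \<Longrightarrow> smooth_at A p f \<Longrightarrow> smooth_at A p g \<Longrightarrow> v (\<lambda>q. f q * g q) = f p * v g + g p * v f"
proof -
  have "(\<lambda>q. f q * g q) = f * g" by auto
  then show "v \<in> tangent_space A p \<Longrightarrow> smooth_at A p f \<Longrightarrow> smooth_at A p g \<Longrightarrow> v (\<lambda>q. f q * g q) = f p * v g + g p * v f"
    by (simp add: tangent_space_def)
qed

lemma tv_cmult: "v \<in> tangent_space A p \<Longrightarrow> smooth_at A p f \<Longrightarrow> v (\<lambda>q. c * f q) = c * v f"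
  unfolding tangent_space_def fscale_def by blast

lemma tv_not_smooth: "v \<in> tangent_space A p \<Longrightarrow> \<not> smooth_at A p f \<Longrightarrow> v f = 0"
  by (simp add: tangent_space_def)

lemma tangent_spaceI:
  assumes "\<And>f g. smooth_at A p f \<Longrightarrow> smooth_at A p g \<Longrightarrow> v (\<lambda>q. f q + g q) = v f + v g"
    and "\<And>f g. smooth_at A p f \<Longrightarrow> smooth_at A p g \<Longrightarrow> v (\<lambda>q. f q * g q) = f p * v g + g p * v f"
    and "\<And>c f. smooth_at A p f \<Longrightarrow> v (\<lambda>q. c * f q) = c * v f"
    and "\<And>f. \<not> smooth_at A p f \<Longrightarrow> v f = 0"
  shows "v \<in> tangent_space A p"
  using assms unfolding tangent_space_def fscale_def plus_fun_def times_fun_def by blast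

lemma tangent_eqI:
  assumes "v \<in> tangent_space A p" "w \<in> tangent_space A p" "\<And>f. smooth_at A p f \<Longrightarrow> v f = w f"
  shows "v = w"
  using assms tv_not_smooth by (metis ext)

lemma tv_const:
  assumes "v \<in> tangent_space A p" "p \<in> points A"
  shows "v (\<lambda>_. c) = 0"
proof -
  have s: "smooth_at A p (\<lambda>_. c)" for c by (simp add: assms smooth_at_const)
  have "v (\<lambda>_. 1) = 0" using tv_mult[OF assms(1) s s, of 1 1] by simp
  then show ?thesis using tv_cmult[OF assms(1) s, of c 1] by simp
qed

lemma tv_diff:
  "v \<in> tangent_space A p \<Longrightarrow> smooth_at A p f \<Longrightarrow> smooth_at A p g \<Longrightarrow> v (\<lambda>q. f q - g q) = v f - v g"
  using tv_add[of v p f "\<lambda>q. (-1) * g q"] tv_cmult[of v p g "-1"] smooth_at_cmult[of p g "-1"] by simp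

lemma tv_sum:
  assumes v: "v \<in> tangent_space A p" and p: "p \<in> points A" and f: "\<And>i. i \<in> I \<Longrightarrow> smooth_at A p (f i)"
  shows "v (\<lambda>q. \<Sum>i\<in>I. f i q) = (\<Sum>i\<in>I. v (f i))"
  using f
proof (induction I rule: infinite_finite_induct)
  case (insert x F)
  then show ?case by (simp add: tv_add[OF v] smooth_at_sum[OF p])
qed (auto simp: tv_const[OF v p])

text \<open>Locality of derivations. The indicator function of W is smooth at p and idempotent, so
  the Leibniz rule gives v ind = 2 * v ind, hence v ind = 0. Multiplication by it preserves v f and
  v g and makes the two functions equal everywhere. This works because smoothness at p does not
  restrict a function away from p.\<close>

lemma tv_cong:
  assumes v: "v \<in> tangent_space A p" and W: "mopen A W" "p \<in> W" and f: "smooth_at A p f"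
    and eq: "\<And>q. q \<in> W \<Longrightarrow> f q = g q"
  shows "v f = v g"
proof -
  define ind :: "'a \<Rightarrow> real" where "ind = (\<lambda>q. if q \<in> W then 1 else 0)"
  have ind: "smooth_at A p ind"
    using mopen_subset[OF W] by (intro smooth_at_cong[OF smooth_at_const[of p 1] W]) (auto simp: ind_def)
  have g: "smooth_at A p g" by (rule smooth_at_cong[OF f W eq])
  have "v (\<lambda>q. ind q * ind q) = 2 * v ind" using tv_mult[OF v ind ind] W by (simp add: ind_def)
  moreover have "(\<lambda>q. ind q * ind q) = ind" by (auto simp: ind_def)
  ultimately have "v ind = 0" by simp
  then have "v (\<lambda>q. ind q * f q) = v f" "v (\<lambda>q. ind q * g q) = v g"
    using tv_mult[OF v ind] f g W by (auto simp: ind_def)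
  moreover have "(\<lambda>q. ind q * f q) = (\<lambda>q. ind q * g q)" using eq by (auto simp: ind_def)
  ultimately show ?thesis by simp
qed

lemma tangent_zero: "0 \<in> tangent_space A p"
  by (rule tangent_spaceI) auto

lemma tangent_add: "v \<in> tangent_space A p \<Longrightarrow> w \<in> tangent_space A p \<Longrightarrow> v + w \<in> tangent_space A p"
  by (rule tangent_spaceI) (auto simp: tv_add tv_mult tv_cmult tv_not_smooth algebra_simps)

lemma tangent_scale: "v \<in> tangent_space A p \<Longrightarrow> fscale c v \<in> tangent_space A p"
  by (rule tangent_spaceI) (auto simp: fscale_def tv_add tv_mult tv_cmult tv_not_smooth algebra_simps)

lemma tangent_uminus: "v \<in> tangent_space A p \<Longrightarrow> - v \<in> tangent_space A p"
  by (rule tangent_spaceI) (auto simp: tv_add tv_mult tv_cmult tv_not_smooth algebra_simps)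

lemma tangent_diff: "v \<in> tangent_space A p \<Longrightarrow> w \<in> tangent_space A p \<Longrightarrow> v - w \<in> tangent_space A p"
  using tangent_add[of v p "- w"] tangent_uminus[of w p] by simp

lemma tangent_sum: "(\<And>i. i \<in> I \<Longrightarrow> v i \<in> tangent_space A p) \<Longrightarrow> (\<Sum>i\<in>I. v i) \<in> tangent_space A p"
  by (induction I rule: infinite_finite_induct) (auto intro: tangent_zero tangent_add simp: tangent_zero[unfolded zero_fun_def])

section \<open>Coordinate vectors and the coordinate expansion of derivations\<close>

lemma coord_vec_apply:
  "smooth_at A p f \<Longrightarrow> coord_vec A U \<phi> p b f = frechet_derivative (f \<circ> inv_into U \<phi>) (at (\<phi> p)) b"
  by (simp add: coord_vec_def)

lemma coord_vec_has_derivative: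
  assumes "(U, \<phi>) \<in> A" "p \<in> U" "smooth_at A p f"
  shows "((f \<circ> inv_into U \<phi>) has_derivative (\<lambda>b. coord_vec A U \<phi> p b f)) (at (\<phi> p))"
  using smooth_near_differentiable[of "\<phi> p" "f \<circ> inv_into U \<phi>"] assms
  by (simp add: coord_vec_apply smooth_at_chart[OF assms(1,2)] eta_contract_eq)

lemma coord_vec_unique:
  assumes "(U, \<phi>) \<in> A" "p \<in> U" "smooth_at A p f" "((f \<circ> inv_into U \<phi>) has_derivative D) (at (\<phi> p))"
  shows "coord_vec A U \<phi> p b f = D b"
  using has_derivative_unique[OF coord_vec_has_derivative[OF assms(1-3)] assms(4)] by metis

lemma coord_vec_tangent:
  assumes U: "(U, \<phi>) \<in> A" "p \<in> U"
  shows "coord_vec A U \<phi> p b \<in> tangent_space A p"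
proof (rule tangent_spaceI)
  fix f g assume s: "smooth_at A p f" "smooth_at A p g"
  note D = s[THEN coord_vec_has_derivative[OF U]]
  show "coord_vec A U \<phi> p b (\<lambda>q. f q + g q) = coord_vec A U \<phi> p b f + coord_vec A U \<phi> p b g"
    using has_derivative_add[OF D]
    by (intro coord_vec_unique[OF U]) (auto simp: s smooth_at_add o_def)
  have "((f \<circ> inv_into U \<phi>) \<circ> \<phi>) p = f p" "((g \<circ> inv_into U \<phi>) \<circ> \<phi>) p = g p" using U by auto
  then show "coord_vec A U \<phi> p b (\<lambda>q. f q * g q) = f p * coord_vec A U \<phi> p b g + g p * coord_vec A U \<phi> p b f"
    using has_derivative_mult[OF D]
    by (intro coord_vec_unique[OF U]) (auto simp: s smooth_at_mult o_def mult.commute)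
next
  fix c f assume s: "smooth_at A p f"
  show "coord_vec A U \<phi> p b (\<lambda>q. c * f q) = c * coord_vec A U \<phi> p b f"
    using has_derivative_mult_right[OF coord_vec_has_derivative[OF U s], of c]
    by (intro coord_vec_unique[OF U]) (auto simp: s smooth_at_cmult o_def)
qed (simp add: coord_vec_def)

lemma coord_vec_chart:
  assumes U: "(U, \<phi>) \<in> A" "p \<in> U" and g: "smooth_near (\<phi> p) g"
  shows "coord_vec A U \<phi> p b (\<lambda>q. g (\<phi> q)) = frechet_derivative g (at (\<phi> p)) b"
proof -
  have "frechet_derivative ((\<lambda>q. g (\<phi> q)) \<circ> inv_into U \<phi>) (at (\<phi> p)) = frechet_derivative g (at (\<phi> p))"
    by (rule frechet_derivative_cong_open[OF g open_chart[OF U(1)]]) (use U in auto)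
  then show ?thesis by (simp add: coord_vec_apply smooth_at_chart_comp[OF assms])
qed

lemma coord_vec_coord:
  assumes "(U, \<phi>) \<in> A" "p \<in> U"
  shows "coord_vec A U \<phi> p b (\<lambda>q. \<phi> q \<bullet> c) = b \<bullet> c"
proof -
  have "frechet_derivative (\<lambda>x. x \<bullet> c) (at (\<phi> p)) = (\<lambda>x. x \<bullet> c)"
    using frechet_derivative_at bounded_linear_imp_has_derivative[OF bounded_linear_inner_left] by metis
  then show ?thesis
    using coord_vec_chart[OF assms, of "\<lambda>x. x \<bullet> c"] by (simp add: smooth_near_linear bounded_linear_inner_left)
qed

lemma coord_vec_onb:
  assumes "(U, \<phi>) \<in> A" "p \<in> U"
  shows "coord_vec A U \<phi> p x f = (\<Sum>b\<in>onb. (x \<bullet> b) * coord_vec A U \<phi> p b f)"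
proof (cases "smooth_at A p f")
  case True
  have "linear (\<lambda>b. coord_vec A U \<phi> p b f)"
    using has_derivative_linear[OF coord_vec_has_derivative[OF assms True]] .
  from linear_onb[OF this, of x] show ?thesis by simp
qed (simp add: coord_vec_def)

lemma coord_vec_smooth:
  assumes U: "(U, \<phi>) \<in> A" "p \<in> U" and f: "smooth_at A p f"
  shows "smooth_at A p (\<lambda>q. coord_vec A U \<phi> q b f)"
proof -
  obtain W where W: "mopen A W" "p \<in> W" "\<And>q. q \<in> W \<Longrightarrow> smooth_at A q f"
    using smooth_at_nbhd[OF f] by blast
  have "smooth_at A p (\<lambda>q. frechet_derivative (f \<circ> inv_into U \<phi>) (at (\<phi> q)) b)"
    by (rule smooth_at_chart_comp[OF U smooth_near_frechet_derivative[OF f[unfolded smooth_at_chart[OF U]]]])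
  then show ?thesis
    by (rule smooth_at_cong[OF _ W(1,2)]) (simp add: W(3) coord_vec_apply)
qed

lemma Hadamard_chart:
  assumes U: "(U, \<phi>) \<in> A" "p \<in> U" and f: "smooth_at A p f"
  obtains W h where "mopen A W" "p \<in> W" "\<And>b. smooth_at A p (h b)"
    "\<And>q. q \<in> W \<Longrightarrow> f q = f p + (\<Sum>b\<in>onb. ((\<phi> q - \<phi> p) \<bullet> b) * h b q)"
    "\<And>b. h b p = coord_vec A U \<phi> p b f"
proof -
  obtain S h where S: "open S" "\<phi> p \<in> S" and h: "\<And>b. smooth_near (\<phi> p) (h b)"
    and eq: "\<And>x. x \<in> S \<Longrightarrow> (f \<circ> inv_into U \<phi>) x = (f \<circ> inv_into U \<phi>) (\<phi> p) + (\<Sum>b\<in>onb. ((x - \<phi> p) \<bullet> b) * h b x)"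
    and h0: "\<And>b. h b (\<phi> p) = frechet_derivative (f \<circ> inv_into U \<phi>) (at (\<phi> p)) b"
    by (rule Hadamard[OF f[unfolded smooth_at_chart[OF U]]]) (rule that)
  show ?thesis
  proof (rule that[OF mopen_chart_preimage[OF U(1) S(1)], of "\<lambda>b q. h b (\<phi> q)"])
    show "smooth_at A p (\<lambda>q. h b (\<phi> q))" for b by (rule smooth_at_chart_comp[OF U h])
    show "f q = f p + (\<Sum>b\<in>onb. ((\<phi> q - \<phi> p) \<bullet> b) * h b (\<phi> q))" if "q \<in> {q \<in> U. \<phi> q \<in> S}" for q
      using eq[of "\<phi> q"] that U by simp
    show "h b (\<phi> p) = coord_vec A U \<phi> p b f" for b
      by (simp add: h0 coord_vec_apply[OF f])
  qed (use U S in auto)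
qed

text \<open>Apply v to the Hadamard decomposition of f. The coordinate differences vanish at p, so
  the Leibniz rule leaves v of the coordinate times h_b p, and h_b p is the partial derivative of f.
  For f not smooth at p both sides are 0 by convention, so the identity holds for every f.\<close>

lemma tangent_expand:
  assumes U: "(U, \<phi>) \<in> A" "p \<in> U" and v: "v \<in> tangent_space A p"
  shows "v f = (\<Sum>b\<in>onb. v (\<lambda>q. \<phi> q \<bullet> b) * coord_vec A U \<phi> p b f)"
proof (cases "smooth_at A p f")
  case True
  have p: "p \<in> points A" using U chart_points by blast
  obtain W h where W: "mopen A W" "p \<in> W" and sh: "\<And>b. smooth_at A p (h b)"
    and eq: "\<And>q. q \<in> W \<Longrightarrow> f q = f p + (\<Sum>b\<in>onb. ((\<phi> q - \<phi> p) \<bullet> b) * h b q)"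
    and h: "\<And>b. h b p = coord_vec A U \<phi> p b f"
    by (rule Hadamard_chart[OF U True]) (rule that)
  have sx: "smooth_at A p (\<lambda>q. (\<phi> q - \<phi> p) \<bullet> b)" for b
    unfolding inner_diff_left by (intro smooth_at_diff smooth_at_coord[OF U] smooth_at_const p)
  have vx: "v (\<lambda>q. (\<phi> q - \<phi> p) \<bullet> b) = v (\<lambda>q. \<phi> q \<bullet> b)" for b
    unfolding inner_diff_left
    by (subst tv_diff[OF v]) (auto simp: tv_const[OF v p] smooth_at_coord[OF U] smooth_at_const p)
  have "v f = v (\<lambda>q. f p + (\<Sum>b\<in>onb. ((\<phi> q - \<phi> p) \<bullet> b) * h b q))"
    by (rule tv_cong[OF v W True eq])
  also have "\<dots> = (\<Sum>b\<in>onb. v (\<lambda>q. ((\<phi> q - \<phi> p) \<bullet> b) * h b q))"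
    by (subst tv_add[OF v]) (auto simp: tv_const[OF v p] tv_sum[OF v p] smooth_at_const smooth_at_sum smooth_at_mult sh sx p)
  also have "\<dots> = (\<Sum>b\<in>onb. v (\<lambda>q. \<phi> q \<bullet> b) * coord_vec A U \<phi> p b f)"
    by (intro sum.cong refl) (simp add: tv_mult[OF v sx sh] vx h)
  finally show ?thesis .
qed (simp add: coord_vec_def tv_not_smooth[OF v])

lemma tangent_expand_sum:
  assumes "(U, \<phi>) \<in> A" "p \<in> U" "v \<in> tangent_space A p"
  shows "v = (\<Sum>b\<in>onb. fscale (v (\<lambda>q. \<phi> q \<bullet> b)) (coord_vec A U \<phi> p b))"
  by (rule ext) (simp add: sum_fun_apply fscale_def tangent_expand[OF assms, symmetric])

lemma tangent_eq_coord:
  assumes "(U, \<phi>) \<in> A" "p \<in> U" "v \<in> tangent_space A p" "w \<in> tangent_space A p"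
    "\<And>b. b \<in> onb \<Longrightarrow> v (\<lambda>q. \<phi> q \<bullet> b) = w (\<lambda>q. \<phi> q \<bullet> b)"
  shows "v = w"
  using tangent_expand_sum[OF assms(1,2,3)] tangent_expand_sum[OF assms(1,2,4)] assms(5) by simp

subsection \<open>Vector fields and one-forms\<close>

lemma vf_mopen: "vector_field A W X \<Longrightarrow> mopen A W"
  by (simp add: vector_field_def)

lemma vf_tangent: "vector_field A W X \<Longrightarrow> p \<in> W \<Longrightarrow> X p \<in> tangent_space A p"
  by (simp add: vector_field_def)

lemma vf_smooth:
  assumes "vector_field A W X" "p \<in> W" "smooth_at A p f"
  shows "smooth_at A p (\<lambda>q. X q f)"
proof -
  obtain V where V: "mopen A V" "p \<in> V" "\<And>q. q \<in> V \<Longrightarrow> smooth_at A q f"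
    using smooth_at_nbhd[OF assms(3)] by blast
  have "smooth_fun A (V \<inter> W) f"
    using V vf_mopen[OF assms(1)] by (auto simp: smooth_fun_iff mopen_Int)
  then have "smooth_fun A (V \<inter> W) (\<lambda>q. X q f)"
    using assms(1) by (auto simp: vector_field_def)
  then show ?thesis using V assms by (auto simp: smooth_fun_iff)
qed

lemma vfI:
  assumes "mopen A W" "\<And>p. p \<in> W \<Longrightarrow> X p \<in> tangent_space A p"
    "\<And>p f. p \<in> W \<Longrightarrow> smooth_at A p f \<Longrightarrow> smooth_at A p (\<lambda>q. X q f)"
  shows "vector_field A W X"
  using assms by (auto simp: vector_field_def smooth_fun_iff)

text \<open>By \<open>tangent_expand\<close> a field is a combination of coordinate fields, so its
  coefficients decide its smoothness.\<close>

lemma vfI_coord: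
  assumes "mopen A W" "\<And>p. p \<in> W \<Longrightarrow> X p \<in> tangent_space A p"
    "\<And>p. p \<in> W \<Longrightarrow> \<exists>U \<phi>. (U, \<phi>) \<in> A \<and> p \<in> U \<and> (\<forall>b\<in>onb. smooth_at A p (\<lambda>q. X q (\<lambda>r. \<phi> r \<bullet> b)))"
  shows "vector_field A W X"
proof (rule vfI[OF assms(1,2)])
  fix p f assume p: "p \<in> W" and f: "smooth_at A p f"
  obtain U \<phi> where U: "(U, \<phi>) \<in> A" "p \<in> U" and s: "\<And>b. b \<in> onb \<Longrightarrow> smooth_at A p (\<lambda>q. X q (\<lambda>r. \<phi> r \<bullet> b))"
    using assms(3)[OF p] by blast
  have "smooth_at A p (\<lambda>q. \<Sum>b\<in>onb. X q (\<lambda>r. \<phi> r \<bullet> b) * coord_vec A U \<phi> q b f)"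
    using p mopen_subset[OF assms(1)] by (intro smooth_at_sum smooth_at_mult s coord_vec_smooth[OF U f])
  then show "smooth_at A p (\<lambda>q. X q f)"
    by (rule smooth_at_cong[OF _ mopen_Int[OF assms(1) mopen_chart[OF U(1)]]])
       (use p U in \<open>auto simp: tangent_expand[OF U(1) _ assms(2), symmetric]\<close>)
qed

lemma vf_subset: "vector_field A W X \<Longrightarrow> mopen A V \<Longrightarrow> V \<subseteq> W \<Longrightarrow> vector_field A V X"
  by (auto simp: vector_field_def)

lemma vf_cong:
  assumes "vector_field A W X" "\<And>p. p \<in> W \<Longrightarrow> X p = Y p"
  shows "vector_field A W Y"
proof (rule vfI)
  show "smooth_at A p (\<lambda>q. Y q f)" if "p \<in> W" "smooth_at A p f" for p f
    by (rule smooth_at_cong[OF vf_smooth[OF assms(1) that] vf_mopen[OF assms(1)] that(1)]) (simp add: assms(2))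
qed (use assms vf_mopen vf_tangent in auto, metis vf_tangent)

lemma vf_zero: "mopen A W \<Longrightarrow> vector_field A W (\<lambda>_. 0)"
  by (rule vfI) (auto intro: tangent_zero smooth_at_const dest: mopen_subset)

lemma vf_add: "vector_field A W X \<Longrightarrow> vector_field A W Y \<Longrightarrow> vector_field A W (\<lambda>p. X p + Y p)"
  by (rule vfI) (auto intro: tangent_add smooth_at_add vf_smooth vf_mopen vf_tangent)

lemma vf_scale:
  "vector_field A W X \<Longrightarrow> (\<And>p. p \<in> W \<Longrightarrow> smooth_at A p f) \<Longrightarrow> vector_field A W (\<lambda>p. fscale (f p) (X p))"
  by (rule vfI) (auto intro: tangent_scale vf_mopen vf_tangent, auto simp: fscale_def intro: smooth_at_mult vf_smooth)

lemma vf_uminus: "vector_field A W X \<Longrightarrow> vector_field A W (\<lambda>p. - X p)"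
  by (rule vfI) (auto intro: tangent_uminus vf_mopen vf_tangent smooth_at_cmult[where c = "-1", simplified] vf_smooth)

lemma vf_sum:
  assumes "mopen A W" "\<And>i. i \<in> I \<Longrightarrow> vector_field A W (X i)"
  shows "vector_field A W (\<lambda>p. \<Sum>i\<in>I. X i p)"
  using assms(2) by (induction I rule: infinite_finite_induct) (auto intro: vf_zero[OF assms(1)] vf_add)

lemma vf_coord: "(U, \<phi>) \<in> A \<Longrightarrow> vector_field A U (\<lambda>p. coord_vec A U \<phi> p b)"
  by (rule vfI) (auto intro: mopen_chart coord_vec_tangent coord_vec_smooth)

lemma lie_bracket_apply:
  "smooth_at A p f \<Longrightarrow> lie_bracket A X Y p f = X p (\<lambda>q. Y q f) - Y p (\<lambda>q. X q f)"
  by (simp add: lie_bracket_def)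

lemma lie_bracket_tangent:
  assumes X: "vector_field A W X" "p \<in> W" and Y: "vector_field A V Y" "p \<in> V"
  shows "lie_bracket A X Y p \<in> tangent_space A p"
proof (rule tangent_spaceI)
  note Xp = vf_tangent[OF X] and Yp = vf_tangent[OF Y]
  \<comment> \<open>The rules for \<open>Y q\<close> hold only at those q near p where the functions
    involved are still smooth. This packages the passage to such a neighbourhood, which
    \<open>tv_cong\<close> then makes invisible to the outer derivation.\<close>
  have cong: "v (\<lambda>q. Z q f') = v g" if *: "v \<in> tangent_space A p" "smooth_at A p g"
      "vector_field A W' Z" "p \<in> W'" "smooth_at A p f" "smooth_at A p f''"
      "\<And>q. q \<in> W' \<Longrightarrow> smooth_at A q f \<Longrightarrow> smooth_at A q f'' \<Longrightarrow> Z q f' = g q" for v g Z f f'' f' W'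
  proof -
    obtain N where N: "mopen A N" "p \<in> N" "\<And>q. q \<in> N \<Longrightarrow> smooth_at A q f"
      using smooth_at_nbhd[OF *(5)] by blast
    obtain N' where N': "mopen A N'" "p \<in> N'" "\<And>q. q \<in> N' \<Longrightarrow> smooth_at A q f''"
      using smooth_at_nbhd[OF *(6)] by blast
    show ?thesis
      by (rule tv_cong[OF *(1), symmetric, OF mopen_Int[OF vf_mopen[OF *(3)] mopen_Int[OF N(1) N'(1)]] _ *(2)])
         (use * N N' in auto)
  qed
  {
    fix f g assume s: "smooth_at A p f" "smooth_at A p g"
    have "X p (\<lambda>q. Y q (\<lambda>r. f r + g r)) = X p (\<lambda>q. Y q f + Y q g)"
      by (rule cong[OF Xp smooth_at_add[OF s[THEN vf_smooth[OF Y]]] Y s]) (auto intro: tv_add vf_tangent[OF Y(1)])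
    moreover have "Y p (\<lambda>q. X q (\<lambda>r. f r + g r)) = Y p (\<lambda>q. X q f + X q g)"
      by (rule cong[OF Yp smooth_at_add[OF s[THEN vf_smooth[OF X]]] X s]) (auto intro: tv_add vf_tangent[OF X(1)])
    ultimately show "lie_bracket A X Y p (\<lambda>q. f q + g q) = lie_bracket A X Y p f + lie_bracket A X Y p g"
      by (simp add: lie_bracket_apply s smooth_at_add tv_add[OF Xp] tv_add[OF Yp] vf_smooth[OF X] vf_smooth[OF Y])
    have "X p (\<lambda>q. Y q (\<lambda>r. f r * g r)) = X p (\<lambda>q. f q * Y q g + g q * Y q f)"
      by (rule cong[OF Xp smooth_at_add[OF smooth_at_mult[OF s(1) vf_smooth[OF Y s(2)]] smooth_at_mult[OF s(2) vf_smooth[OF Y s(1)]]] Y s])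
        (auto intro: tv_mult vf_tangent[OF Y(1)])
    moreover have "Y p (\<lambda>q. X q (\<lambda>r. f r * g r)) = Y p (\<lambda>q. f q * X q g + g q * X q f)"
      by (rule cong[OF Yp smooth_at_add[OF smooth_at_mult[OF s(1) vf_smooth[OF X s(2)]] smooth_at_mult[OF s(2) vf_smooth[OF X s(1)]]] X s])
        (auto intro: tv_mult vf_tangent[OF X(1)])
    ultimately show "lie_bracket A X Y p (\<lambda>q. f q * g q) = f p * lie_bracket A X Y p g + g p * lie_bracket A X Y p f"
      by (simp add: lie_bracket_apply s smooth_at_mult tv_add[OF Xp] tv_add[OF Yp] tv_mult[OF Xp] tv_mult[OF Yp]
          vf_smooth[OF X] vf_smooth[OF Y] algebra_simps)
  }
  {
    fix c f assume s: "smooth_at A p f"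
    have "X p (\<lambda>q. Y q (\<lambda>r. c * f r)) = X p (\<lambda>q. c * Y q f)"
      by (rule cong[OF Xp smooth_at_cmult[OF vf_smooth[OF Y s]] Y s s]) (auto intro: tv_cmult vf_tangent[OF Y(1)])
    moreover have "Y p (\<lambda>q. X q (\<lambda>r. c * f r)) = Y p (\<lambda>q. c * X q f)"
      by (rule cong[OF Yp smooth_at_cmult[OF vf_smooth[OF X s]] X s s]) (auto intro: tv_cmult vf_tangent[OF X(1)])
    ultimately show "lie_bracket A X Y p (\<lambda>q. c * f q) = c * lie_bracket A X Y p f"
      by (simp add: lie_bracket_apply s smooth_at_cmult tv_cmult[OF Xp] tv_cmult[OF Yp]
          vf_smooth[OF X] vf_smooth[OF Y] algebra_simps)
  }
qed (simp add: lie_bracket_def)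

lemma vf_lie_bracket:
  assumes X: "vector_field A W X" and Y: "vector_field A W Y"
  shows "vector_field A W (lie_bracket A X Y)"
proof (rule vfI)
  fix p f assume p: "p \<in> W" and f: "smooth_at A p f"
  obtain N where N: "mopen A N" "p \<in> N" "\<And>q. q \<in> N \<Longrightarrow> smooth_at A q f"
    using smooth_at_nbhd[OF f] by blast
  have "smooth_at A p (\<lambda>q. X q (\<lambda>r. Y r f) - Y q (\<lambda>r. X r f))"
    by (intro smooth_at_diff vf_smooth[OF X p] vf_smooth[OF Y p] f)
  then show "smooth_at A p (\<lambda>q. lie_bracket A X Y q f)"
    by (rule smooth_at_cong[OF _ N(1,2)]) (simp add: lie_bracket_apply N(3))
qed (use X Y in \<open>auto intro: lie_bracket_tangent vf_mopen\<close>)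

lemma lie_bracket_antisym: "lie_bracket A Y X p = - lie_bracket A X Y p"
  by (auto simp: lie_bracket_def fun_eq_iff)

lemma lie_bracket_add:
  assumes X: "vector_field A W X" "p \<in> W" and Y: "vector_field A W Y" and Z: "vector_field A W Z"
  shows "lie_bracket A X (\<lambda>q. Y q + Z q) p = lie_bracket A X Y p + lie_bracket A X Z p"
  by (rule ext) (simp add: lie_bracket_def tv_add[OF vf_tangent[OF X]] vf_smooth[OF Y X(2)] vf_smooth[OF Z X(2)])

lemma lie_bracket_scale:
  assumes X: "vector_field A W X" "p \<in> W" and Y: "vector_field A W Y" and g: "smooth_at A p g"
  shows "lie_bracket A X (\<lambda>q. fscale (g q) (Y q)) p = fscale (g p) (lie_bracket A X Y p) + fscale (X p g) (Y p)"
  by (rule ext) (simp add: lie_bracket_def fscale_def tv_mult[OF vf_tangent[OF X] g] vf_smooth[OF Y X(2)]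
      tv_not_smooth[OF vf_tangent[OF Y X(2)]] algebra_simps)

lemma lie_bracket_cong:
  assumes X: "vector_field A W X" and Y: "vector_field A W Y" and V: "mopen A V" "p \<in> V" "V \<subseteq> W"
    and eq: "\<And>q. q \<in> V \<Longrightarrow> X q = X' q" "\<And>q. q \<in> V \<Longrightarrow> Y q = Y' q"
  shows "lie_bracket A X Y p = lie_bracket A X' Y' p"
proof -
  have p: "p \<in> W" using V by auto
  have "X p (\<lambda>q. Y q f) = X p (\<lambda>q. Y' q f)" "Y p (\<lambda>q. X q f) = Y p (\<lambda>q. X' q f)" if f: "smooth_at A p f" for f
    by (rule tv_cong[OF vf_tangent[OF X p] V(1,2) vf_smooth[OF Y p f]], simp add: eq)
       (rule tv_cong[OF vf_tangent[OF Y p] V(1,2) vf_smooth[OF X p f]], simp add: eq)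
  then show ?thesis using eq V by (auto simp: lie_bracket_def)
qed

section \<open>Covectors and one-forms\<close>

lemma ct_add: "\<eta> \<in> cotangent_space A p \<Longrightarrow> v \<in> tangent_space A p \<Longrightarrow> w \<in> tangent_space A p \<Longrightarrow> \<eta> (v + w) = \<eta> v + \<eta> w"
  by (simp add: cotangent_space_def)

lemma ct_scale: "\<eta> \<in> cotangent_space A p \<Longrightarrow> v \<in> tangent_space A p \<Longrightarrow> \<eta> (fscale c v) = c * \<eta> v"
  by (simp add: cotangent_space_def)

lemma ct_outside: "\<eta> \<in> cotangent_space A p \<Longrightarrow> v \<notin> tangent_space A p \<Longrightarrow> \<eta> v = 0"
  by (simp add: cotangent_space_def)

lemma cotangentI:
  assumes "\<And>v w. v \<in> tangent_space A p \<Longrightarrow> w \<in> tangent_space A p \<Longrightarrow> \<eta> (v + w) = \<eta> v + \<eta> w"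
    "\<And>c v. v \<in> tangent_space A p \<Longrightarrow> \<eta> (fscale c v) = c * \<eta> v"
    "\<And>v. v \<notin> tangent_space A p \<Longrightarrow> \<eta> v = 0"
  shows "\<eta> \<in> cotangent_space A p"
  using assms by (auto simp: cotangent_space_def)

lemma cotangent_eqI:
  assumes "\<eta> \<in> cotangent_space A p" "\<xi> \<in> cotangent_space A p" "\<And>v. v \<in> tangent_space A p \<Longrightarrow> \<eta> v = \<xi> v"
  shows "\<eta> = \<xi>"
  using assms ct_outside by (metis ext)

lemma ct_zero: "\<eta> \<in> cotangent_space A p \<Longrightarrow> \<eta> 0 = 0"
  using ct_add[of \<eta> p 0 0] tangent_zero by simp

lemma ct_uminus: "\<eta> \<in> cotangent_space A p \<Longrightarrow> v \<in> tangent_space A p \<Longrightarrow> \<eta> (- v) = - \<eta> v"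
  using ct_add[of \<eta> p v "- v"] tangent_uminus ct_zero[of \<eta> p] by simp

lemma ct_diff: "\<eta> \<in> cotangent_space A p \<Longrightarrow> v \<in> tangent_space A p \<Longrightarrow> w \<in> tangent_space A p \<Longrightarrow> \<eta> (v - w) = \<eta> v - \<eta> w"
  using ct_add[of \<eta> p v "- w"] tangent_uminus ct_uminus[of \<eta> p w] by simp

lemma ct_sum: "\<eta> \<in> cotangent_space A p \<Longrightarrow> (\<And>i. i \<in> I \<Longrightarrow> v i \<in> tangent_space A p) \<Longrightarrow> \<eta> (\<Sum>i\<in>I. v i) = (\<Sum>i\<in>I. \<eta> (v i))"
  by (induction I rule: infinite_finite_induct) (auto simp: ct_zero ct_add tangent_sum simp flip: zero_fun_def)

lemma cotangent_zero: "0 \<in> cotangent_space A p"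
  by (rule cotangentI) auto

lemma cotangent_add: "\<eta> \<in> cotangent_space A p \<Longrightarrow> \<xi> \<in> cotangent_space A p \<Longrightarrow> \<eta> + \<xi> \<in> cotangent_space A p"
  by (rule cotangentI) (auto simp: ct_add ct_scale ct_outside algebra_simps)

lemma cotangent_scale: "\<eta> \<in> cotangent_space A p \<Longrightarrow> fscale c \<eta> \<in> cotangent_space A p"
  by (rule cotangentI) (auto simp: ct_add ct_scale ct_outside fscale_def[of c \<eta>] algebra_simps)

lemma cotangent_uminus: "\<eta> \<in> cotangent_space A p \<Longrightarrow> - \<eta> \<in> cotangent_space A p"
  by (rule cotangentI) (auto simp: ct_add ct_scale ct_outside algebra_simps)

lemma cotangent_diff: "\<eta> \<in> cotangent_space A p \<Longrightarrow> \<xi> \<in> cotangent_space A p \<Longrightarrow> \<eta> - \<xi> \<in> cotangent_space A p"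
  using cotangent_add[of \<eta> p "- \<xi>"] cotangent_uminus[of \<xi> p] by simp

lemma ct_expand:
  assumes U: "(U, \<phi>) \<in> A" "p \<in> U" and "\<eta> \<in> cotangent_space A p" "v \<in> tangent_space A p"
  shows "\<eta> v = (\<Sum>b\<in>onb. v (\<lambda>q. \<phi> q \<bullet> b) * \<eta> (coord_vec A U \<phi> p b))"
  by (subst tangent_expand_sum[OF U assms(4)])
     (simp add: ct_sum[OF assms(3)] ct_scale[OF assms(3)] tangent_scale coord_vec_tangent[OF U])

lemma of_mopen: "one_form A W \<eta> \<Longrightarrow> mopen A W"
  by (simp add: one_form_def)

lemma of_cotangent: "one_form A W \<eta> \<Longrightarrow> p \<in> W \<Longrightarrow> \<eta> p \<in> cotangent_space A p"
  by (simp add: one_form_def)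

lemma of_smooth:
  assumes "one_form A W \<eta>" "p \<in> W" "vector_field A V Y" "p \<in> V"
  shows "smooth_at A p (\<lambda>q. \<eta> q (Y q))"
proof -
  have "mopen A (V \<inter> W)" using mopen_Int of_mopen vf_mopen assms by blast
  then have "vector_field A (V \<inter> W) Y" using vf_subset[OF assms(3)] by auto
  then have "smooth_fun A (V \<inter> W) (\<lambda>q. \<eta> q (Y q))"
    using assms(1) unfolding one_form_def by (meson Int_lower2)
  then show ?thesis using assms by (auto simp: smooth_fun_iff)
qed

lemma ofI:
  assumes "mopen A W" "\<And>p. p \<in> W \<Longrightarrow> \<eta> p \<in> cotangent_space A p"
    "\<And>V Y p. vector_field A V Y \<Longrightarrow> V \<subseteq> W \<Longrightarrow> p \<in> V \<Longrightarrow> smooth_at A p (\<lambda>q. \<eta> q (Y q))"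
  shows "one_form A W \<eta>"
  using assms by (auto simp: one_form_def smooth_fun_iff vf_mopen)

lemma of_subset: "one_form A W \<eta> \<Longrightarrow> mopen A V \<Longrightarrow> V \<subseteq> W \<Longrightarrow> one_form A V \<eta>"
  by (auto simp: one_form_def)

lemma of_cong:
  assumes "one_form A W \<eta>" "\<And>p. p \<in> W \<Longrightarrow> \<eta> p = \<xi> p"
  shows "one_form A W \<xi>"
proof (rule ofI)
  show "smooth_at A p (\<lambda>q. \<xi> q (Y q))" if "vector_field A V Y" "V \<subseteq> W" "p \<in> V" for V Y p
    by (rule smooth_at_cong[OF of_smooth[OF assms(1) _ that(1,3)] vf_mopen[OF that(1)] that(3)])
       (use that in \<open>auto simp: assms(2) subsetD\<close>)
qed (use assms of_mopen of_cotangent in auto, metis of_cotangent)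

lemma of_zero: "mopen A W \<Longrightarrow> one_form A W (\<lambda>_. 0)"
  by (rule ofI) (auto intro: cotangent_zero smooth_at_const dest: mopen_subset)

lemma of_add: "one_form A W \<eta> \<Longrightarrow> one_form A W \<xi> \<Longrightarrow> one_form A W (\<lambda>p. \<eta> p + \<xi> p)"
proof (rule ofI)
  show "smooth_at A p (\<lambda>q. (\<eta> q + \<xi> q) (Y q))"
    if "one_form A W \<eta>" "one_form A W \<xi>" "vector_field A V Y" "V \<subseteq> W" "p \<in> V" for V Y p
    using smooth_at_add[OF of_smooth[OF that(1) _ that(3,5)] of_smooth[OF that(2) _ that(3,5)]] that(4,5) by auto
qed (auto intro: cotangent_add of_mopen of_cotangent)

lemma of_scale:
  "one_form A W \<eta> \<Longrightarrow> (\<And>p. p \<in> W \<Longrightarrow> smooth_at A p f) \<Longrightarrow> one_form A W (\<lambda>p. fscale (f p) (\<eta> p))"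
proof (rule ofI)
  show "smooth_at A p (\<lambda>q. fscale (f q) (\<eta> q) (Y q))"
    if "one_form A W \<eta>" "\<And>p. p \<in> W \<Longrightarrow> smooth_at A p f" "vector_field A V Y" "V \<subseteq> W" "p \<in> V" for V Y p
    using smooth_at_mult[OF that(2) of_smooth[OF that(1) _ that(3,5)]] that(4,5) by (auto simp: fscale_def)
qed (auto intro: cotangent_scale of_mopen of_cotangent)

lemma of_uminus: "one_form A W \<eta> \<Longrightarrow> one_form A W (\<lambda>p. - \<eta> p)"
proof (rule ofI)
  show "smooth_at A p (\<lambda>q. (- \<eta> q) (Y q))"
    if "one_form A W \<eta>" "vector_field A V Y" "V \<subseteq> W" "p \<in> V" for V Y p
    using smooth_at_cmult[OF of_smooth[OF that(1) _ that(2,4)], where c = "-1"] that(3,4) by auto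
qed (auto intro: cotangent_uminus of_mopen of_cotangent)

lemma of_diff: "one_form A W \<eta> \<Longrightarrow> one_form A W \<xi> \<Longrightarrow> one_form A W (\<lambda>p. \<eta> p - \<xi> p)"
  using of_add[of W \<eta> "\<lambda>p. - \<xi> p"] of_uminus[of W \<xi>] by simp

lemma fun_differential_cotangent: "fun_differential A f p \<in> cotangent_space A p"
  by (rule cotangentI) (auto simp: fun_differential_def tangent_add tangent_scale, auto simp: fscale_def)

text \<open>Expand Y in the coordinate frame: the derivatives of its coefficients along X occur both
  in X (\<eta> (Y)) and in \<eta> ([X, Y]) and cancel. The right-hand side depends on Y through its
  value at p only, which makes the choice in \<open>lie_derivative\<close> harmless.\<close>

lemma lie_derivative_tensorial:
  assumes X: "vector_field A W X" and \<eta>: "one_form A W \<eta>" and p: "p \<in> W"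
    and Y: "vector_field A V Y" "p \<in> V" and U: "(U, \<phi>) \<in> A" "p \<in> U"
  shows "X p (\<lambda>q. \<eta> q (Y q)) - \<eta> p (lie_bracket A X Y p) =
    (\<Sum>b\<in>onb. Y p (\<lambda>q. \<phi> q \<bullet> b) * (X p (\<lambda>q. \<eta> q (coord_vec A U \<phi> q b)) -
       \<eta> p (lie_bracket A X (\<lambda>q. coord_vec A U \<phi> q b) p)))"
proof -
  define y where "y b q = Y q (\<lambda>r. \<phi> r \<bullet> b)" for b q
  define E where "E b q = coord_vec A U \<phi> q b" for b q
  have pp: "p \<in> points A" using U chart_points by blast
  have E: "vector_field A U (E b)" for b using vf_coord[OF U(1)] by (simp add: E_def[abs_def])
  have y: "smooth_at A p (y b)" for b
    using vf_smooth[OF Y smooth_at_coord[OF U]] by (simp add: y_def[abs_def])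
  note Xp = vf_tangent[OF X p] and Yp = vf_tangent[OF Y] and \<eta>p = of_cotangent[OF \<eta> p]
  have WVU: "mopen A (W \<inter> (V \<inter> U))"
    using X Y(1) U(1) by (intro mopen_Int vf_mopen mopen_chart)
  have sE: "smooth_at A p (\<lambda>q. \<eta> q (E b q))" for b by (rule of_smooth[OF \<eta> p E U(2)])
  have 1: "X p (\<lambda>q. \<eta> q (Y q)) = (\<Sum>b\<in>onb. y b p * X p (\<lambda>q. \<eta> q (E b q)) + \<eta> p (E b p) * X p (y b))"
  proof -
    have "X p (\<lambda>q. \<eta> q (Y q)) = X p (\<lambda>q. \<Sum>b\<in>onb. y b q * \<eta> q (E b q))"
      by (rule tv_cong[OF Xp WVU _ of_smooth[OF \<eta> p Y]])
         (use p Y U in \<open>auto simp: y_def E_def ct_expand[OF U(1) _ of_cotangent[OF \<eta>] vf_tangent[OF Y(1)], symmetric]\<close>)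
    also have "\<dots> = (\<Sum>b\<in>onb. y b p * X p (\<lambda>q. \<eta> q (E b q)) + \<eta> p (E b p) * X p (y b))"
      by (simp add: tv_sum[OF Xp pp] tv_mult[OF Xp] smooth_at_mult y sE)
    finally show ?thesis .
  qed
  have "lie_bracket A X Y p = (\<Sum>b\<in>onb. fscale (y b p) (lie_bracket A X (E b) p) + fscale (X p (y b)) (E b p))"
  proof (rule tangent_eqI[OF lie_bracket_tangent[OF X p Y]])
    show "(\<Sum>b\<in>onb. fscale (y b p) (lie_bracket A X (E b) p) + fscale (X p (y b)) (E b p)) \<in> tangent_space A p"
      by (intro tangent_sum tangent_add tangent_scale lie_bracket_tangent[OF X p E U(2)] vf_tangent[OF E U(2)])
    fix f assume f: "smooth_at A p f"
    have "X p (\<lambda>q. Y q f) = X p (\<lambda>q. \<Sum>b\<in>onb. y b q * E b q f)"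
      by (rule tv_cong[OF Xp WVU _ vf_smooth[OF Y f]])
         (use p Y U in \<open>auto simp: y_def E_def tangent_expand[OF U(1) _ vf_tangent[OF Y(1)], symmetric]\<close>)
    also have "\<dots> = (\<Sum>b\<in>onb. y b p * X p (\<lambda>q. E b q f) + E b p f * X p (y b))"
      by (simp add: tv_sum[OF Xp pp] tv_mult[OF Xp] smooth_at_mult y vf_smooth[OF E U(2) f])
    finally have a: "X p (\<lambda>q. Y q f) = (\<Sum>b\<in>onb. y b p * X p (\<lambda>q. E b q f) + E b p f * X p (y b))" .
    have b: "Y p (\<lambda>q. X q f) = (\<Sum>b\<in>onb. y b p * E b p (\<lambda>q. X q f))"
      unfolding y_def E_def by (rule tangent_expand[OF U Yp])
    show "lie_bracket A X Y p f =
        (\<Sum>b\<in>onb. fscale (y b p) (lie_bracket A X (E b) p) + fscale (X p (y b)) (E b p)) f"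
      unfolding lie_bracket_apply[OF f] sum_fun_apply a b sum_subtractf[symmetric]
      by (rule sum.cong) (auto simp: fscale_def lie_bracket_apply[OF f] algebra_simps)
  qed
  then have "\<eta> p (lie_bracket A X Y p) = \<eta> p (\<Sum>b\<in>onb. fscale (y b p) (lie_bracket A X (E b) p) + fscale (X p (y b)) (E b p))"
    by (rule arg_cong)
  also have "\<dots> = (\<Sum>b\<in>onb. \<eta> p (fscale (y b p) (lie_bracket A X (E b) p) + fscale (X p (y b)) (E b p)))"
    by (intro ct_sum[OF \<eta>p] tangent_add tangent_scale lie_bracket_tangent[OF X p E U(2)] vf_tangent[OF E U(2)])
  also have "\<dots> = (\<Sum>b\<in>onb. y b p * \<eta> p (lie_bracket A X (E b) p) + X p (y b) * \<eta> p (E b p))"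
    by (intro sum.cong refl) (simp add: ct_add[OF \<eta>p] ct_scale[OF \<eta>p] tangent_scale
        lie_bracket_tangent[OF X p E U(2)] vf_tangent[OF E U(2)])
  finally have 2: "\<eta> p (lie_bracket A X Y p) = (\<Sum>b\<in>onb. y b p * \<eta> p (lie_bracket A X (E b) p) + X p (y b) * \<eta> p (E b p))" .
  have 3: "y b p * a + c * d - (y b p * e + d * c) = y b p * (a - e)" for b a c d e
    by (simp add: right_diff_distrib)
  show ?thesis
    unfolding y_def[symmetric] E_def[symmetric]
    unfolding 1 2 sum_subtractf[symmetric] 3 ..
qed

lemma lie_derivative_apply:
  assumes X: "vector_field A W X" and \<eta>: "one_form A W \<eta>" and p: "p \<in> W"
    and Y: "vector_field A V Y" "p \<in> V"
  shows "lie_derivative A X \<eta> p (Y p) = X p (\<lambda>q. \<eta> q (Y q)) - \<eta> p (lie_bracket A X Y p)"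
proof -
  obtain U \<phi> where U: "(U, \<phi>) \<in> A" "p \<in> U"
    using points_chart mopen_subset[OF vf_mopen[OF X] p] by blast
  define Z where "Z = (SOME Z. (\<exists>W. p \<in> W \<and> vector_field A W Z) \<and> Z p = Y p)"
  have "(\<exists>W. p \<in> W \<and> vector_field A W Z) \<and> Z p = Y p"
    unfolding Z_def by (rule someI[of _ Y]) (use Y in auto)
  then obtain V' where Z: "vector_field A V' Z" "p \<in> V'" "Z p = Y p" by blast
  have "lie_derivative A X \<eta> p (Y p) = X p (\<lambda>q. \<eta> q (Z q)) - \<eta> p (lie_bracket A X Z p)"
    using vf_tangent[OF Y] unfolding lie_derivative_def Z_def[symmetric] Let_def by simp
  also have "\<dots> = X p (\<lambda>q. \<eta> q (Y q)) - \<eta> p (lie_bracket A X Y p)"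
    unfolding lie_derivative_tensorial[OF X \<eta> p Z(1,2) U] lie_derivative_tensorial[OF X \<eta> p Y U] Z(3) ..
  finally show ?thesis .
qed

lemma lie_derivative_cotangent:
  assumes X: "vector_field A W X" and \<eta>: "one_form A W \<eta>" and p: "p \<in> W"
  shows "lie_derivative A X \<eta> p \<in> cotangent_space A p"
proof (rule cotangentI)
  obtain U \<phi> where U: "(U, \<phi>) \<in> A" "p \<in> U"
    using points_chart mopen_subset[OF vf_mopen[OF X] p] by blast
  \<comment> \<open>Constant coefficients in the coordinate frame extend any tangent vector at p to
    a field on U.\<close>
  have ext: "\<exists>Y. vector_field A U Y \<and> Y p = v" if v: "v \<in> tangent_space A p" for v
  proof (intro exI conjI)
    show "vector_field A U (\<lambda>q. \<Sum>b\<in>onb. fscale (v (\<lambda>q. \<phi> q \<bullet> b)) (coord_vec A U \<phi> q b))"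
      by (intro vf_sum mopen_chart[OF U(1)] vf_scale vf_coord[OF U(1)] smooth_at_const chart_points[OF U(1)])
  qed (use tangent_expand_sum[OF U v] in simp)
  note * = lie_derivative_apply[OF X \<eta> p _ U(2)] lie_derivative_tensorial[OF X \<eta> p _ U(2) U]
  {
    fix v w assume "v \<in> tangent_space A p" "w \<in> tangent_space A p"
    then obtain Y Z where "vector_field A U Y" "Y p = v" "vector_field A U Z" "Z p = w" using ext by meson
    then show "lie_derivative A X \<eta> p (v + w) = lie_derivative A X \<eta> p v + lie_derivative A X \<eta> p w"
      using *(1)[of Y] *(1)[of Z] *(1)[of "\<lambda>q. Y q + Z q"] *(2)[of Y] *(2)[of Z] *(2)[of "\<lambda>q. Y q + Z q"] vf_add[of U Y Z]
      by (simp add: distrib_right sum.distrib)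
  }
  {
    fix c v assume "v \<in> tangent_space A p"
    then obtain Y where Y: "vector_field A U Y" "Y p = v" using ext by meson
    moreover have "vector_field A U (\<lambda>q. fscale c (Y q))"
      using vf_scale[OF Y(1), of "\<lambda>_. c"] smooth_at_const chart_points[OF U(1)] by blast
    ultimately show "lie_derivative A X \<eta> p (fscale c v) = c * lie_derivative A X \<eta> p v"
      using *(1)[of Y] *(1)[of "\<lambda>q. fscale c (Y q)"] *(2)[of Y] *(2)[of "\<lambda>q. fscale c (Y q)"]
      by (simp add: fscale_def sum_distrib_left mult.assoc)
  }
qed (simp add: lie_derivative_def)

lemma of_lie_derivative:
  assumes X: "vector_field A W X" and \<eta>: "one_form A W \<eta>"
  shows "one_form A W (lie_derivative A X \<eta>)"
proof (rule ofI)
  fix V Y p assume Y: "vector_field A V Y" "V \<subseteq> W" "p \<in> V"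
  have XV: "vector_field A V X" "one_form A V \<eta>"
    using vf_subset[OF X vf_mopen[OF Y(1)] Y(2)] of_subset[OF \<eta> vf_mopen[OF Y(1)] Y(2)] .
  have "smooth_at A p (\<lambda>q. X q (\<lambda>r. \<eta> r (Y r)) - \<eta> q (lie_bracket A X Y q))"
    by (intro smooth_at_diff vf_smooth[OF XV(1) Y(3)] of_smooth[OF XV(2) Y(3) _ Y(3)] Y(1) vf_lie_bracket[OF XV(1)])
  then show "smooth_at A p (\<lambda>q. lie_derivative A X \<eta> q (Y q))"
    by (rule smooth_at_cong[OF _ vf_mopen[OF Y(1)] Y(3)])
       (simp add: lie_derivative_apply[OF XV _ Y(1)])
qed (use assms in \<open>auto intro: lie_derivative_cotangent vf_mopen\<close>)

lemma of_fun_differential: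
  assumes "mopen A W" "\<And>p. p \<in> W \<Longrightarrow> smooth_at A p f"
  shows "one_form A W (fun_differential A f)"
proof (rule ofI[OF assms(1) fun_differential_cotangent])
  fix V Y p assume Y: "vector_field A V Y" "V \<subseteq> W" "p \<in> V"
  show "smooth_at A p (\<lambda>q. fun_differential A f q (Y q))"
    by (rule smooth_at_cong[OF vf_smooth[OF Y(1,3) assms(2)] vf_mopen[OF Y(1)] Y(3)])
       (use Y in \<open>auto simp: fun_differential_def vf_tangent\<close>)
qed

subsection \<open>The Courant bracket\<close>

lemma gen_section_courant:
  assumes s: "gen_section A W s" and t: "gen_section A W t"
  shows "gen_section A W (courant_bracket A s t)"
proof -
  have st: "vector_field A W (fst \<circ> s)" "one_form A W (snd \<circ> s)" "vector_field A W (fst \<circ> t)" "one_form A W (snd \<circ> t)"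
    using s t by (auto simp: gen_section_def)
  have W: "mopen A W" by (rule vf_mopen[OF st(1)])
  have "one_form A W (\<lambda>p. lie_derivative A (fst \<circ> s) (snd \<circ> t) p - lie_derivative A (fst \<circ> t) (snd \<circ> s) p
      + fscale (1/2) (fun_differential A (\<lambda>q. (snd \<circ> s) q ((fst \<circ> t) q) - (snd \<circ> t) q ((fst \<circ> s) q)) p))"
    by (intro of_add of_diff of_lie_derivative st of_scale of_fun_differential W smooth_at_diff
          of_smooth[OF st(2) _ st(3)] of_smooth[OF st(4) _ st(1)] smooth_at_const mopen_subset[OF W])
  moreover have "vector_field A W (lie_bracket A (fst \<circ> s) (fst \<circ> t))"
    by (intro vf_lie_bracket st)
  ultimately show ?thesis
    by (simp add: gen_section_def courant_bracket_def o_def Let_def)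
qed

text \<open>Evaluation on a local field Z turns both Lie derivatives into iterated derivatives and
  brackets, free of the choice made in \<open>lie_derivative\<close>.\<close>

lemma courant_bracket_apply:
  assumes s: "gen_section A W s" and t: "gen_section A W t" and p: "p \<in> W" and Z: "vector_field A V Z" "p \<in> V"
  shows "snd (courant_bracket A s t p) (Z p) =
    fst (s p) (\<lambda>q. snd (t q) (Z q)) - snd (t p) (lie_bracket A (\<lambda>q. fst (s q)) Z p)
    - fst (t p) (\<lambda>q. snd (s q) (Z q)) + snd (s p) (lie_bracket A (\<lambda>q. fst (t q)) Z p)
    + 1/2 * Z p (\<lambda>q. snd (s q) (fst (t q)) - snd (t q) (fst (s q)))"
proof -
  have st: "vector_field A W (\<lambda>q. fst (s q))" "one_form A W (\<lambda>q. snd (s q))"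
    "vector_field A W (\<lambda>q. fst (t q))" "one_form A W (\<lambda>q. snd (t q))"
    using s t by (auto simp: gen_section_def o_def)
  show ?thesis
    using lie_derivative_apply[OF st(1,4) p Z] lie_derivative_apply[OF st(3,2) p Z] vf_tangent[OF Z]
    by (simp add: courant_bracket_def Let_def o_def fscale_def fun_differential_def)
qed

end

lemma (in mfd) smooth_at_comp:
  fixes f :: "'a \<Rightarrow> 'f::findim_inner"
  assumes p: "p \<in> points A" and f: "\<And>b. b \<in> onb \<Longrightarrow> smooth_at A p (\<lambda>q. f q \<bullet> b)" and g: "smooth_near (f p) g"
  shows "smooth_at A p (\<lambda>q. g (f q))"
proof -
  obtain U \<phi> where U: "(U, \<phi>) \<in> A" "p \<in> U" using points_chart[OF p] by blast
  have "smooth_near (\<phi> p) (f \<circ> inv_into U \<phi>)"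
    using f[unfolded smooth_at_chart[OF U]] by (intro iffD2[OF smooth_near_components]) (simp add: o_def)
  from smooth_near_comp[OF this, of g] show ?thesis
    unfolding smooth_at_chart[OF U] using g U by (simp add: o_def)
qed

subsection \<open>Maps that are smooth at a point\<close>

text \<open>Smoothness is tested on functions only; continuity follows by applying it to indicator
  functions of open sets.\<close>

definition smap ::
  "('a, 'e::findim_inner) atlas \<Rightarrow> ('b, 'f::findim_inner) atlas \<Rightarrow> ('a \<Rightarrow> 'b) \<Rightarrow> 'a \<Rightarrow> bool"
  where "smap A B F p \<longleftrightarrow> p \<in> points A \<and> F p \<in> points B \<and>
    (\<forall>f. smooth_at B (F p) f \<longrightarrow> smooth_at A p (\<lambda>q. f (F q)))"

lemma smapD: "smap A B F p \<Longrightarrow> smooth_at B (F p) f \<Longrightarrow> smooth_at A p (\<lambda>q. f (F q))"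
  by (simp add: smap_def)

lemma smap_comp: "smap A B F p \<Longrightarrow> smap B C H (F p) \<Longrightarrow> smap A C (\<lambda>q. H (F q)) p"
  using smapD[of A B F p "\<lambda>y. f (H y)" for f] smapD[of B C H "F p"] by (auto simp: smap_def[of A C] smap_def[of B C] smap_def[of A B])

lemma smap_id: "p \<in> points A \<Longrightarrow> smap A A (\<lambda>q. q) p"
  by (simp add: smap_def)

lemma smap_const: "mfd A \<Longrightarrow> p \<in> points A \<Longrightarrow> c \<in> points B \<Longrightarrow> smap A B (\<lambda>_. c) p"
  by (simp add: smap_def mfd.smooth_at_const)

lemma smap_nbhd:
  assumes A: "mfd A" and B: "mfd B" and F: "smap A B F p" and W: "mopen B W" "F p \<in> W"
  obtains V where "mopen A V" "p \<in> V" "\<And>q. q \<in> V \<Longrightarrow> F q \<in> W"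
proof -
  interpret A: mfd A by fact
  interpret B: mfd B by fact
  define ind :: "_ \<Rightarrow> real" where "ind q = (if q \<in> W then 1 else 0)" for q
  have "smooth_at B (F p) ind"
    by (rule B.smooth_at_cong[OF B.smooth_at_const[of _ 1] W])
       (use W B.mopen_subset in \<open>auto simp: ind_def\<close>)
  then have "smooth_at A p (\<lambda>q. ind (F q))" using F by (rule smapD[rotated])
  then obtain V where "mopen A V" "p \<in> V" "\<forall>q\<in>V. ind (F q) \<in> {0<..}"
    using A.smooth_at_preimage[of p "\<lambda>q. ind (F q)" "{0<..}"] W by (auto simp: ind_def)
  then show ?thesis using that[of V] by (auto simp: ind_def split: if_splits)
qed

lemma smooth_map_smap:
  assumes A: "mfd A" and B: "mfd B" and F: "smooth_map A B F" and p: "p \<in> points A"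
  shows "smap A B F p"
proof -
  interpret A: mfd A by fact
  interpret B: mfd B by fact
  have Fp: "F p \<in> points B" using F p by (auto simp: smooth_map_def)
  obtain U \<phi> where U: "(U, \<phi>) \<in> A" "p \<in> U" using A.points_chart[OF p] by blast
  obtain V \<psi> where V: "(V, \<psi>) \<in> B" "F p \<in> V" using B.points_chart[OF Fp] by blast
  define S where "S = \<phi> ` (U \<inter> F -` V)"
  have S: "open S" "smooth_on S (\<psi> \<circ> F \<circ> inv_into U \<phi>)" "\<phi> p \<in> S"
    using F U V unfolding smooth_map_def S_def by fastforce+
  then have n: "smooth_near (\<phi> p) (\<psi> \<circ> F \<circ> inv_into U \<phi>)" by (auto simp: smooth_near_def)
  have "smooth_at A p (\<lambda>q. f (F q))" if f: "smooth_at B (F p) f" for f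
    unfolding A.smooth_at_chart[OF U]
  proof (rule smooth_near_cong[OF smooth_near_comp[OF n, of "f \<circ> inv_into V \<psi>"] S(1,3)])
    show "smooth_near ((\<psi> \<circ> F \<circ> inv_into U \<phi>) (\<phi> p)) (f \<circ> inv_into V \<psi>)"
      using f[unfolded B.smooth_at_chart[OF V]] U by simp
    show "(f \<circ> inv_into V \<psi>) ((\<psi> \<circ> F \<circ> inv_into U \<phi>) x) = ((\<lambda>q. f (F q)) \<circ> inv_into U \<phi>) x" if "x \<in> S" for x
      using that U V by (auto simp: S_def)
  qed
  then show ?thesis using p Fp by (simp add: smap_def)
qed

section \<open>Differentials\<close>

lemma differential_apply: "smooth_at B (F p) f \<Longrightarrow> differential A B F p v f = v (\<lambda>q. f (F q))"
  by (simp add: differential_def o_def)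

lemma differential_tangent:
  assumes "mfd A" and B: "mfd B" and F: "smap A B F p" and v: "v \<in> tangent_space A p"
  shows "differential A B F p v \<in> tangent_space B (F p)"
proof -
  interpret A: mfd A by fact
  interpret B: mfd B by fact
  show ?thesis
    by (rule B.tangent_spaceI)
       (simp_all add: differential_apply B.smooth_at_add B.smooth_at_mult B.smooth_at_cmult
          A.tv_add[OF v] A.tv_mult[OF v] A.tv_cmult[OF v] smapD[OF F], simp add: differential_def)
qed

subsection \<open>Products\<close>

lemma prod_atlas_chart: "(U, \<phi>) \<in> A \<Longrightarrow> (V, \<psi>) \<in> B \<Longrightarrow> (U \<times> V, map_prod \<phi> \<psi>) \<in> prod_atlas A B"
  by (auto simp: prod_atlas_def)

lemma points_prod_atlas: "points (prod_atlas A B) = points A \<times> points B"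
  by (force simp: points_def prod_atlas_def)

locale mfd2 = A: mfd A + B: mfd B
  for A :: "('a, 'e::findim_inner) atlas" and B :: "('b, 'f::findim_inner) atlas"
begin

abbreviation "PB \<equiv> prod_atlas A B"

lemma inv_prod_chart:
  assumes "(U, \<phi>) \<in> A" "(V, \<psi>) \<in> B" "x \<in> \<phi> ` U" "y \<in> \<psi> ` V"
  shows "inv_into (U \<times> V) (map_prod \<phi> \<psi>) (x, y) = (inv_into U \<phi> x, inv_into V \<psi> y)"
proof -
  obtain p q where pq: "p \<in> U" "q \<in> V" "x = \<phi> p" "y = \<psi> q" using assms by auto
  have "inj_on (map_prod \<phi> \<psi>) (U \<times> V)"
    using map_prod_inj_on A.inj_chart B.inj_chart assms by metis
  from inv_into_f_f[OF this, of "(p, q)"] show ?thesis using pq assms by simp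
qed

sublocale P: mfd PB
proof
  fix W :: "('a \<times> 'b) set" and \<chi>1
  assume "(W, \<chi>1) \<in> PB"
  then obtain U \<phi> V \<psi> where W: "W = U \<times> V" "\<chi>1 = map_prod \<phi> \<psi>" and UV: "(U, \<phi>) \<in> A" "(V, \<psi>) \<in> B"
    by (auto simp: prod_atlas_def)
  show "inj_on \<chi>1 W" using W UV map_prod_inj_on A.inj_chart B.inj_chart by metis
  show "open (\<chi>1 ` W)"
    using W UV A.open_chart B.open_chart by (simp add: map_prod_surj_on[OF refl refl] open_Times)
  fix W' :: "('a \<times> 'b) set" and \<chi>2
  assume "(W', \<chi>2) \<in> PB"
  then obtain U' \<phi>' V' \<psi>' where W': "W' = U' \<times> V'" "\<chi>2 = map_prod \<phi>' \<psi>'" and UV': "(U', \<phi>') \<in> A" "(V', \<psi>') \<in> B"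
    by (auto simp: prod_atlas_def)
  have WW: "W \<inter> W' = (U \<inter> U') \<times> (V \<inter> V')" using W W' by auto
  show o: "open (\<chi>1 ` (W \<inter> W'))"
    unfolding WW W(2) map_prod_surj_on[OF refl refl]
    using A.open_overlap B.open_overlap UV UV' by (intro open_Times)
  show "smooth_on (\<chi>1 ` (W \<inter> W')) (\<chi>2 \<circ> inv_into W \<chi>1)"
    unfolding smooth_on_iff_near[OF o]
  proof
    fix z assume "z \<in> \<chi>1 ` (W \<inter> W')"
    then obtain p q where pq: "p \<in> U" "p \<in> U'" "q \<in> V" "q \<in> V'" "z = (\<phi> p, \<psi> q)" "z \<in> \<chi>1 ` (W \<inter> W')"
      using W W' by auto
    have "smooth_near z (\<lambda>z. ((\<phi>' \<circ> inv_into U \<phi>) (fst z), (\<psi>' \<circ> inv_into V \<psi>) (snd z)))"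
      using A.transition_near[OF UV(1) UV'(1) pq(1,2)] B.transition_near[OF UV(2) UV'(2) pq(3,4)] pq(5)
      by (intro smooth_near_Pair smooth_near_comp[OF smooth_near_linear[OF bounded_linear_fst]]
           smooth_near_comp[OF smooth_near_linear[OF bounded_linear_snd]]) (simp_all add: o_def)
    then show "smooth_near z (\<chi>2 \<circ> inv_into W \<chi>1)"
      by (rule smooth_near_cong[OF _ o pq(6)])
         (use W W' UV inv_prod_chart[OF UV] in auto)
  qed
qed

lemma swap: "mfd2 B A" ..

lemma smap_fst:
  assumes pq: "p \<in> points A" "q \<in> points B"
  shows "smap PB A fst (p, q)"
proof -
  obtain U \<phi> where U: "(U, \<phi>) \<in> A" "p \<in> U" using A.points_chart[OF pq(1)] by blast
  obtain V \<psi> where V: "(V, \<psi>) \<in> B" "q \<in> V" using B.points_chart[OF pq(2)] by blast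
  have UV: "(U \<times> V, map_prod \<phi> \<psi>) \<in> PB" "(p, q) \<in> U \<times> V"
    using U V by (auto intro: prod_atlas_chart)
  have "smooth_at PB (p, q) (\<lambda>z. f (fst z))" if f: "smooth_at A p f" for f
  proof -
    have "smooth_near (map_prod \<phi> \<psi> (p, q)) (\<lambda>z. (f \<circ> inv_into U \<phi>) (fst z))"
      using smooth_near_comp[OF smooth_near_linear[OF bounded_linear_fst, of "(\<phi> p, \<psi> q)"], of "f \<circ> inv_into U \<phi>"]
        f[unfolded A.smooth_at_chart[OF U]] by simp
    from P.smooth_at_chart_comp[OF UV this] show ?thesis
      by (rule P.smooth_at_cong[OF _ P.mopen_chart[OF UV(1)] UV(2)]) (use U in auto)
  qed
  then show ?thesis using pq by (simp add: smap_def points_prod_atlas)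
qed

lemma smap_snd:
  assumes pq: "p \<in> points A" "q \<in> points B"
  shows "smap PB B snd (p, q)"
proof -
  obtain U \<phi> where U: "(U, \<phi>) \<in> A" "p \<in> U" using A.points_chart[OF pq(1)] by blast
  obtain V \<psi> where V: "(V, \<psi>) \<in> B" "q \<in> V" using B.points_chart[OF pq(2)] by blast
  have UV: "(U \<times> V, map_prod \<phi> \<psi>) \<in> PB" "(p, q) \<in> U \<times> V"
    using U V by (auto intro: prod_atlas_chart)
  have "smooth_at PB (p, q) (\<lambda>z. f (snd z))" if f: "smooth_at B q f" for f
  proof -
    have "smooth_near (map_prod \<phi> \<psi> (p, q)) (\<lambda>z. (f \<circ> inv_into V \<psi>) (snd z))"
      using smooth_near_comp[OF smooth_near_linear[OF bounded_linear_snd, of "(\<phi> p, \<psi> q)"], of "f \<circ> inv_into V \<psi>"]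
        f[unfolded B.smooth_at_chart[OF V]] by simp
    from P.smooth_at_chart_comp[OF UV this] show ?thesis
      by (rule P.smooth_at_cong[OF _ P.mopen_chart[OF UV(1)] UV(2)]) (use V in auto)
  qed
  then show ?thesis using pq by (simp add: smap_def points_prod_atlas)
qed

lemma smap_Pair:
  fixes C :: "('c, 'g::findim_inner) atlas"
  assumes C: "mfd C" and F: "smap C A F p" and H: "smap C B H p"
  shows "smap C PB (\<lambda>x. (F x, H x)) p"
proof -
  interpret C: mfd C by fact
  have p: "p \<in> points C" "F p \<in> points A" "H p \<in> points B" using F H by (auto simp: smap_def)
  obtain U \<phi> where U: "(U, \<phi>) \<in> A" "F p \<in> U" using A.points_chart[OF p(2)] by blast
  obtain V \<psi> where V: "(V, \<psi>) \<in> B" "H p \<in> V" using B.points_chart[OF p(3)] by blast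
  have UV: "(U \<times> V, map_prod \<phi> \<psi>) \<in> PB" "(F p, H p) \<in> U \<times> V"
    using U V by (auto intro: prod_atlas_chart)
  obtain W1 where W1: "mopen C W1" "p \<in> W1" "\<And>x. x \<in> W1 \<Longrightarrow> F x \<in> U"
    using smap_nbhd[OF C A.mfd_axioms F A.mopen_chart[OF U(1)] U(2)] by blast
  obtain W2 where W2: "mopen C W2" "p \<in> W2" "\<And>x. x \<in> W2 \<Longrightarrow> H x \<in> V"
    using smap_nbhd[OF C B.mfd_axioms H B.mopen_chart[OF V(1)] V(2)] by blast
  have "smooth_at C p (\<lambda>x. f (F x, H x))" if f: "smooth_at PB (F p, H p) f" for f
  proof -
    have "smooth_at C p (\<lambda>x. (f \<circ> inv_into (U \<times> V) (map_prod \<phi> \<psi>)) (\<phi> (F x), \<psi> (H x)))"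
    proof (rule C.smooth_at_comp[OF p(1), where f = "\<lambda>x. (\<phi> (F x), \<psi> (H x))"])
      show "smooth_at C p (\<lambda>q. (\<phi> (F q), \<psi> (H q)) \<bullet> b)" for b
        using C.smooth_at_add[OF smapD[OF F A.smooth_at_coord[OF U, of "fst b"]] smapD[OF H B.smooth_at_coord[OF V, of "snd b"]]]
        by (simp add: inner_prod_def)
      show "smooth_near (\<phi> (F p), \<psi> (H p)) (f \<circ> inv_into (U \<times> V) (map_prod \<phi> \<psi>))"
        using f[unfolded P.smooth_at_chart[OF UV]] by simp
    qed
    then show ?thesis
      by (rule C.smooth_at_cong[OF _ C.mopen_Int[OF W1(1) W2(1)]])
         (use W1 W2 U V in \<open>auto simp: inv_prod_chart\<close>)
  qed
  then show ?thesis using p by (simp add: smap_def points_prod_atlas)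
qed

lemma smap_Pair_left: "p \<in> points A \<Longrightarrow> q \<in> points B \<Longrightarrow> smap B PB (\<lambda>y. (p, y)) q"
  by (intro smap_Pair B.mfd_axioms smap_const smap_id)

lemma smap_Pair_right: "p \<in> points A \<Longrightarrow> q \<in> points B \<Longrightarrow> smap A PB (\<lambda>x. (x, q)) p"
  by (intro smap_Pair A.mfd_axioms smap_const smap_id)

lemma coord_vec_snd:
  assumes U: "(U, \<phi>) \<in> A" "p \<in> U" and V: "(V, \<psi>) \<in> B" "q \<in> V" and H: "smooth_at PB (p, q) H"
  shows "coord_vec B V \<psi> q c (\<lambda>y. H (p, y)) = coord_vec PB (U \<times> V) (map_prod \<phi> \<psi>) (p, q) (0, c) H"
proof (rule B.coord_vec_unique[OF V])
  have UV: "(U \<times> V, map_prod \<phi> \<psi>) \<in> PB" "(p, q) \<in> U \<times> V"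
    using U V by (auto intro: prod_atlas_chart)
  have pq: "p \<in> points A" "q \<in> points B" using U V A.chart_points B.chart_points by blast+
  show "smooth_at B q (\<lambda>y. H (p, y))" using smapD[OF smap_Pair_left[OF pq] H] .
  have D: "((H \<circ> inv_into (U \<times> V) (map_prod \<phi> \<psi>)) has_derivative
      (\<lambda>b. coord_vec PB (U \<times> V) (map_prod \<phi> \<psi>) (p, q) b H)) (at (\<phi> p, \<psi> q))"
    using P.coord_vec_has_derivative[OF UV H] by simp
  have "((\<lambda>y. (\<phi> p, y)) has_derivative (\<lambda>c. (0, c))) (at (\<psi> q))"
    by (rule derivative_eq_intros refl | simp)+
  from has_derivative_compose[OF this D]
  show "((\<lambda>y. H (p, y)) \<circ> inv_into V \<psi> has_derivative
      (\<lambda>c. coord_vec PB (U \<times> V) (map_prod \<phi> \<psi>) (p, q) (0, c) H)) (at (\<psi> q))"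
    by (rule has_derivative_transform_within_open[OF _ B.open_chart[OF V(1)]])
       (use U V in \<open>auto simp: inv_prod_chart\<close>)
qed

text \<open>The derivative in the second variable, written as a combination of derivatives of H on
  the product. These are smooth in both variables, which is how smooth dependence on the parameter p
  is obtained in the next two lemmas.\<close>

lemma tangent_snd_expand:
  assumes U: "(U, \<phi>) \<in> A" "p \<in> U" and V: "(V, \<psi>) \<in> B" "q \<in> V" and H: "smooth_at PB (p, q) H"
    and w: "w \<in> tangent_space B q"
  shows "w (\<lambda>y. H (p, y)) =
    (\<Sum>c\<in>onb. w (\<lambda>y. \<psi> y \<bullet> c) * coord_vec PB (U \<times> V) (map_prod \<phi> \<psi>) (p, q) (0, c) H)"
  using B.tangent_expand[OF V w, of "\<lambda>y. H (p, y)"] by (simp add: coord_vec_snd[OF U V H])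

lemma vf_snd_smooth:
  assumes Y: "vector_field B W Y" "q \<in> W" and H: "smooth_at PB (p, q) H"
  shows "smooth_at PB (p, q) (\<lambda>z. Y (snd z) (\<lambda>y. H (fst z, y)))"
proof -
  have pq: "p \<in> points A" "q \<in> points B" using P.smooth_at_points[OF H] by (auto simp: points_prod_atlas)
  obtain U \<phi> where U: "(U, \<phi>) \<in> A" "p \<in> U" using A.points_chart[OF pq(1)] by blast
  obtain V \<psi> where V: "(V, \<psi>) \<in> B" "q \<in> V" using B.points_chart[OF pq(2)] by blast
  have UV: "(U \<times> V, map_prod \<phi> \<psi>) \<in> PB" "(p, q) \<in> U \<times> V"
    using U V by (auto intro: prod_atlas_chart)
  obtain N where N: "mopen PB N" "(p, q) \<in> N" "\<And>z. z \<in> N \<Longrightarrow> smooth_at PB z H"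
    using P.smooth_at_nbhd[OF H] by blast
  obtain N' where N': "mopen PB N'" "(p, q) \<in> N'" "\<And>z. z \<in> N' \<Longrightarrow> snd z \<in> W"
    by (rule smap_nbhd[OF P.mfd_axioms B.mfd_axioms smap_snd[OF pq] B.vf_mopen[OF Y(1)]])
       (use Y in auto)
  have "smooth_at PB (p, q) (\<lambda>z. \<Sum>c\<in>onb. Y (snd z) (\<lambda>y. \<psi> y \<bullet> c) *
     coord_vec PB (U \<times> V) (map_prod \<phi> \<psi>) z (0, c) H)"
    by (intro P.smooth_at_sum P.smooth_at_mult P.coord_vec_smooth[OF UV H] P.smooth_at_points[OF H]
         smapD[OF smap_snd[OF pq], of "\<lambda>y. Y y f" for f, simplified] B.vf_smooth[OF Y] B.smooth_at_coord[OF V])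
  then show ?thesis
  proof (rule P.smooth_at_cong[OF _ P.mopen_Int[OF P.mopen_Int[OF N(1) N'(1)] P.mopen_chart[OF UV(1)]]])
    fix z assume z: "z \<in> N \<inter> N' \<inter> U \<times> V"
    obtain a b where ab: "z = (a, b)" by (cases z)
    have "a \<in> U" "b \<in> V" "smooth_at PB (a, b) H" "Y b \<in> tangent_space B b"
      using z N(3) N'(3)[of z] ab B.vf_tangent[OF Y(1)] by auto
    then show "(\<Sum>c\<in>onb. Y (snd z) (\<lambda>y. \<psi> y \<bullet> c) * coord_vec PB (U \<times> V) (map_prod \<phi> \<psi>) z (0, c) H) =
        Y (snd z) (\<lambda>y. H (fst z, y))"
      using tangent_snd_expand[OF U(1) _ V(1)] ab by simp
  qed (use N N' UV in auto)
qed

lemma tangent_snd_smooth: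
  assumes w: "w \<in> tangent_space B q" and H: "smooth_at PB (p, q) H"
  shows "smooth_at A p (\<lambda>x. w (\<lambda>y. H (x, y)))"
proof -
  have pq: "p \<in> points A" "q \<in> points B" using P.smooth_at_points[OF H] by (auto simp: points_prod_atlas)
  obtain U \<phi> where U: "(U, \<phi>) \<in> A" "p \<in> U" using A.points_chart[OF pq(1)] by blast
  obtain V \<psi> where V: "(V, \<psi>) \<in> B" "q \<in> V" using B.points_chart[OF pq(2)] by blast
  have UV: "(U \<times> V, map_prod \<phi> \<psi>) \<in> PB" "(p, q) \<in> U \<times> V"
    using U V by (auto intro: prod_atlas_chart)
  obtain N where N: "mopen PB N" "(p, q) \<in> N" "\<And>z. z \<in> N \<Longrightarrow> smooth_at PB z H"
    using P.smooth_at_nbhd[OF H] by blast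
  obtain N' where N': "mopen A N'" "p \<in> N'" "\<And>x. x \<in> N' \<Longrightarrow> (x, q) \<in> N"
    using smap_nbhd[OF A.mfd_axioms P.mfd_axioms smap_Pair_right[OF pq] N(1,2)] by blast
  have "smooth_at A p (\<lambda>x. \<Sum>c\<in>onb. w (\<lambda>y. \<psi> y \<bullet> c) *
     coord_vec PB (U \<times> V) (map_prod \<phi> \<psi>) (x, q) (0, c) H)"
    using smapD[OF smap_Pair_right[OF pq] P.coord_vec_smooth[OF UV H]]
    by (intro A.smooth_at_sum A.smooth_at_cmult pq)
  then show ?thesis
    by (rule A.smooth_at_cong[OF _ A.mopen_Int[OF N'(1) A.mopen_chart[OF U(1)]]])
       (use N N' U in \<open>auto simp: tangent_snd_expand[OF U(1) _ V _ w]\<close>)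
qed

text \<open>The product rule for two-variable functions. The differentials of the three maps into
  the product are compared on its coordinate functions, each of which is a sum of a function of the
  first and a function of the second factor.\<close>

lemma tangent_Pair:
  fixes C :: "('c, 'g::findim_inner) atlas"
  assumes C: "mfd C" and F: "smap C A F p" and G: "smap C B G p" and v: "v \<in> tangent_space C p"
    and H: "smooth_at PB (F p, G p) H"
  shows "v (\<lambda>x. H (F x, G x)) = v (\<lambda>x. H (F x, G p)) + v (\<lambda>x. H (F p, G x))"
proof -
  interpret C: mfd C by fact
  have pq: "p \<in> points C" "F p \<in> points A" "G p \<in> points B" using F G by (auto simp: smap_def)
  obtain U \<phi> where U: "(U, \<phi>) \<in> A" "F p \<in> U" using A.points_chart[OF pq(2)] by blast
  obtain V \<psi> where V: "(V, \<psi>) \<in> B" "G p \<in> V" using B.points_chart[OF pq(3)] by blast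
  have UV: "(U \<times> V, map_prod \<phi> \<psi>) \<in> PB" "(F p, G p) \<in> U \<times> V"
    using U V by (auto intro: prod_atlas_chart)
  let ?D = "\<lambda>K. differential C PB K p v"
  have s: "smap C PB (\<lambda>x. (F x, G x)) p" "smap C PB (\<lambda>x. (F x, G p)) p"
    "smap C PB (\<lambda>x. (F p, G x)) p"
    by (intro smap_Pair C F G smap_const pq)+
  have "?D (\<lambda>x. (F x, G x)) = ?D (\<lambda>x. (F x, G p)) + ?D (\<lambda>x. (F p, G x))"
  proof (rule P.tangent_eq_coord[OF UV])
    show "?D (\<lambda>x. (F x, G x)) \<in> tangent_space PB (F p, G p)"
      using differential_tangent[OF C P.mfd_axioms s(1) v] .
    show "?D (\<lambda>x. (F x, G p)) + ?D (\<lambda>x. (F p, G x)) \<in> tangent_space PB (F p, G p)"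
      using differential_tangent[OF C P.mfd_axioms s(2) v] differential_tangent[OF C P.mfd_axioms s(3) v]
      by (rule P.tangent_add)
    fix b :: "'e \<times> 'f"
    have "smooth_at C p (\<lambda>x. \<phi> (F x) \<bullet> fst b)" "smooth_at C p (\<lambda>x. \<psi> (G x) \<bullet> snd b)"
      using smapD[OF F A.smooth_at_coord[OF U]] smapD[OF G B.smooth_at_coord[OF V]] .
    then show "?D (\<lambda>x. (F x, G x)) (\<lambda>z. map_prod \<phi> \<psi> z \<bullet> b) =
        (?D (\<lambda>x. (F x, G p)) + ?D (\<lambda>x. (F p, G x))) (\<lambda>z. map_prod \<phi> \<psi> z \<bullet> b)"
      using P.smooth_at_coord[OF UV, of b]
      by (simp add: differential_apply inner_prod_def C.tv_add[OF v] C.smooth_at_const[OF pq(1)] C.tv_const[OF v pq(1)])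
  qed
  from fun_cong[OF this, of H] show ?thesis using H by (simp add: differential_apply)
qed

text \<open>Symmetry of mixed partial derivatives, obtained from a Hadamard decomposition
  \<open>H(x, y) = c + \<Sum>\<^sub>e (\<alpha>\<^sub>e(x) + \<beta>\<^sub>e(y)) h\<^sub>e(x, y)\<close>: the iterated derivative is an expression symmetric in
  the two factors.\<close>

lemma iterated_derivative:
  assumes v: "v \<in> tangent_space A p" and w: "w \<in> tangent_space B q" and pq: "p \<in> points A" "q \<in> points B"
    and W: "mopen PB W" "(p, q) \<in> W"
    and \<alpha>: "\<And>e. smooth_at A p (\<alpha> e)" "\<And>e. \<alpha> e p = 0"
    and \<beta>: "\<And>e. smooth_at B q (\<beta> e)" "\<And>e. \<beta> e q = 0"
    and I: "finite I" and h: "\<And>e. smooth_at PB (p, q) (h e)"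
    and eq: "\<And>x y. (x, y) \<in> W \<Longrightarrow> H (x, y) = c + (\<Sum>e\<in>I. (\<alpha> e x + \<beta> e y) * h e (x, y))"
    and H: "smooth_at PB (p, q) H"
  shows "v (\<lambda>x. w (\<lambda>y. H (x, y))) = (\<Sum>e\<in>I. v (\<alpha> e) * w (\<lambda>y. h e (p, y)) + w (\<beta> e) * v (\<lambda>x. h e (x, q)))"
proof -
  \<comment> \<open>Each \<open>h e\<close> is smooth on some neighbourhood of its own; finiteness
    of I yields a common one.\<close>
  have "\<exists>N. mopen PB N \<and> (p, q) \<in> N \<and> (\<forall>z\<in>N. \<forall>e\<in>J. smooth_at PB z (h e))"
    if "finite J" for J
    using that
  proof (induction J)
    case empty
    then show ?case using W by blast
  next
    case (insert e J)
    then obtain N where N: "mopen PB N" "(p, q) \<in> N" "\<forall>z\<in>N. \<forall>e\<in>J. smooth_at PB z (h e)"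
      by blast
    obtain N' where N': "mopen PB N'" "(p, q) \<in> N'" "\<forall>z\<in>N'. smooth_at PB z (h e)"
      using P.smooth_at_nbhd[OF h] by blast
    show ?case
      by (rule exI[of _ "N \<inter> N'"]) (use N N' P.mopen_Int in auto)
  qed
  from this[OF I] obtain N where N: "mopen PB N" "(p, q) \<in> N"
    "\<And>z e. z \<in> N \<Longrightarrow> e \<in> I \<Longrightarrow> smooth_at PB z (h e)"
    by blast
  obtain N1 where N1: "mopen A N1" "p \<in> N1" "\<And>x. x \<in> N1 \<Longrightarrow> (x, q) \<in> N \<inter> W"
    using smap_nbhd[OF A.mfd_axioms P.mfd_axioms smap_Pair_right[OF pq] P.mopen_Int[OF N(1) W(1)]] N W by blast
  \<comment> \<open>The Leibniz rule at y = q, where every \<open>\<beta> e\<close> vanishes, so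
    that only \<open>\<alpha> e x\<close> remains as the value of the first factor.\<close>
  have inner: "w (\<lambda>y. H (x, y)) = (\<Sum>e\<in>I. \<alpha> e x * w (\<lambda>y. h e (x, y)) + w (\<beta> e) * h e (x, q))" if x: "x \<in> N1" for x
  proof -
    have xq: "(x, q) \<in> N" "(x, q) \<in> W" using N1(3)[OF x] by auto
    have px: "x \<in> points A" using A.mopen_subset[OF N1(1) x] .
    obtain M where M: "mopen B M" "q \<in> M" "\<And>y. y \<in> M \<Longrightarrow> (x, y) \<in> W"
      using smap_nbhd[OF B.mfd_axioms P.mfd_axioms smap_Pair_left[OF px pq(2)] W(1) xq(2)] by blast
    have sh: "smooth_at B q (\<lambda>y. h e (x, y))" if "e \<in> I" for e
      using smapD[OF smap_Pair_left[OF px pq(2)] N(3)[OF xq(1) that]] .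
    have s\<beta>: "smooth_at B q (\<lambda>y. \<alpha> e x + \<beta> e y)" for e
      by (intro B.smooth_at_add B.smooth_at_const \<beta> pq)
    have w\<beta>: "w (\<lambda>y. \<alpha> e x + \<beta> e y) = w (\<beta> e)" for e
      by (simp add: B.tv_add[OF w] B.tv_const[OF w] B.smooth_at_const \<beta> pq)
    have s: "smooth_at B q (\<lambda>y. c + (\<Sum>e\<in>I. (\<alpha> e x + \<beta> e y) * h e (x, y)))"
      by (intro B.smooth_at_add B.smooth_at_const B.smooth_at_sum B.smooth_at_mult s\<beta> sh pq)
    have "w (\<lambda>y. H (x, y)) = w (\<lambda>y. c + (\<Sum>e\<in>I. (\<alpha> e x + \<beta> e y) * h e (x, y)))"
      by (rule B.tv_cong[OF w M(1,2) s, symmetric]) (simp add: eq M(3))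
    also have "\<dots> = (\<Sum>e\<in>I. w (\<lambda>y. (\<alpha> e x + \<beta> e y) * h e (x, y)))"
      by (simp add: B.tv_add[OF w] B.tv_const[OF w] B.tv_sum[OF w] B.smooth_at_const B.smooth_at_sum B.smooth_at_mult s\<beta> sh pq)
    also have "\<dots> = (\<Sum>e\<in>I. \<alpha> e x * w (\<lambda>y. h e (x, y)) + w (\<beta> e) * h e (x, q))"
      by (intro sum.cong refl) (simp add: B.tv_mult[OF w s\<beta> sh] w\<beta> \<beta>)
    finally show ?thesis .
  qed
  have s1: "smooth_at A p (\<lambda>x. w (\<lambda>y. h e (x, y)))" for e by (rule tangent_snd_smooth[OF w h])
  have s2: "smooth_at A p (\<lambda>x. h e (x, q))" for e using smapD[OF smap_Pair_right[OF pq] h] .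
  have "v (\<lambda>x. w (\<lambda>y. H (x, y))) = v (\<lambda>x. \<Sum>e\<in>I. \<alpha> e x * w (\<lambda>y. h e (x, y)) + w (\<beta> e) * h e (x, q))"
    by (rule A.tv_cong[OF v N1(1,2) tangent_snd_smooth[OF w H] inner])
  also have "\<dots> = (\<Sum>e\<in>I. v (\<lambda>x. \<alpha> e x * w (\<lambda>y. h e (x, y)) + w (\<beta> e) * h e (x, q)))"
    by (intro A.tv_sum[OF v] A.smooth_at_add A.smooth_at_mult A.smooth_at_cmult s1 s2 \<alpha> pq)
  also have "\<dots> = (\<Sum>e\<in>I. v (\<alpha> e) * w (\<lambda>y. h e (p, y)) + w (\<beta> e) * v (\<lambda>x. h e (x, q)))"
    by (intro sum.cong refl)
       (simp add: A.tv_add[OF v] A.tv_mult[OF v] A.tv_cmult[OF v] A.smooth_at_mult A.smooth_at_cmult s1 s2 \<alpha>)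
  finally show ?thesis .
qed

lemma mixed_derivatives:
  assumes v: "v \<in> tangent_space A p" and w: "w \<in> tangent_space B q" and H: "smooth_at PB (p, q) H"
  shows "v (\<lambda>x. w (\<lambda>y. H (x, y))) = w (\<lambda>y. v (\<lambda>x. H (x, y)))"
proof -
  interpret S: mfd2 B A by (rule swap)
  have pq: "p \<in> points A" "q \<in> points B" using P.smooth_at_points[OF H] by (auto simp: points_prod_atlas)
  obtain U \<phi> where U: "(U, \<phi>) \<in> A" "p \<in> U" using A.points_chart[OF pq(1)] by blast
  obtain V \<psi> where V: "(V, \<psi>) \<in> B" "q \<in> V" using B.points_chart[OF pq(2)] by blast
  have UV: "(U \<times> V, map_prod \<phi> \<psi>) \<in> PB" "(p, q) \<in> U \<times> V"
    using U V by (auto intro: prod_atlas_chart)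
  obtain W h where W: "mopen PB W" "(p, q) \<in> W" and h: "\<And>e. smooth_at PB (p, q) (h e)"
    and eq: "\<And>z. z \<in> W \<Longrightarrow> H z = H (p, q) + (\<Sum>e\<in>onb. ((map_prod \<phi> \<psi> z - map_prod \<phi> \<psi> (p, q)) \<bullet> e) * h e z)"
    by (rule P.Hadamard_chart[OF UV H]) (rule that)
  define \<alpha> where "\<alpha> e x = (\<phi> x - \<phi> p) \<bullet> fst e" for e :: "'e \<times> 'f" and x
  define \<beta> where "\<beta> e y = (\<psi> y - \<psi> q) \<bullet> snd e" for e :: "'e \<times> 'f" and y
  have \<alpha>: "smooth_at A p (\<alpha> e)" "\<alpha> e p = 0" for e
    using A.smooth_at_diff[OF A.smooth_at_coord[OF U] A.smooth_at_const[OF pq(1)]]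
    by (simp_all add: \<alpha>_def[abs_def] inner_diff_left)
  have \<beta>: "smooth_at B q (\<beta> e)" "\<beta> e q = 0" for e
    using B.smooth_at_diff[OF B.smooth_at_coord[OF V] B.smooth_at_const[OF pq(2)]]
    by (simp_all add: \<beta>_def[abs_def] inner_diff_left)
  have eq: "H (x, y) = H (p, q) + (\<Sum>e\<in>onb. (\<alpha> e x + \<beta> e y) * h e (x, y))" if "(x, y) \<in> W" for x y
    using eq[OF that] by (simp add: \<alpha>_def \<beta>_def inner_prod_def)
  \<comment> \<open>Exchange of the factors. It lets \<open>iterated_derivative\<close> be applied a
    second time to the same decomposition with \<alpha> and \<beta> in exchanged roles; the two sums
    then agree up to the order of terms and factors.\<close>
  have sw: "smap (prod_atlas B A) PB (\<lambda>z. (snd z, fst z)) (q, p)"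
    by (intro smap_Pair S.P.mfd_axioms S.smap_fst S.smap_snd pq)
  obtain W' where W': "mopen (prod_atlas B A) W'" "(q, p) \<in> W'" "\<And>z. z \<in> W' \<Longrightarrow> (snd z, fst z) \<in> W"
    by (rule smap_nbhd[OF S.P.mfd_axioms P.mfd_axioms sw W(1)]) (use W in auto)
  have "v (\<lambda>x. w (\<lambda>y. H (x, y))) = (\<Sum>e\<in>onb. v (\<alpha> e) * w (\<lambda>y. h e (p, y)) + w (\<beta> e) * v (\<lambda>x. h e (x, q)))"
    by (rule iterated_derivative[OF v w pq W \<alpha> \<beta> finite_onb h eq H])
  moreover have "w (\<lambda>y. v (\<lambda>x. (\<lambda>z. H (snd z, fst z)) (y, x))) =
      (\<Sum>e\<in>onb. w (\<beta> e) * v (\<lambda>x. (\<lambda>z. h e (snd z, fst z)) (q, x)) + v (\<alpha> e) * w (\<lambda>y. (\<lambda>z. h e (snd z, fst z)) (y, p)))"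
  proof (rule S.iterated_derivative[OF w v pq(2,1) W'(1,2) \<beta> \<alpha> finite_onb])
    show "smooth_at (prod_atlas B A) (q, p) (\<lambda>z. h e (snd z, fst z))" for e
      using smapD[OF sw, of "h e"] h by simp
    show "smooth_at (prod_atlas B A) (q, p) (\<lambda>z. H (snd z, fst z))"
      using smapD[OF sw, of H] H by simp
    show "(\<lambda>z. H (snd z, fst z)) (y, x) = H (p, q) + (\<Sum>e\<in>onb. (\<beta> e y + \<alpha> e x) * (\<lambda>z. h e (snd z, fst z)) (y, x))"
      if "(y, x) \<in> W'" for x y
      using eq[of x y] W'(3)[OF that] by (simp add: add.commute)
  qed
  ultimately show ?thesis by (simp add: add.commute mult.commute)
qed

end

subsection \<open>The cotangent bundle\<close>

locale cotangent_mfd = A: mfd A for A :: "('a, 'e::findim_inner) atlas"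
begin

abbreviation "CB \<equiv> cotangent_bundle A"
abbreviation "CS U \<equiv> Sigma U (cotangent_space A)"

lemma coord_vec_onb_sum:
  assumes "(U, \<phi>) \<in> A" "p \<in> U"
  shows "coord_vec A U \<phi> p x = (\<Sum>b\<in>onb. fscale (x \<bullet> b) (coord_vec A U \<phi> p b))"
  by (rule ext) (simp add: sum_fun_apply fscale_def A.coord_vec_onb[OF assms, of x, symmetric])

text \<open>Resolves the definite description in \<open>cotangent_chart\<close>: the representing
  vector is built from \<open>onb\<close>, and from then on only its inner products matter.\<close>

lemma cotangent_chart_inner:
  assumes U: "(U, \<phi>) \<in> A" "p \<in> U" and \<xi>: "\<xi> \<in> cotangent_space A p"
  shows "fst (cotangent_chart A U \<phi> (p, \<xi>)) = \<phi> p"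
    and "snd (cotangent_chart A U \<phi> (p, \<xi>)) \<bullet> b = \<xi> (coord_vec A U \<phi> p b)"
proof -
  define w where "w = (\<Sum>b\<in>onb. \<xi> (coord_vec A U \<phi> p b) *\<^sub>R b)"
  have w: "w \<bullet> x = \<xi> (coord_vec A U \<phi> p x)" for x
    by (subst coord_vec_onb_sum[OF U], subst A.ct_sum[OF \<xi>])
       (auto simp: A.tangent_scale A.coord_vec_tangent[OF U] A.ct_scale[OF \<xi>] w_def inner_sum_left inner_commute[of x] mult.commute)
  have "(THE w. \<forall>b. w \<bullet> b = \<xi> (coord_vec A U \<phi> p b)) = w"
    using w by (intro the_equality) (auto intro: onb_eqI)
  then show "snd (cotangent_chart A U \<phi> (p, \<xi>)) \<bullet> b = \<xi> (coord_vec A U \<phi> p b)"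
    by (simp add: cotangent_chart_def w)
  show "fst (cotangent_chart A U \<phi> (p, \<xi>)) = \<phi> p"
    by (simp add: cotangent_chart_def)
qed

text \<open>The covector at p whose coordinate vector in the chart is w, that is, the inverse of the
  fibre part of \<open>cotangent_chart\<close>.\<close>

definition cov :: "'a set \<Rightarrow> ('a \<Rightarrow> 'e) \<Rightarrow> 'a \<Rightarrow> 'e \<Rightarrow> 'a cvec" where
  "cov U \<phi> p w = (\<lambda>v. if v \<in> tangent_space A p then \<Sum>b\<in>onb. v (\<lambda>q. \<phi> q \<bullet> b) * (w \<bullet> b) else 0)"

lemma cov_cotangent: "cov U \<phi> p w \<in> cotangent_space A p"
  by (rule A.cotangentI)
     (auto simp: cov_def A.tangent_add A.tangent_scale distrib_right sum.distrib, simp add: fscale_def sum_distrib_left mult.assoc)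

lemma cotangent_chart_cov:
  assumes U: "(U, \<phi>) \<in> A" "p \<in> U"
  shows "cotangent_chart A U \<phi> (p, cov U \<phi> p w) = (\<phi> p, w)"
proof -
  have "cov U \<phi> p w (coord_vec A U \<phi> p c) = w \<bullet> c" if "c \<in> onb" for c
  proof -
    have "cov U \<phi> p w (coord_vec A U \<phi> p c) = (\<Sum>b\<in>onb. (w \<bullet> b) *\<^sub>R b) \<bullet> c"
      by (simp add: cov_def A.coord_vec_tangent[OF U] A.coord_vec_coord[OF U] inner_sum_left inner_commute[of c] mult.commute)
    then show ?thesis by (simp add: onb_expand)
  qed
  then have "snd (cotangent_chart A U \<phi> (p, cov U \<phi> p w)) = w"
    by (subst onb_eqI) (simp_all add: cotangent_chart_inner(2)[OF U cov_cotangent])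
  then show ?thesis
    using cotangent_chart_inner(1)[OF U cov_cotangent] by (simp add: prod_eq_iff)
qed

lemma cotangent_chart_inj:
  assumes U: "(U, \<phi>) \<in> A"
  shows "inj_on (cotangent_chart A U \<phi>) (CS U)"
proof (rule inj_onI, clarify)
  fix p \<xi> q \<eta> assume p: "p \<in> U" "\<xi> \<in> cotangent_space A p" and q: "q \<in> U" "\<eta> \<in> cotangent_space A q"
    and eq: "cotangent_chart A U \<phi> (p, \<xi>) = cotangent_chart A U \<phi> (q, \<eta>)"
  have "\<phi> p = \<phi> q"
    using eq cotangent_chart_inner(1)[OF U p] cotangent_chart_inner(1)[OF U q] by simp
  then have pq: "p = q" using A.inj_chart[OF U] p q by (auto dest: inj_onD)
  have "\<xi> (coord_vec A U \<phi> p b) = \<eta> (coord_vec A U \<phi> p b)" for b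
    using eq cotangent_chart_inner(2)[OF U p, of b] cotangent_chart_inner(2)[OF U q, of b] pq by simp
  then have "\<xi> = \<eta>"
    using p q pq by (intro A.cotangent_eqI[of _ p]) (auto simp: A.ct_expand[OF U p(1)])
  then show "p = q \<and> \<xi> = \<eta>" using pq by simp
qed

lemma cotangent_chart_image:
  assumes U: "(U, \<phi>) \<in> A" and N: "N \<subseteq> U"
  shows "cotangent_chart A U \<phi> ` CS N = \<phi> ` N \<times> UNIV"
proof (intro equalityI subsetI)
  fix z assume "z \<in> cotangent_chart A U \<phi> ` CS N"
  then obtain p \<xi> where p: "p \<in> N" "\<xi> \<in> cotangent_space A p" and z: "z = cotangent_chart A U \<phi> (p, \<xi>)" by auto
  then have "fst z = \<phi> p" using cotangent_chart_inner(1)[OF U _ p(2)] N by auto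
  then show "z \<in> \<phi> ` N \<times> UNIV" using p by (auto simp: mem_Times_iff)
next
  fix z :: "'e \<times> 'e" assume "z \<in> \<phi> ` N \<times> UNIV"
  then obtain p where p: "p \<in> N" "z = (\<phi> p, snd z)" by (auto simp: mem_Times_iff prod_eq_iff)
  then have "z = cotangent_chart A U \<phi> (p, cov U \<phi> p (snd z))"
    using cotangent_chart_cov[OF U] N by (metis subsetD)
  then show "z \<in> cotangent_chart A U \<phi> ` CS N" using p cov_cotangent by blast
qed

lemma inv_cotangent_chart:
  assumes U: "(U, \<phi>) \<in> A" "p \<in> U"
  shows "inv_into (CS U) (cotangent_chart A U \<phi>) (\<phi> p, w) = (p, cov U \<phi> p w)"
  using inv_into_f_f[OF cotangent_chart_inj[OF U(1)], of "(p, cov U \<phi> p w)"] U cov_cotangent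
  by (simp add: cotangent_chart_cov[OF U])

lemma cotangent_bundle_chart: "(U, \<phi>) \<in> A \<Longrightarrow> (CS U, cotangent_chart A U \<phi>) \<in> CB"
  by (auto simp: cotangent_bundle_def)

lemma points_cotangent_bundle: "points CB = CS (points A)"
  by (force simp: points_def cotangent_bundle_def)

lemma smooth_near_fst:
  "smooth_near (fst z) f \<Longrightarrow> smooth_near z (\<lambda>z. f (fst z))"
  by (rule smooth_near_comp[OF smooth_near_linear[OF bounded_linear_fst]])

sublocale C: mfd CB
proof
  fix W \<chi>1
  assume "(W, \<chi>1) \<in> CB"
  then obtain U \<phi> where W: "W = CS U" "\<chi>1 = cotangent_chart A U \<phi>" and U: "(U, \<phi>) \<in> A"
    by (auto simp: cotangent_bundle_def)
  show "inj_on \<chi>1 W" using W cotangent_chart_inj[OF U] by simp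
  show "open (\<chi>1 ` W)"
    using W cotangent_chart_image[OF U subset_refl] A.open_chart[OF U] by (simp add: open_Times)
  fix W' \<chi>2
  assume "(W', \<chi>2) \<in> CB"
  then obtain V \<psi> where W': "W' = CS V" "\<chi>2 = cotangent_chart A V \<psi>" and V: "(V, \<psi>) \<in> A"
    by (auto simp: cotangent_bundle_def)
  have WW: "W \<inter> W' = CS (U \<inter> V)" using W W' by auto
  have im: "\<chi>1 ` (W \<inter> W') = \<phi> ` (U \<inter> V) \<times> UNIV"
    unfolding WW W(2) by (rule cotangent_chart_image[OF U]) auto
  show o: "open (\<chi>1 ` (W \<inter> W'))"
    unfolding im using A.open_overlap[OF U V] by (simp add: open_Times)
  show "smooth_on (\<chi>1 ` (W \<inter> W')) (\<chi>2 \<circ> inv_into W \<chi>1)"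
    unfolding smooth_on_iff_near[OF o]
  proof
    fix z assume z: "z \<in> \<chi>1 ` (W \<inter> W')"
    then obtain p where p: "p \<in> U" "p \<in> V" "fst z = \<phi> p" unfolding im by auto
    \<comment> \<open>The Jacobian matrix of the change of coordinates. Covectors transform by it,
      so a change of bundle charts is linear in the fibre with coefficients smooth on the
      base.\<close>
    define g where "g b c q = coord_vec A V \<psi> q b (\<lambda>r. \<phi> r \<bullet> c)" for b c q
    have g: "smooth_near (\<phi> p) (g b c \<circ> inv_into U \<phi>)" for b c
      using A.coord_vec_smooth[OF V p(2) A.smooth_at_coord[OF U p(1)]] A.smooth_at_chart[OF U p(1)]
      by (simp add: g_def[abs_def])
    have t: "smooth_near (\<phi> p) (\<psi> \<circ> inv_into U \<phi>)"
      by (rule A.transition_near[OF U V p(1,2)])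
    have "smooth_near z (\<lambda>z. ((\<psi> \<circ> inv_into U \<phi>) (fst z),
        \<Sum>b\<in>onb. (\<Sum>c\<in>onb. (g b c \<circ> inv_into U \<phi>) (fst z) * (snd z \<bullet> c)) *\<^sub>R b))"
      by (intro smooth_near_Pair smooth_near_sum smooth_near_scaleR smooth_near_mult smooth_near_const
           smooth_near_fst[where f = "\<psi> \<circ> inv_into U \<phi>"] smooth_near_fst[where f = "g b c \<circ> inv_into U \<phi>" for b c]
           smooth_near_linear[where h = "\<lambda>z. snd z \<bullet> c" for c] bounded_linear_inner_left_comp bounded_linear_snd)
         (use g t p(3) in simp_all)
    then show "smooth_near z (\<chi>2 \<circ> inv_into W \<chi>1)"
    proof (rule smooth_near_cong[OF _ o z])
      fix y assume "y \<in> \<chi>1 ` (W \<inter> W')"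
      then obtain q w where q: "q \<in> U" "q \<in> V" "y = (\<phi> q, w)" unfolding im by auto
      have "(\<chi>2 \<circ> inv_into W \<chi>1) y = cotangent_chart A V \<psi> (q, cov U \<phi> q w)"
        using W W' q inv_cotangent_chart[OF U q(1)] by simp
      also have "\<dots> = (\<psi> q, \<Sum>b\<in>onb. (\<Sum>c\<in>onb. g b c q * (w \<bullet> c)) *\<^sub>R b)"
      proof (rule prod_eqI)
        show "snd (cotangent_chart A V \<psi> (q, cov U \<phi> q w)) = snd (\<psi> q, \<Sum>b\<in>onb. (\<Sum>c\<in>onb. g b c q * (w \<bullet> c)) *\<^sub>R b)"
          by (rule onb_eqI)
             (simp add: cotangent_chart_inner(2)[OF V q(2) cov_cotangent] inner_sum_onb,
              simp add: cov_def A.coord_vec_tangent[OF V q(2)] g_def)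
      qed (simp add: cotangent_chart_inner(1)[OF V q(2) cov_cotangent])
      finally show "((\<psi> \<circ> inv_into U \<phi>) (fst y),
          \<Sum>b\<in>onb. (\<Sum>c\<in>onb. (g b c \<circ> inv_into U \<phi>) (fst y) * (snd y \<bullet> c)) *\<^sub>R b) = (\<chi>2 \<circ> inv_into W \<chi>1) y"
        using q U by simp
    qed
  qed
qed

lemma mopen_CS: "mopen A W \<Longrightarrow> mopen CB (CS W)"
proof -
  assume W: "mopen A W"
  have "open (cotangent_chart A U \<phi> ` (CS W \<inter> CS U))" if U: "(U, \<phi>) \<in> A" for U \<phi>
  proof -
    have "CS W \<inter> CS U = CS (W \<inter> U)" by auto
    then show ?thesis
      using cotangent_chart_image[OF U, of "W \<inter> U"] A.mopen_image[OF W U] by (simp add: open_Times)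
  qed
  then show "mopen CB (CS W)"
    using A.mopen_subset[OF W] unfolding mopen_def points_cotangent_bundle
    by (auto simp: cotangent_bundle_def)
qed

lemma smap_proj:
  assumes x: "x \<in> points CB"
  shows "smap CB A fst x"
proof -
  obtain p \<xi> where px: "x = (p, \<xi>)" by (cases x)
  have p: "p \<in> points A" "\<xi> \<in> cotangent_space A p" using x px by (auto simp: points_cotangent_bundle)
  obtain U \<phi> where U: "(U, \<phi>) \<in> A" "p \<in> U" using A.points_chart[OF p(1)] by blast
  have CU: "x \<in> CS U" using U p px by simp
  have "smooth_at CB x (\<lambda>z. f (fst z))" if f: "smooth_at A p f" for f
  proof -
    have "smooth_near (cotangent_chart A U \<phi> x) (\<lambda>z. (f \<circ> inv_into U \<phi>) (fst z))"
      using f[unfolded A.smooth_at_chart[OF U]] cotangent_chart_inner(1)[OF U p(2)] px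
      by (intro smooth_near_fst[where f = "f \<circ> inv_into U \<phi>"]) simp
    from C.smooth_at_chart_comp[OF cotangent_bundle_chart[OF U(1)] CU this] show ?thesis
      by (rule C.smooth_at_cong[OF _ C.mopen_chart[OF cotangent_bundle_chart[OF U(1)]] CU])
         (use U cotangent_chart_inner(1)[OF U(1)] in auto)
  qed
  then show ?thesis using x px p by (simp add: smap_def)
qed

lemma smooth_proj: "(p, \<xi>) \<in> points CB \<Longrightarrow> smooth_at A p f \<Longrightarrow> smooth_at CB (p, \<xi>) (\<lambda>z. f (fst z))"
  using smapD[OF smap_proj, of "(p, \<xi>)" f] by simp

lemma smooth_fibre_coord:
  assumes U: "(U, \<phi>) \<in> A" "p \<in> U" and \<xi>: "\<xi> \<in> cotangent_space A p"
  shows "smooth_at CB (p, \<xi>) (\<lambda>z. snd z (coord_vec A U \<phi> (fst z) b))"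
proof -
  have CU: "(p, \<xi>) \<in> CS U" using U \<xi> by simp
  from C.smooth_at_coord[OF cotangent_bundle_chart[OF U(1)] CU, of "(0, b)"] show ?thesis
    by (rule C.smooth_at_cong[OF _ C.mopen_chart[OF cotangent_bundle_chart[OF U(1)]] CU])
       (auto simp: inner_prod_def cotangent_chart_inner[OF U(1)])
qed

text \<open>The fibrewise linear function that a vector field defines on the cotangent bundle. In a
  chart it is a combination of fibre coordinates with the components of Y as coefficients.\<close>

lemma smooth_momentum:
  assumes Y: "vector_field A W Y" "p \<in> W" and \<xi>: "\<xi> \<in> cotangent_space A p"
  shows "smooth_at CB (p, \<xi>) (\<lambda>z. snd z (Y (fst z)))"
proof -
  have p: "p \<in> points A" using A.mopen_subset[OF A.vf_mopen[OF Y(1)] Y(2)] .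
  have x: "(p, \<xi>) \<in> points CB" using p \<xi> by (simp add: points_cotangent_bundle)
  obtain U \<phi> where U: "(U, \<phi>) \<in> A" "p \<in> U" using A.points_chart[OF p(1)] by blast
  have "smooth_at CB (p, \<xi>) (\<lambda>z. \<Sum>b\<in>onb. Y (fst z) (\<lambda>q. \<phi> q \<bullet> b) * snd z (coord_vec A U \<phi> (fst z) b))"
    by (intro C.smooth_at_sum C.smooth_at_mult x smooth_fibre_coord[OF U \<xi>]
         smooth_proj[OF x, of "\<lambda>q. Y q f" for f] A.vf_smooth[OF Y] A.smooth_at_coord[OF U])
  then show ?thesis
    by (rule C.smooth_at_cong[OF _ mopen_CS[OF A.mopen_Int[OF A.vf_mopen[OF Y(1)] A.mopen_chart[OF U(1)]]]])
       (use Y U \<xi> in \<open>auto simp: A.ct_expand[OF U(1) _ _ A.vf_tangent[OF Y(1)], symmetric]\<close>)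
qed

lemma smap_section:
  assumes \<sigma>: "one_form A W \<sigma>" "p \<in> W"
  shows "smap A CB (\<lambda>q. (q, \<sigma> q)) p"
proof -
  note \<sigma>p = A.of_cotangent[OF \<sigma>(1)]
  have p: "p \<in> points A" using A.mopen_subset[OF A.of_mopen[OF \<sigma>(1)] \<sigma>(2)] .
  have x: "(p, \<sigma> p) \<in> points CB" using p \<sigma>p[OF \<sigma>(2)] by (simp add: points_cotangent_bundle)
  obtain U \<phi> where U: "(U, \<phi>) \<in> A" "p \<in> U" using A.points_chart[OF p(1)] by blast
  have CU: "(CS U, cotangent_chart A U \<phi>) \<in> CB" "(p, \<sigma> p) \<in> CS U"
    using U \<sigma>p \<sigma>(2) cotangent_bundle_chart by auto
  have WU: "mopen A (W \<inter> U)" "p \<in> W \<inter> U"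
    using A.mopen_Int[OF A.of_mopen[OF \<sigma>(1)] A.mopen_chart[OF U(1)]] U \<sigma> by auto
  have "smooth_at A p (\<lambda>q. f (q, \<sigma> q))" if f: "smooth_at CB (p, \<sigma> p) f" for f
  proof -
    let ?\<chi> = "cotangent_chart A U \<phi>"
    have "smooth_at A p (\<lambda>q. (f \<circ> inv_into (CS U) ?\<chi>) (?\<chi> (q, \<sigma> q)))"
    proof (rule A.smooth_at_comp[OF p, where f = "\<lambda>q. ?\<chi> (q, \<sigma> q)"])
      show "smooth_near (?\<chi> (p, \<sigma> p)) (f \<circ> inv_into (CS U) ?\<chi>)"
        using f[unfolded C.smooth_at_chart[OF CU]] .
      fix b :: "'e \<times> 'e"
      have "smooth_at A p (\<lambda>q. \<phi> q \<bullet> fst b + \<sigma> q (coord_vec A U \<phi> q (snd b)))"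
        by (intro A.smooth_at_add A.smooth_at_coord[OF U] A.of_smooth[OF \<sigma> A.vf_coord[OF U(1)] U(2)])
      then show "smooth_at A p (\<lambda>q. ?\<chi> (q, \<sigma> q) \<bullet> b)"
        by (rule A.smooth_at_cong[OF _ WU])
           (use \<sigma>p in \<open>auto simp: inner_prod_def cotangent_chart_inner[OF U(1)]\<close>)
    qed
    then show ?thesis
      by (rule A.smooth_at_cong[OF _ WU]) (use \<sigma>p CU(1) in auto)
  qed
  then show ?thesis using x p by (simp add: smap_def)
qed

text \<open>Every chart coordinate of the bundle is a function pulled back from the base plus a
  constant combination of fibre coordinates, so these two families separate tangent vectors.\<close>

lemma tangent_eq_cotangent:
  assumes U: "(U, \<phi>) \<in> A" "p \<in> U" and \<xi>: "\<xi> \<in> cotangent_space A p"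
    and w: "w \<in> tangent_space CB (p, \<xi>)" and w': "w' \<in> tangent_space CB (p, \<xi>)"
    and base: "\<And>f. smooth_at A p f \<Longrightarrow> w (\<lambda>z. f (fst z)) = w' (\<lambda>z. f (fst z))"
    and fibre: "\<And>b. b \<in> onb \<Longrightarrow> w (\<lambda>z. snd z (coord_vec A U \<phi> (fst z) b)) = w' (\<lambda>z. snd z (coord_vec A U \<phi> (fst z) b))"
  shows "w = w'"
proof -
  have CU: "(CS U, cotangent_chart A U \<phi>) \<in> CB" "(p, \<xi>) \<in> CS U"
    using U \<xi> cotangent_bundle_chart by auto
  have x: "(p, \<xi>) \<in> points CB" by (rule C.chart_points[OF CU])
  have "v (\<lambda>z. cotangent_chart A U \<phi> z \<bullet> e) =
      v (\<lambda>z. \<phi> (fst z) \<bullet> fst e) + (\<Sum>b\<in>onb. (b \<bullet> snd e) * v (\<lambda>z. snd z (coord_vec A U \<phi> (fst z) b)))"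
    if v: "v \<in> tangent_space CB (p, \<xi>)" for v and e :: "'e \<times> 'e"
  proof -
    have s1: "smooth_at CB (p, \<xi>) (\<lambda>z. \<phi> (fst z) \<bullet> fst e)"
      by (rule smooth_proj[OF x A.smooth_at_coord[OF U]])
    have s2: "smooth_at CB (p, \<xi>) (\<lambda>z. \<Sum>b\<in>onb. (b \<bullet> snd e) * snd z (coord_vec A U \<phi> (fst z) b))"
      by (intro C.smooth_at_sum C.smooth_at_cmult smooth_fibre_coord[OF U \<xi>] x)
    have "v (\<lambda>z. cotangent_chart A U \<phi> z \<bullet> e) =
        v (\<lambda>z. \<phi> (fst z) \<bullet> fst e + (\<Sum>b\<in>onb. (b \<bullet> snd e) * snd z (coord_vec A U \<phi> (fst z) b)))"
    proof (rule C.tv_cong[OF v C.mopen_chart[OF CU(1)] CU(2) C.smooth_at_coord[OF CU]])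
      fix z assume "z \<in> CS U"
      then obtain q \<eta> where z: "z = (q, \<eta>)" "q \<in> U" "\<eta> \<in> cotangent_space A q" by auto
      define y where "y = snd (cotangent_chart A U \<phi> z)"
      have "y \<bullet> snd e = (\<Sum>b\<in>onb. (y \<bullet> b) *\<^sub>R b) \<bullet> snd e" by (simp add: onb_expand)
      also have "\<dots> = (\<Sum>b\<in>onb. (b \<bullet> snd e) * (y \<bullet> b))" by (simp add: inner_sum_left mult.commute)
      finally show "cotangent_chart A U \<phi> z \<bullet> e =
          \<phi> (fst z) \<bullet> fst e + (\<Sum>b\<in>onb. (b \<bullet> snd e) * snd z (coord_vec A U \<phi> (fst z) b))"
        using z cotangent_chart_inner[OF U(1) z(2,3)] by (simp add: inner_prod_def y_def)
    qed
    also have "\<dots> = v (\<lambda>z. \<phi> (fst z) \<bullet> fst e) + (\<Sum>b\<in>onb. v (\<lambda>z. (b \<bullet> snd e) * snd z (coord_vec A U \<phi> (fst z) b)))"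
      unfolding C.tv_add[OF v s1 s2]
      by (subst C.tv_sum[OF v x]) (auto intro: C.smooth_at_cmult smooth_fibre_coord[OF U \<xi>])
    finally show ?thesis
      by (simp add: C.tv_cmult[OF v smooth_fibre_coord[OF U \<xi>]])
  qed
  from this[OF w] this[OF w'] show ?thesis
    by (intro C.tangent_eq_coord[OF CU w w']) (simp add: base[OF A.smooth_at_coord[OF U]] fibre)
qed

text \<open>In a bundle chart the curve \<xi> + t \<eta> is an affine line in the fibre direction.
  Hence \<open>deriv\<close> in \<open>vertical_lift\<close> is a genuine derivative, and the
  vertical lift is a coordinate vector.\<close>

lemma vertical_lift_coord:
  assumes U: "(U, \<phi>) \<in> A" "p \<in> U" and \<xi>: "\<xi> \<in> cotangent_space A p" and \<eta>: "\<eta> \<in> cotangent_space A p"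
    and f: "smooth_at CB (p, \<xi>) f"
  shows "((\<lambda>t. f (p, \<xi> + fscale t \<eta>)) has_field_derivative
      coord_vec CB (CS U) (cotangent_chart A U \<phi>) (p, \<xi>) (0, snd (cotangent_chart A U \<phi> (p, \<eta>))) f) (at 0)"
proof -
  let ?\<chi> = "cotangent_chart A U \<phi>"
  have CU: "(CS U, ?\<chi>) \<in> CB" "(p, \<xi>) \<in> CS U"
    using U \<xi> cotangent_bundle_chart by auto
  have D: "((f \<circ> inv_into (CS U) ?\<chi>) has_derivative (\<lambda>b. coord_vec CB (CS U) ?\<chi> (p, \<xi>) b f)) (at (?\<chi> (p, \<xi>)))"
    by (rule C.coord_vec_has_derivative[OF CU f])
  define y where "y = (0::'e, snd (?\<chi> (p, \<eta>)))"
  have \<chi>: "?\<chi> (p, \<xi> + fscale t \<eta>) = ?\<chi> (p, \<xi>) + t *\<^sub>R y" for t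
  proof (rule prod_eqI)
    show "fst (?\<chi> (p, \<xi> + fscale t \<eta>)) = fst (?\<chi> (p, \<xi>) + t *\<^sub>R y)"
      by (simp add: cotangent_chart_def y_def)
    show "snd (?\<chi> (p, \<xi> + fscale t \<eta>)) = snd (?\<chi> (p, \<xi>) + t *\<^sub>R y)"
      by (rule onb_eqI)
         (simp add: cotangent_chart_inner(2)[OF U] \<xi> \<eta> A.cotangent_add A.cotangent_scale inner_add_left y_def, simp add: fscale_def)
  qed
  have "((\<lambda>t. ?\<chi> (p, \<xi>) + t *\<^sub>R y) has_derivative (\<lambda>t. t *\<^sub>R y)) (at 0)"
    by (rule derivative_eq_intros refl | simp)+
  from has_derivative_compose[OF this, of "f \<circ> inv_into (CS U) ?\<chi>"] D
  have "((\<lambda>t. (f \<circ> inv_into (CS U) ?\<chi>) (?\<chi> (p, \<xi>) + t *\<^sub>R y)) has_derivative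
      (\<lambda>t. coord_vec CB (CS U) ?\<chi> (p, \<xi>) (t *\<^sub>R y) f)) (at 0)" by simp
  moreover have "inv_into (CS U) ?\<chi> (?\<chi> (p, \<xi> + fscale t \<eta>)) = (p, \<xi> + fscale t \<eta>)" for t
    by (rule C.inv_chart[OF CU(1)]) (use U \<xi> \<eta> A.cotangent_add A.cotangent_scale in auto)
  then have "(f \<circ> inv_into (CS U) ?\<chi>) (?\<chi> (p, \<xi>) + t *\<^sub>R y) = f (p, \<xi> + fscale t \<eta>)" for t
    unfolding \<chi>[symmetric] by simp
  moreover have "coord_vec CB (CS U) ?\<chi> (p, \<xi>) (t *\<^sub>R y) f = coord_vec CB (CS U) ?\<chi> (p, \<xi>) y f * t" for t y
    using linear_scale[OF has_derivative_linear[OF D], of t y] by simp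
  ultimately show ?thesis
    unfolding has_field_derivative_def y_def[symmetric] by simp
qed

lemma vertical_lift_tangent:
  assumes p: "p \<in> points A" and \<xi>: "\<xi> \<in> cotangent_space A p" and \<eta>: "\<eta> \<in> cotangent_space A p"
  shows "vertical_lift A (p, \<xi>) \<eta> \<in> tangent_space CB (p, \<xi>)"
proof -
  obtain U \<phi> where U: "(U, \<phi>) \<in> A" "p \<in> U" using A.points_chart[OF p(1)] by blast
  have CU: "(CS U, cotangent_chart A U \<phi>) \<in> CB" "(p, \<xi>) \<in> CS U"
    using U \<xi> cotangent_bundle_chart by auto
  have "vertical_lift A (p, \<xi>) \<eta> = coord_vec CB (CS U) (cotangent_chart A U \<phi>) (p, \<xi>) (0, snd (cotangent_chart A U \<phi> (p, \<eta>)))"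
  proof
    fix f
    show "vertical_lift A (p, \<xi>) \<eta> f = coord_vec CB (CS U) (cotangent_chart A U \<phi>) (p, \<xi>) (0, snd (cotangent_chart A U \<phi> (p, \<eta>))) f"
      using DERIV_imp_deriv[OF vertical_lift_coord[OF U \<xi> \<eta>, of f]]
      by (cases "smooth_at CB (p, \<xi>) f") (simp_all add: vertical_lift_def coord_vec_def)
  qed
  then show ?thesis using C.coord_vec_tangent[OF CU] by simp
qed

lemma vertical_lift_base:
  "smooth_at CB (p, \<xi>) (\<lambda>z. f (fst z)) \<Longrightarrow> vertical_lift A (p, \<xi>) \<eta> (\<lambda>z. f (fst z)) = 0"
  by (simp add: vertical_lift_def)

lemma vertical_lift_momentum:
  "smooth_at CB (p, \<xi>) (\<lambda>z. snd z (Y (fst z))) \<Longrightarrow> vertical_lift A (p, \<xi>) \<eta> (\<lambda>z. snd z (Y (fst z))) = \<eta> (Y p)"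
proof -
  have "((\<lambda>t. \<xi> (Y p) + t * \<eta> (Y p)) has_field_derivative \<eta> (Y p)) (at 0)"
    by (rule derivative_eq_intros refl | simp)+
  then show "smooth_at CB (p, \<xi>) (\<lambda>z. snd z (Y (fst z))) \<Longrightarrow> vertical_lift A (p, \<xi>) \<eta> (\<lambda>z. snd z (Y (fst z))) = \<eta> (Y p)"
    by (simp add: vertical_lift_def fscale_def DERIV_imp_deriv)
qed

end

section \<open>Integrability in a frame\<close>

subsection \<open>Tensoriality of the Nijenhuis expression\<close>

text \<open>Serves three modules of sections: vector fields on the base manifold, vector fields on
  its cotangent bundle, and sections of the generalized tangent bundle.\<close>

locale section_space = vector_space sc for sc :: "real \<Rightarrow> 'v::ab_group_add \<Rightarrow> 'v" +
  fixes M :: "'a set" and Sec :: "('a \<Rightarrow> 'v) set" and Fn :: "('a \<Rightarrow> real) set"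
  assumes Sec_add: "s \<in> Sec \<Longrightarrow> t \<in> Sec \<Longrightarrow> (\<lambda>q. s q + t q) \<in> Sec"
    and Sec_sc: "f \<in> Fn \<Longrightarrow> s \<in> Sec \<Longrightarrow> (\<lambda>q. sc (f q) (s q)) \<in> Sec"
    and Sec_zero: "(\<lambda>_. 0) \<in> Sec"
    and Fn_const: "(\<lambda>_. c) \<in> Fn"
    and Fn_indicator: "(\<lambda>q. if q \<in> M then 0 else 1) \<in> Fn"
begin

text \<open>Values outside \<open>M\<close> are irrelevant: a section vanishing on \<open>M\<close> is unchanged by
  multiplication with the indicator function of the complement of \<open>M\<close>.\<close>

lemma tensor_eq_zero:
  fixes T :: "('a \<Rightarrow> 'v) \<Rightarrow> 'w::ab_group_add"
  assumes add: "\<And>s t. s \<in> Sec \<Longrightarrow> t \<in> Sec \<Longrightarrow> T (\<lambda>q. s q + t q) = T s + T t"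
    and scale: "\<And>f s. f \<in> Fn \<Longrightarrow> s \<in> Sec \<Longrightarrow> T s = 0 \<or> f p = 0 \<Longrightarrow> T (\<lambda>q. sc (f q) (s q)) = 0"
    and p: "p \<in> M" and K: "finite K" and c: "\<And>k. k \<in> K \<Longrightarrow> c k \<in> Fn"
    and S: "\<And>k. k \<in> K \<Longrightarrow> S k \<in> Sec" "\<And>k. k \<in> K \<Longrightarrow> T (S k) = 0"
    and s: "s \<in> Sec" "\<And>q. q \<in> M \<Longrightarrow> s q = (\<Sum>k\<in>K. sc (c k q) (S k q))"
  shows "T s = 0"
proof -
  have T0: "T (\<lambda>_. 0) = 0" using add[OF Sec_zero Sec_zero] by simp
  have R: "(\<lambda>q. \<Sum>k\<in>L. sc (c k q) (S k q)) \<in> Sec \<and> T (\<lambda>q. \<Sum>k\<in>L. sc (c k q) (S k q)) = 0"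
    if "finite L" "L \<subseteq> K" for L
    using that
  proof (induction L rule: finite_induct)
    case empty
    then show ?case by (simp add: T0 Sec_zero)
  next
    case (insert k L)
    then have k: "(\<lambda>q. sc (c k q) (S k q)) \<in> Sec" "T (\<lambda>q. sc (c k q) (S k q)) = 0"
      using Sec_sc scale c S by auto
    show ?case using insert k add[OF k(1), of "\<lambda>q. \<Sum>k\<in>L. sc (c k q) (S k q)"]
      by (simp add: Sec_add)
  qed
  define R where "R q = (\<Sum>k\<in>K. sc (c k q) (S k q))" for q
  have R: "R \<in> Sec" "T R = 0" using R[OF K subset_refl] by (simp_all add: R_def[abs_def])
  define Z where "Z q = s q + sc (- 1) (R q)" for q
  have Z: "Z \<in> Sec" unfolding Z_def[abs_def] by (rule Sec_add[OF s(1) Sec_sc[OF Fn_const R(1)]])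
  have Z0: "Z q = 0" if "q \<in> M" for q using s(2)[OF that] by (simp add: Z_def R_def)
  then have "Z = (\<lambda>q. sc (if q \<in> M then 0 else 1) (Z q))" by auto
  \<comment> \<open>Here the coefficient vanishes at p, whereas for the terms of R the frame member
    is annihilated by T; the disjunction in \<open>scale\<close> covers both uses.\<close>
  moreover have "T (\<lambda>q. sc (if q \<in> M then 0 else 1) (Z q)) = 0"
    using scale[OF Fn_indicator Z] p by simp
  ultimately have "T Z = 0" by simp
  moreover have "s = (\<lambda>q. R q + Z q)" by (auto simp: Z_def)
  ultimately show ?thesis using add[OF R(1) Z] R(2) by simp
qed

end

text \<open>The term with \<open>ip\<close> and \<open>dd\<close> is the failure of the Courant bracket to satisfy the Leibniz rule;
  it drops out of the Nijenhuis expression because \<open>J\<close> is skew-symmetric.\<close>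

locale acs_bracket = section_space sc M Sec Fn
  for sc :: "real \<Rightarrow> 'v::ab_group_add \<Rightarrow> 'v" and M :: "'a set" and Sec and Fn +
  fixes V :: "'a \<Rightarrow> 'v set" and br :: "('a \<Rightarrow> 'v) \<Rightarrow> ('a \<Rightarrow> 'v) \<Rightarrow> 'a \<Rightarrow> 'v"
    and an :: "'v \<Rightarrow> ('a \<Rightarrow> real) \<Rightarrow> real" and ip :: "'v \<Rightarrow> 'v \<Rightarrow> real"
    and dd :: "('a \<Rightarrow> real) \<Rightarrow> 'a \<Rightarrow> 'v" and J :: "'a \<Rightarrow> 'v \<Rightarrow> 'v"
  assumes V_add: "p \<in> M \<Longrightarrow> u \<in> V p \<Longrightarrow> v \<in> V p \<Longrightarrow> u + v \<in> V p"
    and V_sc: "p \<in> M \<Longrightarrow> u \<in> V p \<Longrightarrow> sc c u \<in> V p"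
    and V_dd: "p \<in> M \<Longrightarrow> f \<in> Fn \<Longrightarrow> dd f p \<in> V p"
    and V_Sec: "p \<in> M \<Longrightarrow> s \<in> Sec \<Longrightarrow> s p \<in> V p"
    and V_br: "p \<in> M \<Longrightarrow> s \<in> Sec \<Longrightarrow> t \<in> Sec \<Longrightarrow> br s t p \<in> V p"
    and J_add: "p \<in> M \<Longrightarrow> u \<in> V p \<Longrightarrow> v \<in> V p \<Longrightarrow> J p (u + v) = J p u + J p v"
    and J_sc: "p \<in> M \<Longrightarrow> u \<in> V p \<Longrightarrow> J p (sc c u) = sc c (J p u)"
    and J_J: "p \<in> M \<Longrightarrow> u \<in> V p \<Longrightarrow> J p (J p u) = - u"
    and Sec_J: "s \<in> Sec \<Longrightarrow> (\<lambda>q. J q (s q)) \<in> Sec"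
    and ip_J: "p \<in> M \<Longrightarrow> u \<in> V p \<Longrightarrow> v \<in> V p \<Longrightarrow> ip (J p u) v = - ip u (J p v)"
    and ip_minus: "p \<in> M \<Longrightarrow> u \<in> V p \<Longrightarrow> v \<in> V p \<Longrightarrow> ip u (- v) = - ip u v"
    and br_cong: "p \<in> M \<Longrightarrow> s \<in> Sec \<Longrightarrow> t \<in> Sec \<Longrightarrow> t' \<in> Sec \<Longrightarrow> (\<And>q. q \<in> M \<Longrightarrow> t q = t' q) \<Longrightarrow> br s t p = br s t' p"
    and br_add: "p \<in> M \<Longrightarrow> s \<in> Sec \<Longrightarrow> t \<in> Sec \<Longrightarrow> t' \<in> Sec \<Longrightarrow> br s (\<lambda>q. t q + t' q) p = br s t p + br s t' p"
    and br_sc: "p \<in> M \<Longrightarrow> s \<in> Sec \<Longrightarrow> t \<in> Sec \<Longrightarrow> f \<in> Fn \<Longrightarrow>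
      br s (\<lambda>q. sc (f q) (t q)) p = sc (f p) (br s t p) + sc (an (s p) f) (t p) - sc (ip (s p) (t p)) (dd f p)"
    and br_anti: "p \<in> M \<Longrightarrow> s \<in> Sec \<Longrightarrow> t \<in> Sec \<Longrightarrow> br t s p = - br s t p"
begin

definition nij :: "('a \<Rightarrow> 'v) \<Rightarrow> ('a \<Rightarrow> 'v) \<Rightarrow> 'a \<Rightarrow> 'v" where
  "nij s t p = br (\<lambda>q. J q (s q)) (\<lambda>q. J q (t q)) p - J p (br (\<lambda>q. J q (s q)) t p)
    - J p (br s (\<lambda>q. J q (t q)) p) - br s t p"

lemma J_uminus: "p \<in> M \<Longrightarrow> u \<in> V p \<Longrightarrow> J p (- u) = - J p u"
  using J_sc[of p u "-1"] by simp

lemma V_uminus: "p \<in> M \<Longrightarrow> u \<in> V p \<Longrightarrow> - u \<in> V p"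
  using V_sc[of p u "-1"] by simp

lemma J_diff: "p \<in> M \<Longrightarrow> u \<in> V p \<Longrightarrow> v \<in> V p \<Longrightarrow> J p (u - v) = J p u - J p v"
  using J_add[of p u "- v"] J_uminus[of p v] V_uminus[of p v] by simp

lemma nij_anti: "p \<in> M \<Longrightarrow> s \<in> Sec \<Longrightarrow> t \<in> Sec \<Longrightarrow> nij t s p = - nij s t p"
  unfolding nij_def
  by (simp add: br_anti[of p s t] br_anti[of p s "\<lambda>q. J q (t q)"] br_anti[of p "\<lambda>q. J q (s q)" t]
      br_anti[of p "\<lambda>q. J q (s q)" "\<lambda>q. J q (t q)"] Sec_J J_uminus V_br)

lemma nij_add:
  assumes p: "p \<in> M" and s: "s \<in> Sec" and t: "t \<in> Sec" "t' \<in> Sec"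
  shows "nij s (\<lambda>q. t q + t' q) p = nij s t p + nij s t' p"
proof -
  have c: "br r (\<lambda>q. J q (t q + t' q)) p = br r (\<lambda>q. J q (t q)) p + br r (\<lambda>q. J q (t' q)) p" if r: "r \<in> Sec" for r
    using br_cong[OF p r Sec_J[OF Sec_add[OF t]] Sec_add[OF Sec_J[OF t(1)] Sec_J[OF t(2)]]]
    by (simp add: J_add V_Sec t br_add[OF p r Sec_J[OF t(1)] Sec_J[OF t(2)]])
  show ?thesis
    unfolding nij_def
    by (simp add: c s Sec_J br_add p t J_add V_br)
qed

text \<open>Of the eight extra terms, those with \<open>an\<close> cancel because J J = - 1. Those
  with \<open>dd\<close> cancel because skewness gives ip (J s) (J t) = ip s t and ip (J s) t = - ip
  s (J t).\<close>

lemma nij_sc: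
  assumes p: "p \<in> M" and s: "s \<in> Sec" and t: "t \<in> Sec" and f: "f \<in> Fn"
  shows "nij s (\<lambda>q. sc (f q) (t q)) p = sc (f p) (nij s t p)"
proof -
  have c: "br r (\<lambda>q. J q (sc (f q) (t q))) p =
      sc (f p) (br r (\<lambda>q. J q (t q)) p) + sc (an (r p) f) (J p (t p)) - sc (ip (r p) (J p (t p))) (dd f p)"
    if r: "r \<in> Sec" for r
    using br_cong[OF p r Sec_J[OF Sec_sc[OF f t]] Sec_sc[OF f Sec_J[OF t]]]
    by (simp add: J_sc V_Sec t br_sc[OF p r Sec_J[OF t] f])
  have v: "s p \<in> V p" "t p \<in> V p" "J p (s p) \<in> V p" "J p (t p) \<in> V p" "dd f p \<in> V p"
    using V_Sec[OF p] s t Sec_J V_dd[OF p f] by blast+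
  have i: "ip (J p (s p)) (t p) = - ip (s p) (J p (t p))" "ip (J p (s p)) (J p (t p)) = ip (s p) (t p)"
    using ip_J[OF p v(1,2)] ip_J[OF p v(1,4)] ip_minus[OF p v(1,2)] J_J[OF p v(2)] by simp_all
  have J3: "J p (a + b - c) = J p a + J p b - J p c" "J p (a + b + c) = J p a + J p b + J p c"
    if "a \<in> V p" "b \<in> V p" "c \<in> V p" for a b c
    using that by (simp_all add: J_diff[OF p] V_add[OF p] J_add[OF p])
  have "nij s (\<lambda>q. sc (f q) (t q)) p =
     sc (f p) (br (\<lambda>q. J q (s q)) (\<lambda>q. J q (t q)) p) - sc (f p) (J p (br (\<lambda>q. J q (s q)) t p))
    - sc (f p) (J p (br s (\<lambda>q. J q (t q)) p)) - sc (f p) (br s t p)"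
    unfolding nij_def c[OF s] c[OF Sec_J[OF s]] br_sc[OF p s t f] br_sc[OF p Sec_J[OF s] t f] i
    using s t v by (simp add: J3 V_sc p V_br Sec_J J_sc J_J)
  then show ?thesis by (simp add: nij_def scale_right_diff_distrib)
qed

text \<open>By tensoriality the expression vanishes as soon as it does on the frame. There it is
  again a frame section, with an index that does not depend on the point, so injectivity of S at the
  single point p0 turns its vanishing into an algebraic identity.\<close>

lemma nij_frame:
  fixes S :: "'f::findim_inner \<Rightarrow> 'a \<Rightarrow> 'v"
  assumes S: "\<And>u. S u \<in> Sec" and S_diff: "\<And>u v p. p \<in> M \<Longrightarrow> S (u - v) p = S u p - S v p"
    and S_inj: "\<And>u p. p \<in> M \<Longrightarrow> S u p = 0 \<Longrightarrow> u = 0" and ne: "p0 \<in> M"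
    and br_S: "\<And>u v p. p \<in> M \<Longrightarrow> br (S u) (S v) p = S (bk u v) p"
    and J_S: "\<And>u p. p \<in> M \<Longrightarrow> J p (S u p) = S (j u) p"
    and frame: "\<And>s. s \<in> Sec \<Longrightarrow> \<exists>c. (\<forall>b\<in>onb. c b \<in> Fn) \<and> (\<forall>q\<in>M. s q = (\<Sum>b\<in>onb. sc (c b q) (S b q)))"
  shows "(\<forall>s\<in>Sec. \<forall>t\<in>Sec. \<forall>p\<in>M. nij s t p = 0) \<longleftrightarrow>
    (\<forall>u v. bk (j u) (j v) - j (bk (j u) v) - j (bk u (j v)) - bk u v = 0)"
proof -
  \<comment> \<open>\<open>br_cong\<close> replaces the second argument only; antisymmetry moves the
    first argument there and back.\<close>
  have br1: "br (\<lambda>q. J q (S u q)) (S v) p = S (bk (j u) v) p" if p: "p \<in> M" for u v p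
  proof -
    have "br (\<lambda>q. J q (S u q)) (S v) p = - br (S v) (\<lambda>q. J q (S u q)) p"
      by (rule br_anti[OF p S Sec_J[OF S]])
    also have "br (S v) (\<lambda>q. J q (S u q)) p = br (S v) (S (j u)) p"
      by (rule br_cong[OF p S Sec_J[OF S] S]) (simp add: J_S)
    also have "- br (S v) (S (j u)) p = br (S (j u)) (S v) p"
      by (rule br_anti[OF p S S, symmetric])
    finally show ?thesis by (simp add: br_S p)
  qed
  have br2: "br r (\<lambda>q. J q (S v q)) p = br r (S (j v)) p" if p: "p \<in> M" "r \<in> Sec" for r v p
    by (rule br_cong[OF p Sec_J[OF S] S]) (simp add: J_S)
  have N: "nij (S u) (S v) p = S (bk (j u) (j v) - j (bk (j u) v) - j (bk u (j v)) - bk u v) p" if p: "p \<in> M" for u v p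
    unfolding nij_def br2[OF p Sec_J[OF S]] br2[OF p S] br1[OF p] br_S[OF p] J_S[OF p] S_diff[OF p] ..
  have "nij s t p = 0" if z: "\<And>u v. nij (S u) (S v) p = 0" and st: "s \<in> Sec" "t \<in> Sec" "p \<in> M" for s t p
  proof -
    have 1: "nij r t p = 0" if t: "t \<in> Sec" and r: "r \<in> Sec" "\<And>v. nij r (S v) p = 0" for r t
    proof -
      obtain c where c: "\<And>b. b \<in> onb \<Longrightarrow> c b \<in> Fn" "\<And>q. q \<in> M \<Longrightarrow> t q = (\<Sum>b\<in>onb. sc (c b q) (S b q))"
        using frame[OF t] by blast
      show ?thesis
        by (rule tensor_eq_zero[where T = "\<lambda>t. nij r t p" and S = S and c = c and K = onb, OF _ _ st(3) finite_onb c(1) S r(2) t c(2)])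
           (auto simp: nij_add[OF st(3) r(1)] nij_sc[OF st(3) r(1)])
    qed
    have "nij (S v) s p = 0" for v
      by (rule 1[OF st(1) S z])
    then have "nij s (S v) p = 0" for v
      by (simp add: nij_anti[OF st(3) S st(1), of v])
    then show ?thesis by (rule 1[OF st(2,1)])
  qed
  moreover have "S 0 p = 0" if "p \<in> M" for p using S_diff[OF that, of 0 0] by simp
  ultimately show ?thesis using N S S_inj[OF ne] ne by metis
qed

end

subsection \<open>Manifolds with a frame of constant structure\<close>

text \<open>A global frame and its dual coframe, indexed linearly by the model space, with
  \<open>br\<close> playing the role of the structure constants. A point must exist so that
  identities between frame members descend to the model space.\<close>

locale frame_mfd = cotangent_mfd A for A :: "('a, 'e::findim_inner) atlas" +
  fixes E :: "'e \<Rightarrow> 'a \<Rightarrow> 'a tvec" and \<theta> :: "'e \<Rightarrow> 'a \<Rightarrow> 'a cvec" and br :: "'e \<Rightarrow> 'e \<Rightarrow> 'e"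
  assumes E_vf: "vector_field A (points A) (E a)"
    and \<theta>_of: "one_form A (points A) (\<theta> w)"
    and E_onb: "p \<in> points A \<Longrightarrow> E a p = (\<Sum>b\<in>onb. fscale (a \<bullet> b) (E b p))"
    and \<theta>_onb: "p \<in> points A \<Longrightarrow> \<theta> w p = (\<Sum>b\<in>onb. fscale (w \<bullet> b) (\<theta> b p))"
    and \<theta>_E: "p \<in> points A \<Longrightarrow> \<theta> w p (E a p) = w \<bullet> a"
    and E_expand: "p \<in> points A \<Longrightarrow> v \<in> tangent_space A p \<Longrightarrow> v = (\<Sum>b\<in>onb. fscale (\<theta> b p v) (E b p))"
    and bracket_E: "p \<in> points A \<Longrightarrow> lie_bracket A (E a) (E b) p = E (br a b) p"
    and points_nonempty: "points A \<noteq> {}"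
begin

lemma E_tangent: "p \<in> points A \<Longrightarrow> E a p \<in> tangent_space A p"
  by (rule A.vf_tangent[OF E_vf])

lemma \<theta>_cotangent: "p \<in> points A \<Longrightarrow> \<theta> w p \<in> cotangent_space A p"
  by (rule A.of_cotangent[OF \<theta>_of])

lemma E_smooth: "smooth_at A p f \<Longrightarrow> smooth_at A p (\<lambda>q. E a q f)"
  by (rule A.vf_smooth[OF E_vf A.smooth_at_points])

lemma E_inj: "p \<in> points A \<Longrightarrow> E a p = E b p \<Longrightarrow> a = b"
  by (rule onb_eqI) (metis \<theta>_E inner_commute)

lemma E_add: "p \<in> points A \<Longrightarrow> E (a + b) p = E a p + E b p"
  by (simp add: E_onb[of p "a + b"] E_onb[of p a] E_onb[of p b] fun_eq_iff sum_fun_apply fscale_def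
      inner_add_left distrib_right sum.distrib)

lemma E_scale: "p \<in> points A \<Longrightarrow> E (c *\<^sub>R a) p = fscale c (E a p)"
  by (simp add: E_onb[of p "c *\<^sub>R a"] E_onb[of p a] fun_eq_iff sum_fun_apply fscale_def
      sum_distrib_left mult.assoc)

lemma E_diff: "p \<in> points A \<Longrightarrow> E (a - b) p = E a p - E b p"
  using E_add[of p "a - b" b] by simp

lemma \<theta>_add: "p \<in> points A \<Longrightarrow> \<theta> (a + b) p = \<theta> a p + \<theta> b p"
  by (simp add: \<theta>_onb[of p "a + b"] \<theta>_onb[of p a] \<theta>_onb[of p b] fun_eq_iff sum_fun_apply fscale_def
      inner_add_left distrib_right sum.distrib)

lemma \<theta>_diff: "p \<in> points A \<Longrightarrow> \<theta> (a - b) p = \<theta> a p - \<theta> b p"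
  using \<theta>_add[of p "a - b" b] by simp

lemma E_coeff: "p \<in> points A \<Longrightarrow> v \<in> tangent_space A p \<Longrightarrow> v = E (\<Sum>b\<in>onb. \<theta> b p v *\<^sub>R b) p"
  by (subst E_onb) (auto simp: inner_sum_onb E_expand[symmetric] cong: sum.cong)

lemma cotangent_eq_E:
  assumes p: "p \<in> points A" and "\<eta> \<in> cotangent_space A p" "\<xi> \<in> cotangent_space A p" "\<And>a. \<eta> (E a p) = \<xi> (E a p)"
  shows "\<eta> = \<xi>"
proof (rule A.cotangent_eqI[OF assms(2,3)])
  fix v assume v: "v \<in> tangent_space A p"
  define a where "a = (\<Sum>b\<in>onb. \<theta> b p v *\<^sub>R b)"
  have "v = E a p" unfolding a_def by (rule E_coeff[OF p v])
  then show "\<eta> v = \<xi> v" using assms(4) by simp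
qed

lemma ct_E_onb:
  assumes p: "p \<in> points A" and \<eta>: "\<eta> \<in> cotangent_space A p"
  shows "\<eta> (E a p) = (\<Sum>b\<in>onb. (a \<bullet> b) * \<eta> (E b p))"
  by (subst E_onb[OF p], subst A.ct_sum[OF \<eta>]) (auto simp: A.ct_scale[OF \<eta>] A.tangent_scale E_tangent[OF p])

lemma \<theta>_coeff:
  assumes p: "p \<in> points A" and \<eta>: "\<eta> \<in> cotangent_space A p"
  shows "\<eta> = \<theta> (\<Sum>b\<in>onb. \<eta> (E b p) *\<^sub>R b) p"
  by (rule cotangent_eq_E[OF p \<eta> \<theta>_cotangent[OF p]])
     (subst ct_E_onb[OF p \<eta>], simp add: \<theta>_E[OF p] inner_sum_left inner_sum_right inner_commute mult.commute)

lemma E_br: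
  assumes "smooth_at A p f"
  shows "E (br a b) p f = E a p (\<lambda>q. E b q f) - E b p (\<lambda>q. E a q f)"
  using assms A.smooth_at_points[OF assms] by (simp add: bracket_E[symmetric] lie_bracket_def)

lemma ex_point: "\<exists>p. p \<in> points A"
  using points_nonempty by blast

text \<open>As for the other laws of \<open>br\<close> below, the law holds for commutators of
  derivations at some point and is pulled back to the model space by \<open>E_inj\<close>.\<close>

lemma br_add_right: "br a (b + c) = br a b + br a c"
proof -
  obtain p where p: "p \<in> points A" using ex_point ..
  have "E (br a (b + c)) p = E (br a b + br a c) p"
  proof (rule A.tangent_eqI[OF E_tangent[OF p] E_tangent[OF p]])
    fix f assume f: "smooth_at A p f"
    have "E a p (\<lambda>q. E (b + c) q f) = E a p (\<lambda>q. E b q f + E c q f)"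
      by (rule A.tv_cong[OF E_tangent[OF p] A.mopen_points p E_smooth[OF f]]) (simp add: E_add)
    then show "E (br a (b + c)) p f = E (br a b + br a c) p f"
      by (simp add: E_br f E_add[OF p] A.tv_add[OF E_tangent[OF p]] E_smooth)
  qed
  then show ?thesis by (rule E_inj[OF p])
qed

lemma br_scale_right: "br a (k *\<^sub>R b) = k *\<^sub>R br a b"
proof -
  obtain p where p: "p \<in> points A" using ex_point ..
  have "E (br a (k *\<^sub>R b)) p = E (k *\<^sub>R br a b) p"
  proof (rule A.tangent_eqI[OF E_tangent[OF p] E_tangent[OF p]])
    fix f assume f: "smooth_at A p f"
    have "E a p (\<lambda>q. E (k *\<^sub>R b) q f) = E a p (\<lambda>q. k * E b q f)"
      by (rule A.tv_cong[OF E_tangent[OF p] A.mopen_points p E_smooth[OF f]]) (simp add: E_scale fscale_def)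
    then show "E (br a (k *\<^sub>R b)) p f = E (k *\<^sub>R br a b) p f"
      by (simp add: E_br f E_scale[OF p] fscale_def A.tv_cmult[OF E_tangent[OF p]] E_smooth right_diff_distrib)
  qed
  then show ?thesis by (rule E_inj[OF p])
qed

lemma br_anti: "br a b = - br b a"
proof -
  obtain p where p: "p \<in> points A" using ex_point ..
  have "E (br a b) p = E (- br b a) p"
  proof (rule A.tangent_eqI[OF E_tangent[OF p] E_tangent[OF p]])
    fix f assume f: "smooth_at A p f"
    show "E (br a b) p f = E (- br b a) p f"
      using E_scale[OF p, of "-1" "br b a"] by (simp add: fscale_def E_br f)
  qed
  then show ?thesis by (rule E_inj[OF p])
qed

lemma br_add_left: "br (a + b) c = br a c + br b c"
  using br_anti[of "a + b" c] br_add_right[of c a b] br_anti[of a c] br_anti[of b c] by simp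

lemma br_scale_left: "br (k *\<^sub>R a) c = k *\<^sub>R br a c"
  using br_anti[of "k *\<^sub>R a" c] br_scale_right[of c k a] br_anti[of a c] by simp

lemma linear_br_left: "linear (\<lambda>a. br a c)"
  by (rule linearI) (auto simp: br_add_left br_scale_left)

text \<open>The Jacobi identity, stated as the fact that br a is a representation on the model
  space. In \<open>bracket_S\<close> it expresses the flatness of the connection.\<close>

lemma br_jacobi: "br a (br b c) - br b (br a c) = br (br a b) c"
proof -
  obtain p where p: "p \<in> points A" using ex_point ..
  have "E (br a (br b c) - br b (br a c)) p = E (br (br a b) c) p"
  proof (rule A.tangent_eqI[OF E_tangent[OF p] E_tangent[OF p]])
    fix f assume f: "smooth_at A p f"
    have e: "E a p (\<lambda>q. E (br b c) q f) = E a p (\<lambda>q. E b q (\<lambda>r. E c r f)) - E a p (\<lambda>q. E c q (\<lambda>r. E b r f))" for a b c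
    proof -
      obtain W where W: "mopen A W" "p \<in> W" "\<And>q. q \<in> W \<Longrightarrow> smooth_at A q f"
        using A.smooth_at_nbhd[OF f] by blast
      have "E a p (\<lambda>q. E (br b c) q f) = E a p (\<lambda>q. E b q (\<lambda>r. E c r f) - E c q (\<lambda>r. E b r f))"
        by (rule A.tv_cong[OF E_tangent[OF p] W(1,2) E_smooth[OF f]]) (simp add: E_br W(3))
      then show ?thesis by (simp add: A.tv_diff[OF E_tangent[OF p]] E_smooth f)
    qed
    show "E (br a (br b c) - br b (br a c)) p f = E (br (br a b) c) p f"
      by (simp add: E_diff[OF p] E_br f E_smooth e)
  qed
  then show ?thesis by (rule E_inj[OF p])
qed

section \<open>Momenta of the frame as global fibre coordinates of the cotangent bundle\<close>

definition mom :: "'e \<Rightarrow> 'a \<times> 'a cvec \<Rightarrow> real" where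
  "mom a = (\<lambda>z. snd z (E a (fst z)))"

lemma points_CB: "x \<in> points CB \<Longrightarrow> fst x \<in> points A \<and> snd x \<in> cotangent_space A (fst x)"
  by (auto simp: points_cotangent_bundle)

lemma mom_smooth: "x \<in> points CB \<Longrightarrow> smooth_at CB x (mom a)"
  using smooth_momentum[OF E_vf, of "fst x" "snd x"] points_CB[of x] by (simp add: mom_def)

lemma base_smooth: "x \<in> points CB \<Longrightarrow> smooth_at A (fst x) f \<Longrightarrow> smooth_at CB x (\<lambda>z. f (fst z))"
  using smooth_proj[of "fst x" "snd x"] by simp

lemma linear_mom: "x \<in> points CB \<Longrightarrow> linear (\<lambda>a. mom a x)"
  using points_CB[of x]
  by (intro linearI) (auto simp: mom_def E_add E_scale A.ct_add A.ct_scale E_tangent)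

lemma fibre_coord_mom:
  assumes U: "(U, \<phi>) \<in> A" and z: "z \<in> CS U"
  shows "snd z (coord_vec A U \<phi> (fst z) b) = (\<Sum>c\<in>onb. \<theta> c (fst z) (coord_vec A U \<phi> (fst z) b) * mom c z)"
proof -
  have p: "fst z \<in> U" "fst z \<in> points A" "snd z \<in> cotangent_space A (fst z)"
    using z A.chart_points[OF U] by auto
  show ?thesis
    by (subst E_expand[OF p(2) A.coord_vec_tangent[OF U p(1)]], subst A.ct_sum[OF p(3)])
       (auto simp: mom_def A.ct_scale[OF p(3)] A.tangent_scale E_tangent[OF p(2)])
qed

lemma smooth_frame_coeff:
  "vector_field A V Y \<Longrightarrow> p \<in> V \<Longrightarrow> smooth_at A p (\<lambda>q. \<theta> w q (Y q))"
  using A.of_smooth[OF \<theta>_of _ _] A.mopen_subset[OF A.vf_mopen] by blast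

lemma tangent_fibre_coord:
  assumes x: "x \<in> points CB" and w: "w \<in> tangent_space CB x" and U: "(U, \<phi>) \<in> A" "fst x \<in> U"
  shows "w (\<lambda>z. snd z (coord_vec A U \<phi> (fst z) b)) =
    (\<Sum>c\<in>onb. \<theta> c (fst x) (coord_vec A U \<phi> (fst x) b) * w (mom c) +
      mom c x * w (\<lambda>z. \<theta> c (fst z) (coord_vec A U \<phi> (fst z) b)))"
proof -
  have CU: "(CS U, cotangent_chart A U \<phi>) \<in> CB" "x \<in> CS U"
    using U cotangent_bundle_chart points_CB[OF x] by (auto simp: mem_Times_iff mem_Sigma_iff) (metis mem_Sigma_iff prod.collapse)
  have s: "smooth_at CB x (\<lambda>z. \<theta> c (fst z) (coord_vec A U \<phi> (fst z) b))" for c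
    by (rule base_smooth[OF x smooth_frame_coeff[OF A.vf_coord[OF U(1)] U(2)]])
  have "w (\<lambda>z. snd z (coord_vec A U \<phi> (fst z) b)) = w (\<lambda>z. \<Sum>c\<in>onb. \<theta> c (fst z) (coord_vec A U \<phi> (fst z) b) * mom c z)"
    using smooth_fibre_coord[OF U, of "snd x"] points_CB[OF x]
    by (intro C.tv_cong[OF w C.mopen_chart[OF CU(1)] CU(2)]) (auto simp: fibre_coord_mom[OF U(1)])
  also have "\<dots> = (\<Sum>c\<in>onb. w (\<lambda>z. \<theta> c (fst z) (coord_vec A U \<phi> (fst z) b) * mom c z))"
    by (intro C.tv_sum[OF w x] C.smooth_at_mult s mom_smooth[OF x])
  also have "\<dots> = (\<Sum>c\<in>onb. \<theta> c (fst x) (coord_vec A U \<phi> (fst x) b) * w (mom c) +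
      mom c x * w (\<lambda>z. \<theta> c (fst z) (coord_vec A U \<phi> (fst z) b)))"
    by (intro sum.cong refl C.tv_mult[OF w s mom_smooth[OF x]])
  finally show ?thesis .
qed

text \<open>The fibre coordinates of any chart are combinations of momenta with coefficients pulled
  back from the base. By the Leibniz rule a tangent vector is therefore known once its action on
  pulled-back functions and on the momenta is known.\<close>

lemma tangent_eq_mom:
  assumes x: "x \<in> points CB" and w: "w \<in> tangent_space CB x" and w': "w' \<in> tangent_space CB x"
    and base: "\<And>f. smooth_at A (fst x) f \<Longrightarrow> w (\<lambda>z. f (fst z)) = w' (\<lambda>z. f (fst z))"
    and fibre: "\<And>c. c \<in> onb \<Longrightarrow> w (mom c) = w' (mom c)"
  shows "w = w'"
proof -
  obtain U \<phi> where U: "(U, \<phi>) \<in> A" "fst x \<in> U" using A.points_chart points_CB[OF x] by blast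
  have "w (\<lambda>z. snd z (coord_vec A U \<phi> (fst z) b)) = w' (\<lambda>z. snd z (coord_vec A U \<phi> (fst z) b))" for b
    unfolding tangent_fibre_coord[OF x w U] tangent_fibre_coord[OF x w' U]
    by (intro sum.cong refl) (simp add: fibre base[OF smooth_frame_coeff[OF A.vf_coord[OF U(1)] U(2)]])
  then show ?thesis
    using tangent_eq_cotangent[OF U, of "snd x" w w'] points_CB[OF x] w w' base by simp
qed

text \<open>The same expression of fibre coordinates by momenta as in \<open>tangent_eq_mom\<close>,
  now used for the smoothness of a field instead of the equality of two vectors.\<close>

lemma vfI_mom:
  assumes W: "mopen CB W" and X: "\<And>x. x \<in> W \<Longrightarrow> X x \<in> tangent_space CB x"
    and base: "\<And>x f. x \<in> W \<Longrightarrow> smooth_at A (fst x) f \<Longrightarrow> smooth_at CB x (\<lambda>y. X y (\<lambda>z. f (fst z)))"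
    and fibre: "\<And>x c. x \<in> W \<Longrightarrow> c \<in> onb \<Longrightarrow> smooth_at CB x (\<lambda>y. X y (mom c))"
  shows "vector_field CB W X"
proof (rule C.vfI_coord[OF W X])
  fix x assume xW: "x \<in> W"
  have x: "x \<in> points CB" by (rule C.mopen_subset[OF W xW])
  obtain U \<phi> where U: "(U, \<phi>) \<in> A" "fst x \<in> U" using A.points_chart points_CB[OF x] by blast
  have CU: "(CS U, cotangent_chart A U \<phi>) \<in> CB" "x \<in> CS U"
    using U cotangent_bundle_chart points_CB[OF x] by auto (metis mem_Sigma_iff prod.collapse)
  have WU: "mopen CB (W \<inter> CS U)" "x \<in> W \<inter> CS U"
    using C.mopen_Int[OF W C.mopen_chart[OF CU(1)]] xW CU by auto
  let ?d = "\<lambda>b q. coord_vec A U \<phi> q b"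
  have fc: "smooth_at CB x (\<lambda>y. X y (\<lambda>z. snd z (?d b (fst z))))" for b
  proof -
    have "smooth_at CB x (\<lambda>y. \<Sum>c\<in>onb. \<theta> c (fst y) (?d b (fst y)) * X y (mom c) + mom c y * X y (\<lambda>z. \<theta> c (fst z) (?d b (fst z))))"
      by (intro C.smooth_at_sum C.smooth_at_add C.smooth_at_mult x fibre xW mom_smooth base_smooth[OF x]
           base smooth_frame_coeff[OF A.vf_coord[OF U(1)] U(2)])
    then show ?thesis
      by (rule C.smooth_at_cong[OF _ WU])
         (use U C.mopen_subset[OF W] in \<open>auto simp: tangent_fibre_coord[OF _ X U(1)]\<close>)
  qed
  have "smooth_at CB x (\<lambda>y. X y (\<lambda>z. cotangent_chart A U \<phi> z \<bullet> e))" for e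
  proof -
    have "smooth_at CB x (\<lambda>y. X y (\<lambda>z. \<phi> (fst z) \<bullet> fst e) + X y (\<lambda>z. snd z (?d (snd e) (fst z))))"
      by (intro C.smooth_at_add fc base xW A.smooth_at_coord[OF U])
    then show ?thesis
    proof (rule C.smooth_at_cong[OF _ WU])
      fix y assume y: "y \<in> W \<inter> CS U"
      then have yC: "y \<in> CS U" and yU: "fst y \<in> U" and y\<xi>: "snd y \<in> cotangent_space A (fst y)"
        and Xy: "X y \<in> tangent_space CB y" and yp: "y \<in> points CB"
        using X C.mopen_subset[OF W] by auto
      have s1: "smooth_at CB y (\<lambda>z. \<phi> (fst z) \<bullet> fst e)"
        by (rule base_smooth[OF yp A.smooth_at_coord[OF U(1) yU]])
      have s2: "smooth_at CB y (\<lambda>z. snd z (?d (snd e) (fst z)))"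
        using smooth_fibre_coord[OF U(1) yU y\<xi>] by simp
      have "X y (\<lambda>z. cotangent_chart A U \<phi> z \<bullet> e) = X y (\<lambda>z. \<phi> (fst z) \<bullet> fst e + snd z (?d (snd e) (fst z)))"
      proof (rule C.tv_cong[OF Xy C.mopen_chart[OF CU(1)] yC C.smooth_at_coord[OF CU(1) yC]])
        fix z assume "z \<in> CS U"
        then show "cotangent_chart A U \<phi> z \<bullet> e = \<phi> (fst z) \<bullet> fst e + snd z (?d (snd e) (fst z))"
          using cotangent_chart_inner[OF U(1), of "fst z" "snd z"] by (auto simp: inner_prod_def)
      qed
      then show "X y (\<lambda>z. \<phi> (fst z) \<bullet> fst e) + X y (\<lambda>z. snd z (?d (snd e) (fst z))) =
          X y (\<lambda>z. cotangent_chart A U \<phi> z \<bullet> e)"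
        by (simp add: C.tv_add[OF Xy s1 s2])
    qed
  qed
  then show "\<exists>U \<phi>. (U, \<phi>) \<in> CB \<and> x \<in> U \<and> (\<forall>b\<in>onb. smooth_at CB x (\<lambda>q. X q (\<lambda>r. \<phi> r \<bullet> b)))"
    using CU by blast
qed

end

section \<open>Modules of sections\<close>

lemma vector_space_fscale: "vector_space fscale"
  by standard (auto simp: fscale_def fun_eq_iff algebra_simps)

lemma vector_space_pscale: "vector_space pscale"
  by standard (auto simp: pscale_def fscale_def fun_eq_iff prod_eq_iff algebra_simps)

context mfd
begin

text \<open>Equal to 0 on the manifold and to 1 off it; supplies \<open>Fn_indicator\<close> for the
  handling of values outside the manifold.\<close>

lemma smooth_indicator: "p \<in> points A \<Longrightarrow> smooth_at A p (\<lambda>q. if q \<in> points A then 0 else 1)"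
  by (rule smooth_at_cong[OF smooth_at_const[of p 0] mopen_points]) auto

lemma section_space_vf:
  "section_space fscale (points A) {X. vector_field A (points A) X} {f. smooth_fun A (points A) f}"
  unfolding section_space_def section_space_axioms_def
  using vf_zero[OF mopen_points]
  by (auto intro: vector_space_fscale vf_add vf_scale smooth_indicator smooth_at_const mopen_points simp: smooth_fun_iff zero_fun_def)

lemma gen_section_iff:
  "gen_section A W s \<longleftrightarrow> vector_field A W (\<lambda>q. fst (s q)) \<and> one_form A W (\<lambda>q. snd (s q))"
  by (simp add: gen_section_def o_def)

lemma gen_sectionD:
  "gen_section A W s \<Longrightarrow> vector_field A W (\<lambda>q. fst (s q))"
  "gen_section A W s \<Longrightarrow> one_form A W (\<lambda>q. snd (s q))"
  by (simp_all add: gen_section_iff)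

lemma gen_section_add: "gen_section A W s \<Longrightarrow> gen_section A W t \<Longrightarrow> gen_section A W (\<lambda>q. s q + t q)"
  by (simp add: gen_section_iff vf_add of_add)

lemma gen_section_scale:
  "gen_section A W s \<Longrightarrow> (\<And>p. p \<in> W \<Longrightarrow> smooth_at A p f) \<Longrightarrow> gen_section A W (\<lambda>q. pscale (f q) (s q))"
  by (simp add: gen_section_iff pscale_def vf_scale of_scale)

lemma gen_section_cong:
  "gen_section A W s \<Longrightarrow> (\<And>q. q \<in> W \<Longrightarrow> s q = t q) \<Longrightarrow> gen_section A W t"
  unfolding gen_section_iff using vf_cong[of W "\<lambda>q. fst (s q)" "\<lambda>q. fst (t q)"]
    of_cong[of W "\<lambda>q. snd (s q)" "\<lambda>q. snd (t q)"] by simp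

lemma gen_section_uminus: "gen_section A W s \<Longrightarrow> gen_section A W (\<lambda>q. - s q)"
  by (simp add: gen_section_iff vf_uminus of_uminus)

lemma gen_section_tangent: "gen_section A W s \<Longrightarrow> p \<in> W \<Longrightarrow> s p \<in> gen_tangent A p"
  using vf_tangent[of W "\<lambda>q. fst (s q)"] of_cotangent[of W "\<lambda>q. snd (s q)"]
  by (simp add: gen_section_iff gen_tangent_def mem_Times_iff)

lemma gen_section_zero: "gen_section A (points A) (\<lambda>_. 0)"
  by (simp add: gen_section_iff vf_zero of_zero mopen_points)

lemma section_space_gen:
  "section_space pscale (points A) {s. gen_section A (points A) s} {f. smooth_fun A (points A) f}"
  unfolding section_space_def section_space_axioms_def
  by (auto intro: vector_space_pscale gen_section_add gen_section_scale gen_section_zero smooth_indicator smooth_at_const mopen_points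
      simp: smooth_fun_iff)

lemma gen_tangent_add: "u \<in> gen_tangent A p \<Longrightarrow> v \<in> gen_tangent A p \<Longrightarrow> u + v \<in> gen_tangent A p"
  by (simp add: gen_tangent_def mem_Times_iff tangent_add cotangent_add)

lemma gen_tangent_scale: "u \<in> gen_tangent A p \<Longrightarrow> pscale c u \<in> gen_tangent A p"
  by (simp add: gen_tangent_def mem_Times_iff tangent_scale cotangent_scale pscale_def)

lemma gen_tangent_diff: "u \<in> gen_tangent A p \<Longrightarrow> v \<in> gen_tangent A p \<Longrightarrow> u - v \<in> gen_tangent A p"
  by (simp add: gen_tangent_def mem_Times_iff tangent_diff cotangent_diff)

end

context frame_mfd
begin

subsection \<open>The Courant bracket in a frame\<close>

lemma courant_fst: "fst (courant_bracket A s t p) = lie_bracket A (\<lambda>q. fst (s q)) (\<lambda>q. fst (t q)) p"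
  by (simp add: courant_bracket_def Let_def o_def)

lemma courant_snd:
  assumes "gen_section A (points A) s" "gen_section A (points A) t" "p \<in> points A"
  shows "snd (courant_bracket A s t p) (E a p) =
    fst (s p) (\<lambda>q. snd (t q) (E a q)) - snd (t p) (lie_bracket A (\<lambda>q. fst (s q)) (E a) p)
    - fst (t p) (\<lambda>q. snd (s q) (E a q)) + snd (s p) (lie_bracket A (\<lambda>q. fst (t q)) (E a) p)
    + 1/2 * E a p (\<lambda>q. snd (s q) (fst (t q)) - snd (t q) (fst (s q)))"
  by (rule A.courant_bracket_apply[OF assms E_vf assms(3)])

lemma courant_tangent:
  "gen_section A (points A) s \<Longrightarrow> gen_section A (points A) t \<Longrightarrow> p \<in> points A \<Longrightarrow> courant_bracket A s t p \<in> gen_tangent A p"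
  by (rule A.gen_section_tangent[OF A.gen_section_courant])

lemma gen_eqI:
  assumes "p \<in> points A" "u \<in> gen_tangent A p" "v \<in> gen_tangent A p" "fst u = fst v" "\<And>a. snd u (E a p) = snd v (E a p)"
  shows "u = v"
  using assms cotangent_eq_E[of p "snd u" "snd v"] by (auto simp: gen_tangent_def prod_eq_iff)

lemma courant_cong:
  assumes s: "gen_section A (points A) s" and t: "gen_section A (points A) t" and t': "gen_section A (points A) t'"
    and p: "p \<in> points A" and eq: "\<And>q. q \<in> points A \<Longrightarrow> t q = t' q"
  shows "courant_bracket A s t p = courant_bracket A s t' p"
proof (rule gen_eqI[OF p courant_tangent[OF s t p] courant_tangent[OF s t' p]])
  note st = A.gen_sectionD[OF s]
    A.gen_sectionD[OF t]
  note P = A.mopen_points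
  show "fst (courant_bracket A s t p) = fst (courant_bracket A s t' p)"
    unfolding courant_fst by (rule A.lie_bracket_cong[OF st(1,3) P p]) (auto simp: eq)
  fix a
  have 1: "lie_bracket A (\<lambda>q. fst (t q)) (E a) p = lie_bracket A (\<lambda>q. fst (t' q)) (E a) p"
    by (rule A.lie_bracket_cong[OF st(3) E_vf P p]) (auto simp: eq)
  have 2: "fst (s p) (\<lambda>q. snd (t q) (E a q)) = fst (s p) (\<lambda>q. snd (t' q) (E a q))"
    by (rule A.tv_cong[OF A.vf_tangent[OF st(1) p] P p A.of_smooth[OF st(4) p E_vf p]]) (simp add: eq)
  have 3: "E a p (\<lambda>q. snd (s q) (fst (t q)) - snd (t q) (fst (s q))) = E a p (\<lambda>q. snd (s q) (fst (t' q)) - snd (t' q) (fst (s q)))"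
    by (rule A.tv_cong[OF E_tangent[OF p] P p A.smooth_at_diff[OF A.of_smooth[OF st(2) p st(3) p] A.of_smooth[OF st(4) p st(1) p]]])
       (simp add: eq)
  show "snd (courant_bracket A s t p) (E a p) = snd (courant_bracket A s t' p) (E a p)"
    unfolding courant_snd[OF s t p] courant_snd[OF s t' p] 1 2 3 eq[OF p] ..
qed

lemma courant_anti:
  assumes s: "gen_section A (points A) s" and t: "gen_section A (points A) t" and p: "p \<in> points A"
  shows "courant_bracket A t s p = - courant_bracket A s t p"
proof (rule gen_eqI[OF p courant_tangent[OF t s p]])
  note st = A.gen_sectionD[OF s]
    A.gen_sectionD[OF t]
  show "- courant_bracket A s t p \<in> gen_tangent A p"
    using A.gen_tangent_scale[OF courant_tangent[OF s t p], of "-1"]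
    by (simp add: pscale_def fscale_def prod_eq_iff uminus_prod_def fun_Compl_def)
  show "fst (courant_bracket A t s p) = fst (- courant_bracket A s t p)"
    unfolding fst_uminus courant_fst by (rule A.lie_bracket_antisym)
  fix a
  have "E a p (\<lambda>q. snd (s q) (fst (t q)) - snd (t q) (fst (s q))) = - E a p (\<lambda>q. snd (t q) (fst (s q)) - snd (s q) (fst (t q)))"
    by (simp add: A.tv_diff[OF E_tangent[OF p]] A.of_smooth[OF st(2) p st(3) p] A.of_smooth[OF st(4) p st(1) p])
  then show "snd (courant_bracket A t s p) (E a p) = snd (- courant_bracket A s t p) (E a p)"
    by (simp add: courant_snd[OF s t p] courant_snd[OF t s p])
qed

lemma courant_add:
  assumes s: "gen_section A (points A) s" and t: "gen_section A (points A) t" and t': "gen_section A (points A) t'"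
    and p: "p \<in> points A"
  shows "courant_bracket A s (\<lambda>q. t q + t' q) p = courant_bracket A s t p + courant_bracket A s t' p"
proof (rule gen_eqI[OF p courant_tangent[OF s A.gen_section_add[OF t t'] p]
      A.gen_tangent_add[OF courant_tangent[OF s t p] courant_tangent[OF s t' p]]])
  note st = A.gen_sectionD[OF s]
    A.gen_sectionD[OF t]
    A.gen_sectionD[OF t']
  note Xp = A.vf_tangent[OF st(1) p] and \<xi>p = A.of_cotangent[OF st(2) p] and Ep = E_tangent[OF p]
  show "fst (courant_bracket A s (\<lambda>q. t q + t' q) p) = fst (courant_bracket A s t p + courant_bracket A s t' p)"
    unfolding courant_fst fst_add by (rule A.lie_bracket_add[OF st(1) p st(3,5)])
  fix a
  have "lie_bracket A (\<lambda>q. fst (t q) + fst (t' q)) (E a) p =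
      lie_bracket A (\<lambda>q. fst (t q)) (E a) p + lie_bracket A (\<lambda>q. fst (t' q)) (E a) p"
    using A.lie_bracket_add[OF E_vf p st(3,5), of a]
    by (simp add: A.lie_bracket_antisym[of _ "E a"])
  then have 1: "snd (s p) (lie_bracket A (\<lambda>q. fst (t q) + fst (t' q)) (E a) p) =
      snd (s p) (lie_bracket A (\<lambda>q. fst (t q)) (E a) p) + snd (s p) (lie_bracket A (\<lambda>q. fst (t' q)) (E a) p)"
    by (simp add: A.ct_add[OF \<xi>p] A.lie_bracket_tangent[OF st(3) p E_vf p] A.lie_bracket_tangent[OF st(5) p E_vf p])
  have 2: "fst (s p) (\<lambda>q. snd (t q) (E a q) + snd (t' q) (E a q)) = fst (s p) (\<lambda>q. snd (t q) (E a q)) + fst (s p) (\<lambda>q. snd (t' q) (E a q))"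
    by (rule A.tv_add[OF Xp A.of_smooth[OF st(4) p E_vf p] A.of_smooth[OF st(6) p E_vf p]])
  have "E a p (\<lambda>q. snd (s q) (fst (t q) + fst (t' q)) - (snd (t q) (fst (s q)) + snd (t' q) (fst (s q)))) =
      E a p (\<lambda>q. (snd (s q) (fst (t q)) - snd (t q) (fst (s q))) + (snd (s q) (fst (t' q)) - snd (t' q) (fst (s q))))"
  proof (rule A.tv_cong[OF Ep A.mopen_points p, symmetric])
    show "smooth_at A p (\<lambda>q. (snd (s q) (fst (t q)) - snd (t q) (fst (s q))) + (snd (s q) (fst (t' q)) - snd (t' q) (fst (s q))))"
      by (intro A.smooth_at_add A.smooth_at_diff A.of_smooth[OF st(2) p st(3) p] A.of_smooth[OF st(4) p st(1) p]
          A.of_smooth[OF st(2) p st(5) p] A.of_smooth[OF st(6) p st(1) p])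
    fix q assume q: "q \<in> points A"
    show "(snd (s q) (fst (t q)) - snd (t q) (fst (s q))) + (snd (s q) (fst (t' q)) - snd (t' q) (fst (s q))) =
        snd (s q) (fst (t q) + fst (t' q)) - (snd (t q) (fst (s q)) + snd (t' q) (fst (s q)))"
      by (simp add: A.ct_add[OF A.of_cotangent[OF st(2) q] A.vf_tangent[OF st(3) q] A.vf_tangent[OF st(5) q]])
  qed
  also have "\<dots> = E a p (\<lambda>q. snd (s q) (fst (t q)) - snd (t q) (fst (s q))) + E a p (\<lambda>q. snd (s q) (fst (t' q)) - snd (t' q) (fst (s q)))"
    by (intro A.tv_add[OF Ep] A.smooth_at_diff A.of_smooth[OF st(2) p st(3) p] A.of_smooth[OF st(4) p st(1) p]
          A.of_smooth[OF st(2) p st(5) p] A.of_smooth[OF st(6) p st(1) p])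
  finally have 3: "E a p (\<lambda>q. snd (s q) (fst (t q) + fst (t' q)) - (snd (t q) (fst (s q)) + snd (t' q) (fst (s q)))) =
    E a p (\<lambda>q. snd (s q) (fst (t q)) - snd (t q) (fst (s q))) + E a p (\<lambda>q. snd (s q) (fst (t' q)) - snd (t' q) (fst (s q)))" .
  have 4: "snd (courant_bracket A s (\<lambda>q. t q + t' q) p) (E a p) =
    fst (s p) (\<lambda>q. snd (t q) (E a q) + snd (t' q) (E a q))
    - (snd (t p) (lie_bracket A (\<lambda>q. fst (s q)) (E a) p) + snd (t' p) (lie_bracket A (\<lambda>q. fst (s q)) (E a) p))
    - (fst (t p) (\<lambda>q. snd (s q) (E a q)) + fst (t' p) (\<lambda>q. snd (s q) (E a q)))
    + snd (s p) (lie_bracket A (\<lambda>q. fst (t q) + fst (t' q)) (E a) p)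
    + 1/2 * E a p (\<lambda>q. snd (s q) (fst (t q) + fst (t' q)) - (snd (t q) (fst (s q)) + snd (t' q) (fst (s q))))"
    by (simp only: courant_snd[OF s A.gen_section_add[OF t t'] p] fst_add snd_add plus_fun_apply)
  have 5: "snd (courant_bracket A s t p + courant_bracket A s t' p) (E a p) =
      snd (courant_bracket A s t p) (E a p) + snd (courant_bracket A s t' p) (E a p)"
    by simp
  show "snd (courant_bracket A s (\<lambda>q. t q + t' q) p) (E a p) = snd (courant_bracket A s t p + courant_bracket A s t' p) (E a p)"
    unfolding 4 5 1 2 3 courant_snd[OF s t p] courant_snd[OF s t' p] by (simp add: algebra_simps)
qed

text \<open>Origin of the last term, for s = X + \<xi> and t = Y + \<eta>: the Lie derivative of
  \<xi> along f Y contributes - \<xi>(Y) df, the exact term of the bracket contributes half of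
  (\<xi>(Y) - \<eta>(X)) df, and the sum is minus half of (\<xi>(Y) + \<eta>(X)) df.\<close>

lemma courant_scale:
  assumes s: "gen_section A (points A) s" and t: "gen_section A (points A) t" and p: "p \<in> points A"
    and f: "\<And>q. q \<in> points A \<Longrightarrow> smooth_at A q f"
  shows "courant_bracket A s (\<lambda>q. pscale (f q) (t q)) p =
    pscale (f p) (courant_bracket A s t p) + pscale (fst (s p) f) (t p) - pscale (g_can (s p) (t p)) (0, fun_differential A f p)"
proof (rule gen_eqI[OF p courant_tangent[OF s A.gen_section_scale[OF t f] p]])
  note st = A.gen_sectionD[OF s]
    A.gen_sectionD[OF t]
  note Xp = A.vf_tangent[OF st(1) p] and \<xi>p = A.of_cotangent[OF st(2) p] and \<eta>p = A.of_cotangent[OF st(4) p]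
    and Yp = A.vf_tangent[OF st(3) p] and Ep = E_tangent[OF p] and fp = f[OF p]
  have "(0, fun_differential A f p) \<in> gen_tangent A p"
    by (simp add: gen_tangent_def A.tangent_zero A.fun_differential_cotangent)
  then show "pscale (f p) (courant_bracket A s t p) + pscale (fst (s p) f) (t p) - pscale (g_can (s p) (t p)) (0, fun_differential A f p)
      \<in> gen_tangent A p"
    by (intro A.gen_tangent_diff A.gen_tangent_add A.gen_tangent_scale courant_tangent[OF s t p] A.gen_section_tangent[OF t p])
  show "fst (courant_bracket A s (\<lambda>q. pscale (f q) (t q)) p) =
     fst (pscale (f p) (courant_bracket A s t p) + pscale (fst (s p) f) (t p) - pscale (g_can (s p) (t p)) (0, fun_differential A f p))"
    using A.lie_bracket_scale[OF st(1) p st(3) fp] by (simp add: courant_fst pscale_def fscale_def fun_eq_iff)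
  fix a
  have sh: "smooth_at A p (\<lambda>q. snd (s q) (fst (t q)) - snd (t q) (fst (s q)))"
    by (intro A.smooth_at_diff A.of_smooth[OF st(2) p st(3) p] A.of_smooth[OF st(4) p st(1) p])
  have "lie_bracket A (\<lambda>q. fscale (f q) (fst (t q))) (E a) p =
      fscale (f p) (lie_bracket A (\<lambda>q. fst (t q)) (E a) p) - fscale (E a p f) (fst (t p))"
    using A.lie_bracket_scale[OF E_vf p st(3) fp, of a]
    by (simp add: A.lie_bracket_antisym[of _ "E a"] fscale_def fun_eq_iff)
  then have 1: "snd (s p) (lie_bracket A (\<lambda>q. fscale (f q) (fst (t q))) (E a) p) =
      f p * snd (s p) (lie_bracket A (\<lambda>q. fst (t q)) (E a) p) - E a p f * snd (s p) (fst (t p))"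
    by (simp add: A.ct_diff[OF \<xi>p] A.ct_scale[OF \<xi>p] A.tangent_scale A.lie_bracket_tangent[OF st(3) p E_vf p] Yp)
  have 2: "fst (s p) (\<lambda>q. fscale (f q) (snd (t q)) (E a q)) =
      f p * fst (s p) (\<lambda>q. snd (t q) (E a q)) + snd (t p) (E a p) * fst (s p) f"
    unfolding fscale_def by (rule A.tv_mult[OF Xp fp A.of_smooth[OF st(4) p E_vf p]])
  have "E a p (\<lambda>q. snd (s q) (fscale (f q) (fst (t q))) - fscale (f q) (snd (t q)) (fst (s q))) =
      E a p (\<lambda>q. f q * (snd (s q) (fst (t q)) - snd (t q) (fst (s q))))"
  proof (rule A.tv_cong[OF Ep A.mopen_points p A.smooth_at_mult[OF fp sh], symmetric])
    fix q assume q: "q \<in> points A"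
    show "f q * (snd (s q) (fst (t q)) - snd (t q) (fst (s q))) =
        snd (s q) (fscale (f q) (fst (t q))) - fscale (f q) (snd (t q)) (fst (s q))"
      by (simp add: A.ct_scale[OF A.of_cotangent[OF st(2) q] A.vf_tangent[OF st(3) q]] fscale_def[of _ "snd (t q)"] right_diff_distrib)
  qed
  also have "\<dots> = f p * E a p (\<lambda>q. snd (s q) (fst (t q)) - snd (t q) (fst (s q))) + (snd (s p) (fst (t p)) - snd (t p) (fst (s p))) * E a p f"
    by (rule A.tv_mult[OF Ep fp sh])
  finally have 3: "E a p (\<lambda>q. snd (s q) (fscale (f q) (fst (t q))) - fscale (f q) (snd (t q)) (fst (s q))) =
    f p * E a p (\<lambda>q. snd (s q) (fst (t q)) - snd (t q) (fst (s q))) + (snd (s p) (fst (t p)) - snd (t p) (fst (s p))) * E a p f" .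
  have 4: "fun_differential A f p (E a p) = E a p f" by (simp add: fun_differential_def Ep)
  have ft: "gen_section A (points A) (\<lambda>q. pscale (f q) (t q))"
    by (rule A.gen_section_scale[OF t f])
  have 5: "snd (courant_bracket A s (\<lambda>q. pscale (f q) (t q)) p) (E a p) =
    fst (s p) (\<lambda>q. fscale (f q) (snd (t q)) (E a q))
    - f p * snd (t p) (lie_bracket A (\<lambda>q. fst (s q)) (E a) p)
    - f p * fst (t p) (\<lambda>q. snd (s q) (E a q))
    + snd (s p) (lie_bracket A (\<lambda>q. fscale (f q) (fst (t q))) (E a) p)
    + 1/2 * E a p (\<lambda>q. snd (s q) (fscale (f q) (fst (t q))) - fscale (f q) (snd (t q)) (fst (s q)))"
    unfolding courant_snd[OF s ft p]
    unfolding pscale_def fst_conv snd_conv fscale_def[of "f p"] ..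
  have 6: "snd (pscale (f p) (courant_bracket A s t p) + pscale (fst (s p) f) (t p)
        - pscale (g_can (s p) (t p)) (0, fun_differential A f p)) (E a p) =
      f p * snd (courant_bracket A s t p) (E a p) + fst (s p) f * snd (t p) (E a p) - g_can (s p) (t p) * E a p f"
    by (simp add: pscale_def fscale_def 4)
  show "snd (courant_bracket A s (\<lambda>q. pscale (f q) (t q)) p) (E a p) =
     snd (pscale (f p) (courant_bracket A s t p) + pscale (fst (s p) f) (t p) - pscale (g_can (s p) (t p)) (0, fun_differential A f p)) (E a p)"
    unfolding 5 6
    unfolding 1 2 3 g_can_def courant_snd[OF s t p] by (simp add: field_simps)
qed

section \<open>Generalized sections with constant coefficients\<close>

definition gsec :: "'e \<times> 'e \<Rightarrow> 'a \<Rightarrow> 'a gvec" where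
  "gsec u p = (E (fst u) p, \<theta> (snd u) p)"

text \<open>The coadjoint action of a sends a covector w to c \<mapsto> - w \<bullet> br a c, with
  covectors written as vectors through the inner product. The second component is thus the action of
  fst u on snd v minus the action of fst v on snd u.\<close>

definition bk :: "'e \<times> 'e \<Rightarrow> 'e \<times> 'e \<Rightarrow> 'e \<times> 'e" where
  "bk u v = (br (fst u) (fst v), \<Sum>c\<in>onb. (snd u \<bullet> br (fst v) c - snd v \<bullet> br (fst u) c) *\<^sub>R c)"

lemma bk_snd: "snd (bk u v) \<bullet> c = snd u \<bullet> br (fst v) c - snd v \<bullet> br (fst u) c"
proof -
  have "linear (\<lambda>c. snd u \<bullet> br (fst v) c - snd v \<bullet> br (fst u) c)"
    by (rule linearI) (simp_all add: br_add_right br_scale_right inner_add_right right_diff_distrib)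
  from linear_onb[OF this, of c] show ?thesis
    by (simp add: bk_def inner_sum_left inner_commute[of c] mult.commute)
qed

lemma gsec_section: "gen_section A (points A) (gsec u)"
  by (simp add: A.gen_section_iff gsec_def E_vf \<theta>_of)

lemma gsec_tangent: "p \<in> points A \<Longrightarrow> gsec u p \<in> gen_tangent A p"
  by (rule A.gen_section_tangent[OF gsec_section])

lemma gsec_add: "p \<in> points A \<Longrightarrow> gsec (u + v) p = gsec u p + gsec v p"
  by (simp add: gsec_def E_add \<theta>_add)

lemma gsec_diff: "p \<in> points A \<Longrightarrow> gsec (u - v) p = gsec u p - gsec v p"
  by (simp add: gsec_def E_diff \<theta>_diff)

lemma \<theta>_inj: "p \<in> points A \<Longrightarrow> \<theta> a p = \<theta> b p \<Longrightarrow> a = b"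
  by (rule onb_eqI) (metis \<theta>_E)

lemma gsec_inj: "p \<in> points A \<Longrightarrow> gsec u p = gsec v p \<Longrightarrow> u = v"
  unfolding gsec_def using E_inj[of p "fst u" "fst v"] \<theta>_inj[of p "snd u" "snd v"] by (simp add: prod_eq_iff)

lemma \<theta>_scale: "p \<in> points A \<Longrightarrow> \<theta> (c *\<^sub>R a) p = fscale c (\<theta> a p)"
  by (simp add: \<theta>_onb[of p "c *\<^sub>R a"] \<theta>_onb[of p a] fun_eq_iff sum_fun_apply fscale_def
      sum_distrib_left mult.assoc)

lemma gsec_scale: "p \<in> points A \<Longrightarrow> gsec (c *\<^sub>R u) p = pscale c (gsec u p)"
  by (simp add: gsec_def E_scale \<theta>_scale pscale_def)

lemma gsec_sum: "p \<in> points A \<Longrightarrow> gsec (\<Sum>b\<in>I. f b) p = (\<Sum>b\<in>I. gsec (f b) p)"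
  using gsec_diff[of p 0 0] by (induction I rule: infinite_finite_induct) (auto simp: gsec_add)

definition gcoeff :: "'a \<Rightarrow> 'a gvec \<Rightarrow> 'e \<times> 'e" where
  "gcoeff p u = (\<Sum>b\<in>onb. \<theta> b p (fst u) *\<^sub>R b, \<Sum>b\<in>onb. snd u (E b p) *\<^sub>R b)"

lemma gsec_gcoeff: "p \<in> points A \<Longrightarrow> u \<in> gen_tangent A p \<Longrightarrow> gsec (gcoeff p u) p = u"
  using E_coeff[of p "fst u"] \<theta>_coeff[of p "snd u"] by (auto simp: gsec_def gcoeff_def gen_tangent_def)

lemma gsec_frame:
  assumes s: "gen_section A (points A) s"
  shows "\<exists>c. (\<forall>b\<in>onb. c b \<in> {f. smooth_fun A (points A) f}) \<and>
    (\<forall>q\<in>points A. s q = (\<Sum>b\<in>onb. pscale (c b q) (gsec b q)))"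
proof (intro exI[of _ "\<lambda>b q. gcoeff q (s q) \<bullet> b"] conjI ballI)
  note st = A.gen_sectionD[OF s]
  fix b :: "'e \<times> 'e"
  have "smooth_at A p (\<lambda>q. gcoeff q (s q) \<bullet> b)" if p: "p \<in> points A" for p
    unfolding gcoeff_def inner_prod_def inner_sum_left fst_conv snd_conv inner_scaleR_left
    by (intro A.smooth_at_add A.smooth_at_sum A.smooth_at_mult A.smooth_at_const p
        A.of_smooth[OF \<theta>_of p st(1) p] A.of_smooth[OF st(2) p E_vf p])
  then show "(\<lambda>q. gcoeff q (s q) \<bullet> b) \<in> {f. smooth_fun A (points A) f}"
    by (simp add: A.smooth_fun_iff A.mopen_points)
next
  fix q assume q: "q \<in> points A"
  have "s q = gsec (\<Sum>b\<in>onb. (gcoeff q (s q) \<bullet> b) *\<^sub>R b) q"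
    by (simp add: onb_expand gsec_gcoeff q A.gen_section_tangent[OF s])
  then show "s q = (\<Sum>b\<in>onb. pscale (gcoeff q (s q) \<bullet> b) (gsec b q))"
    by (simp add: gsec_sum gsec_scale q)
qed

text \<open>All pairings \<open>\<theta> w q (E a q)\<close> are constant in q, so every derivative
  term drops out, the exact one included, and the two terms with brackets of frame fields
  remain.\<close>

lemma courant_gsec:
  assumes p: "p \<in> points A"
  shows "courant_bracket A (gsec u) (gsec v) p = gsec (bk u v) p"
proof (rule gen_eqI[OF p courant_tangent[OF gsec_section gsec_section p] gsec_tangent[OF p]])
  show "fst (courant_bracket A (gsec u) (gsec v) p) = fst (gsec (bk u v) p)"
    by (simp add: courant_fst) (simp add: gsec_def bk_def bracket_E p)
  fix a
  have c: "E b p (\<lambda>q. \<theta> w q (E a q)) = 0" for a b w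
    using A.tv_cong[OF E_tangent[OF p] A.mopen_points p, of "\<lambda>q. \<theta> w q (E a q)" "\<lambda>_. w \<bullet> a" b]
      A.of_smooth[OF \<theta>_of p E_vf p] by (simp add: \<theta>_E A.tv_const[OF E_tangent[OF p] p])
  have d: "E a p (\<lambda>q. \<theta> w q (E b q) - \<theta> w' q (E b' q)) = 0" for a b b' w w'
    using c by (simp add: A.tv_diff[OF E_tangent[OF p]] A.of_smooth[OF \<theta>_of p E_vf p])
  show "snd (courant_bracket A (gsec u) (gsec v) p) (E a p) = snd (gsec (bk u v) p) (E a p)"
    unfolding courant_snd[OF gsec_section gsec_section p] gsec_def fst_conv snd_conv
    by (simp add: c d bracket_E p \<theta>_E bk_snd)
qed

end

subsection \<open>Horizontal and vertical lifts\<close>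

text \<open>\<open>horizontal_space\<close> quantifies over parallel global one-forms, so existence
  of lifts has to be supplied by a form through each covector. The values of D on the frame then fix
  what the lifts are.\<close>

locale frame_connection = frame_mfd A E \<theta> br for A :: "('a, 'e::findim_inner) atlas" and E \<theta> br +
  fixes D :: "('a \<Rightarrow> 'a tvec) \<Rightarrow> ('a \<Rightarrow> 'a tvec) \<Rightarrow> 'a \<Rightarrow> 'a tvec"
  assumes parallel_form: "p \<in> points A \<Longrightarrow> \<xi> \<in> cotangent_space A p \<Longrightarrow>
      \<exists>\<sigma>. one_form A (points A) \<sigma> \<and> \<sigma> p = \<xi> \<and>
        (\<forall>X Y. vector_field A (points A) X \<and> vector_field A (points A) Y \<longrightarrow> dual_connection D X \<sigma> Y p = 0)"
    and D_E: "p \<in> points A \<Longrightarrow> D (E a) (E b) p = E (br a b) p"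
begin

text \<open>A horizontal vector is tangent to a section \<sigma> that is parallel at the base point.
  Its derivative of \<open>mom c\<close> is E_a (\<sigma> (E_c)), which parallelism turns into
  \<sigma> (D_(E_a) E_c), an expression in \<xi> alone. Hence the vector does not depend on the
  choice of \<sigma>.\<close>

lemma horizontal_space_E:
  assumes x: "x \<in> points CB" and w: "w \<in> horizontal_space A D x" and wa: "differential CB A fst x w = E a (fst x)"
  shows "w \<in> tangent_space CB x" and "smooth_at A (fst x) f \<Longrightarrow> w (\<lambda>z. f (fst z)) = E a (fst x) f"
    and "w (mom c) = mom (br a c) x"
proof -
  define p \<xi> where "p = fst x" and "\<xi> = snd x"
  have xp: "x = (p, \<xi>)" "p \<in> points A" "\<xi> \<in> cotangent_space A p"
    using points_CB[OF x] by (simp_all add: p_def \<xi>_def)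
  obtain \<sigma> v where \<sigma>: "one_form A (points A) \<sigma>" "\<sigma> p = \<xi>"
    and par: "\<And>X Y. vector_field A (points A) X \<Longrightarrow> vector_field A (points A) Y \<Longrightarrow> dual_connection D X \<sigma> Y p = 0"
    and v: "v \<in> tangent_space A p" and w_eq: "w = differential A CB (\<lambda>q. (q, \<sigma> q)) p v"
    using w unfolding horizontal_space_def by (auto simp: xp(1))
  have sm: "smap A CB (\<lambda>q. (q, \<sigma> q)) p" by (rule smap_section[OF \<sigma>(1) xp(2)])
  show w_tan: "w \<in> tangent_space CB x"
    using differential_tangent[OF A.mfd_axioms C.mfd_axioms sm v] by (simp add: w_eq \<sigma>(2) xp(1))
  have base: "w (\<lambda>z. f (fst z)) = E a p f" if "smooth_at A p f" for f
    using fun_cong[OF wa, of f] that by (simp add: differential_apply p_def)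
  then show "w (\<lambda>z. f (fst z)) = E a (fst x) f" if "smooth_at A (fst x) f" using that by (simp add: p_def)
  \<comment> \<open>The projection undoes the section, so the vector v used to build w is the
    projection of w.\<close>
  have "v = E a p"
  proof (rule A.tangent_eqI[OF v E_tangent[OF xp(2)]])
    fix f assume f: "smooth_at A p f"
    then have "w (\<lambda>z. f (fst z)) = v f"
      using smooth_proj[of p \<xi> f] x by (simp add: w_eq differential_apply \<sigma>(2) xp(1))
    then show "v f = E a p f" using base[OF f] by simp
  qed
  then have "w (mom c) = E a p (\<lambda>q. \<sigma> q (E c q))"
    using mom_smooth[OF x, of c] by (simp add: w_eq differential_apply \<sigma>(2) xp(1) mom_def)
  also have "\<dots> = \<sigma> p (D (E a) (E c) p)"
    using par[OF E_vf E_vf, of a c] by (simp add: dual_connection_def)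
  finally show "w (mom c) = mom (br a c) x"
    by (simp add: D_E xp mom_def \<sigma>(2))
qed

text \<open>Makes the definite description usable: \<open>parallel_form\<close> gives existence, and
  uniqueness holds because \<open>horizontal_space_E\<close> prescribes the action on pulled-back
  functions and momenta.\<close>

lemma horizontal_lift_E:
  assumes x: "x \<in> points CB"
  shows "horizontal_lift A D x (E a (fst x)) \<in> horizontal_space A D x \<and>
    differential CB A fst x (horizontal_lift A D x (E a (fst x))) = E a (fst x)"
  unfolding horizontal_lift_def
proof (rule theI'[of "\<lambda>w. w \<in> horizontal_space A D x \<and> differential CB A fst x w = E a (fst x)"])
  define p \<xi> where "p = fst x" and "\<xi> = snd x"
  have xp: "x = (p, \<xi>)" "p \<in> points A" "\<xi> \<in> cotangent_space A p"
    using points_CB[OF x] by (simp_all add: p_def \<xi>_def)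
  obtain \<sigma> where \<sigma>: "one_form A (points A) \<sigma>" "\<sigma> p = \<xi>"
    "\<And>X Y. vector_field A (points A) X \<Longrightarrow> vector_field A (points A) Y \<Longrightarrow> dual_connection D X \<sigma> Y p = 0"
    using parallel_form[OF xp(2,3)] by blast
  define w where "w = differential A CB (\<lambda>q. (q, \<sigma> q)) p (E a p)"
  have w1: "w \<in> horizontal_space A D x"
    unfolding horizontal_space_def w_def using \<sigma> E_tangent[OF xp(2)]
    by (simp add: xp(1)) (intro exI[of _ \<sigma>] exI[of _ "E a p"], simp)
  have w2: "differential CB A fst x w = E a (fst x)"
  proof
    fix f
    show "differential CB A fst x w f = E a (fst x) f"
    proof (cases "smooth_at A p f")
      case True
      then show ?thesis using smooth_proj[of p \<xi> f] x
        by (simp add: differential_apply w_def xp(1) \<sigma>(2))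
    next
      case False
      then show ?thesis using A.tv_not_smooth[OF E_tangent[OF xp(2)]]
        by (simp add: differential_def xp(1))
    qed
  qed
  have "w' = w" if w': "w' \<in> horizontal_space A D x" "differential CB A fst x w' = E a (fst x)" for w'
    using horizontal_space_E[OF x w'] horizontal_space_E[OF x w1 w2] by (intro tangent_eq_mom[OF x]) auto
  then show "\<exists>!w. w \<in> horizontal_space A D x \<and> differential CB A fst x w = E a (fst x)"
    using w1 w2 by blast
qed

definition S :: "'e \<times> 'e \<Rightarrow> 'a \<times> 'a cvec \<Rightarrow> ('a \<times> 'a cvec) tvec" where
  "S u x = lift_iso A D x (gsec u (fst x))"

lemma S_lifts: "S u x = horizontal_lift A D x (E (fst u) (fst x)) + vertical_lift A x (\<theta> (snd u) (fst x))"
  by (simp add: S_def lift_iso_def gsec_def)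

lemma S_tangent: assumes x: "x \<in> points CB" shows "S u x \<in> tangent_space CB x"
proof -
  have "vertical_lift A x (\<theta> (snd u) (fst x)) \<in> tangent_space CB x"
    using vertical_lift_tangent[of "fst x" "snd x"] points_CB[OF x] \<theta>_cotangent by simp
  moreover have "horizontal_lift A D x (E (fst u) (fst x)) \<in> tangent_space CB x"
    using horizontal_space_E(1)[OF x] horizontal_lift_E[OF x] by blast
  ultimately show ?thesis unfolding S_lifts by (intro C.tangent_add)
qed

lemma S_base: "x \<in> points CB \<Longrightarrow> smooth_at A (fst x) f \<Longrightarrow> S u x (\<lambda>z. f (fst z)) = E (fst u) (fst x) f"
  using horizontal_space_E(2)[of x "horizontal_lift A D x (E (fst u) (fst x))" "fst u" f] horizontal_lift_E[of x "fst u"]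
    vertical_lift_base[of "fst x" "snd x" f] base_smooth[of x f]
  by (simp add: S_lifts)

lemma S_mom: "x \<in> points CB \<Longrightarrow> S u x (mom c) = mom (br (fst u) c) x + snd u \<bullet> c"
  using horizontal_space_E(3)[of x "horizontal_lift A D x (E (fst u) (fst x))" "fst u" c] horizontal_lift_E[of x "fst u"]
    vertical_lift_momentum[of "fst x" "snd x" "E c" "\<theta> (snd u) (fst x)"] mom_smooth[of x c] points_CB[of x]
  by (simp add: S_lifts mom_def \<theta>_E)

text \<open>\<open>S_base\<close> and \<open>S_mom\<close> characterize the lifted frame; its
  linearity and its brackets are verified against these two formulas.\<close>

lemma S_eqI:
  assumes x: "x \<in> points CB" and w: "w \<in> tangent_space CB x"
    and "\<And>f. smooth_at A (fst x) f \<Longrightarrow> w (\<lambda>z. f (fst z)) = E (fst u) (fst x) f"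
    and "\<And>c. w (mom c) = mom (br (fst u) c) x + snd u \<bullet> c"
  shows "w = S u x"
  by (rule tangent_eq_mom[OF x w S_tangent[OF x]]) (simp_all add: assms S_base S_mom)

lemma S_add:
  assumes x: "x \<in> points CB"
  shows "S (u + v) x = S u x + S v x"
proof -
  have p: "fst x \<in> points A" using points_CB[OF x] by simp
  show ?thesis
    by (rule S_eqI[OF x C.tangent_add[OF S_tangent[OF x] S_tangent[OF x]], symmetric])
       (simp_all add: S_base[OF x] S_mom[OF x] E_add[OF p] br_add_left linear_add[OF linear_mom[OF x]] inner_add_left)
qed

lemma S_scale:
  assumes x: "x \<in> points CB"
  shows "S (c *\<^sub>R u) x = fscale c (S u x)"
proof -
  have p: "fst x \<in> points A" using points_CB[OF x] by simp
  show ?thesis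
    by (rule S_eqI[OF x C.tangent_scale[OF S_tangent[OF x]], symmetric])
       (simp_all add: fscale_def S_base[OF x] S_mom[OF x] E_scale[OF p] br_scale_left linear_scale[OF linear_mom[OF x]] distrib_left)
qed

lemma S_diff: "x \<in> points CB \<Longrightarrow> S (u - v) x = S u x - S v x"
  using S_add[of x "u - v" v] by simp

lemma S_sum: "x \<in> points CB \<Longrightarrow> S (\<Sum>b\<in>I. f b) x = (\<Sum>b\<in>I. S (f b) x)"
  using S_diff[of x 0 0] by (induction I rule: infinite_finite_induct) (auto simp: S_add)

lemma S_inj:
  assumes x: "x \<in> points CB" and eq: "S u x = S v x"
  shows "u = v"
proof (rule prod_eqI)
  have p: "fst x \<in> points A" using points_CB[OF x] by simp
  show 1: "fst u = fst v"
  proof (rule E_inj[OF p A.tangent_eqI[OF E_tangent[OF p] E_tangent[OF p]]])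
    fix f assume f: "smooth_at A (fst x) f"
    show "E (fst u) (fst x) f = E (fst v) (fst x) f"
      using S_base[OF x f, of u] S_base[OF x f, of v] eq by simp
  qed
  show "snd u = snd v"
  proof (rule onb_eqI)
    show "snd u \<bullet> c = snd v \<bullet> c" for c
      using S_mom[OF x, of u c] S_mom[OF x, of v c] eq 1 by simp
  qed
qed

lemma S_vf: "vector_field CB (points CB) (S u)"
proof (rule vfI_mom[OF C.mopen_points S_tangent])
  fix x c assume x: "x \<in> points CB"
  show "smooth_at CB x (\<lambda>y. S u y (mom c))"
    by (rule C.smooth_at_cong[OF C.smooth_at_add[OF mom_smooth[OF x, of "br (fst u) c"] C.smooth_at_const[OF x, of "snd u \<bullet> c"]] C.mopen_points x])
       (simp add: S_mom)
next
  fix x f assume x: "x \<in> points CB" and f: "smooth_at A (fst x) f"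
  obtain W where W: "mopen A W" "fst x \<in> W" "\<And>q. q \<in> W \<Longrightarrow> smooth_at A q f"
    using A.smooth_at_nbhd[OF f] by blast
  have xW: "x \<in> CS W" using W(2) points_CB[OF x] by (metis mem_Sigma_iff prod.collapse)
  show "smooth_at CB x (\<lambda>y. S u y (\<lambda>z. f (fst z)))"
    by (rule C.smooth_at_cong[OF base_smooth[OF x E_smooth[OF f]] mopen_CS[OF W(1)] xW])
       (use W C.mopen_subset[OF mopen_CS[OF W(1)]] in \<open>auto simp: S_base\<close>)
qed

text \<open>On pulled-back functions the fields S u act like E (fst u). With a = fst u and b = fst
  v, the commutator applied to \<open>mom c\<close> gives the momentum of [a, [b, c]] - [b, [a, c]],
  which is that of [[a, b], c] by the Jacobi identity. The constants left over are the second
  component of \<open>bk u v\<close>.\<close>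

lemma bracket_S:
  assumes x: "x \<in> points CB"
  shows "lie_bracket CB (S u) (S v) x = S (bk u v) x"
proof (rule S_eqI[OF x C.lie_bracket_tangent[OF S_vf x S_vf x]])
  have p: "fst x \<in> points A" using points_CB[OF x] by simp
  fix f assume f: "smooth_at A (fst x) f"
  obtain W where W: "mopen A W" "fst x \<in> W" "\<And>q. q \<in> W \<Longrightarrow> smooth_at A q f"
    using A.smooth_at_nbhd[OF f] by blast
  have xW: "x \<in> CS W" using W(2) points_CB[OF x] by (metis mem_Sigma_iff prod.collapse)
  have e: "S u x (\<lambda>y. S v y (\<lambda>z. f (fst z))) = E (fst u) (fst x) (\<lambda>q. E (fst v) q f)" for u v
  proof -
    have "S u x (\<lambda>y. E (fst v) (fst y) f) = S u x (\<lambda>y. S v y (\<lambda>z. f (fst z)))"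
      by (rule C.tv_cong[OF S_tangent[OF x] mopen_CS[OF W(1)] xW base_smooth[OF x E_smooth[OF f]]])
         (use W C.mopen_subset[OF mopen_CS[OF W(1)]] in \<open>auto simp: S_base\<close>)
    then show ?thesis using S_base[OF x E_smooth[OF f]] by simp
  qed
  show "lie_bracket CB (S u) (S v) x (\<lambda>z. f (fst z)) = E (fst (bk u v)) (fst x) f"
    by (simp add: C.lie_bracket_apply[OF base_smooth[OF x f]] e bk_def E_br[OF f])
next
  fix c
  have e: "S u x (\<lambda>y. S v y (mom c)) = mom (br (fst u) (br (fst v) c)) x + snd u \<bullet> br (fst v) c" for u v
  proof -
    have "S u x (\<lambda>y. mom (br (fst v) c) y + snd v \<bullet> c) = S u x (\<lambda>y. S v y (mom c))"
      by (rule C.tv_cong[OF S_tangent[OF x] C.mopen_points x C.smooth_at_add[OF mom_smooth[OF x] C.smooth_at_const[OF x]]])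
         (simp add: S_mom)
    then show ?thesis
      by (simp add: C.tv_add[OF S_tangent[OF x] mom_smooth[OF x] C.smooth_at_const[OF x]] C.tv_const[OF S_tangent[OF x] x] S_mom[OF x])
  qed
  have "mom (br (fst u) (br (fst v) c)) x - mom (br (fst v) (br (fst u) c)) x = mom (br (br (fst u) (fst v)) c) x"
    by (simp add: linear_diff[OF linear_mom[OF x], symmetric] br_jacobi)
  moreover have "fst (bk u v) = br (fst u) (fst v)" by (simp add: bk_def)
  ultimately show "lie_bracket CB (S u) (S v) x (mom c) = mom (br (fst (bk u v)) c) x + snd (bk u v) \<bullet> c"
    by (simp add: C.lie_bracket_apply[OF mom_smooth[OF x]] e bk_snd)
qed

text \<open>Inverse of u \<mapsto> S u x: the first component comes from the projection to the base,
  the second is the action on momenta after subtracting that of the horizontal lift.\<close>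

definition coeff :: "'a \<times> 'a cvec \<Rightarrow> ('a \<times> 'a cvec) tvec \<Rightarrow> 'e \<times> 'e" where
  "coeff x w = (let a = \<Sum>b\<in>onb. \<theta> b (fst x) (differential CB A fst x w) *\<^sub>R b
    in (a, \<Sum>c\<in>onb. (w (mom c) - mom (br a c) x) *\<^sub>R c))"

lemma S_coeff:
  assumes x: "x \<in> points CB" and w: "w \<in> tangent_space CB x"
  shows "S (coeff x w) x = w"
proof -
  define a where "a = (\<Sum>b\<in>onb. \<theta> b (fst x) (differential CB A fst x w) *\<^sub>R b)"
  have p: "fst x \<in> points A" using points_CB[OF x] by simp
  have a: "differential CB A fst x w = E a (fst x)"
    unfolding a_def by (rule E_coeff[OF p differential_tangent[OF C.mfd_axioms A.mfd_axioms smap_proj[OF x] w]])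
  have c: "coeff x w = (a, \<Sum>c\<in>onb. (w (mom c) - mom (br a c) x) *\<^sub>R c)"
    by (simp add: coeff_def Let_def a_def)
  have "w = S (coeff x w) x"
  proof (rule tangent_eq_mom[OF x w S_tangent[OF x]])
    fix f assume f: "smooth_at A (fst x) f"
    show "w (\<lambda>z. f (fst z)) = S (coeff x w) x (\<lambda>z. f (fst z))"
      using fun_cong[OF a, of f] f by (simp add: S_base[OF x f] c differential_apply)
  next
    fix c' :: 'e assume c': "c' \<in> onb"
    show "w (mom c') = S (coeff x w) x (mom c')"
      by (simp add: S_mom[OF x] c inner_sum_onb[OF c'])
  qed
  then show ?thesis by simp
qed

lemma coeff_smooth:
  assumes X: "vector_field CB W X" "x \<in> W"
  shows "smooth_at CB x (\<lambda>y. coeff y (X y) \<bullet> u)"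
proof -
  have x: "x \<in> points CB" by (rule C.mopen_subset[OF C.vf_mopen[OF X(1)] X(2)])
  obtain U \<phi> where U: "(U, \<phi>) \<in> A" "fst x \<in> U" using A.points_chart points_CB[OF x] by blast
  have CU: "(CS U, cotangent_chart A U \<phi>) \<in> CB" "x \<in> CS U"
    using U cotangent_bundle_chart points_CB[OF x] by auto (metis mem_Sigma_iff prod.collapse)
  have WU: "mopen CB (W \<inter> CS U)" "x \<in> W \<inter> CS U"
    using C.mopen_Int[OF C.vf_mopen[OF X(1)] C.mopen_chart[OF CU(1)]] X CU by auto
  \<comment> \<open>The frame coefficients of the projection of X y to the base, expanded in a chart
    so that their smoothness in y becomes visible.\<close>
  define g where "g b y = (\<Sum>c\<in>onb. X y (\<lambda>z. \<phi> (fst z) \<bullet> c) * \<theta> b (fst y) (coord_vec A U \<phi> (fst y) c))" for b y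
  have g: "smooth_at CB x (g b)" for b
    unfolding g_def
    by (intro C.smooth_at_sum C.smooth_at_mult x C.vf_smooth[OF X] base_smooth[OF x] A.smooth_at_coord[OF U]
        smooth_frame_coeff[OF A.vf_coord[OF U(1)] U(2)])
  have "smooth_at CB x (\<lambda>y. (\<Sum>b\<in>onb. g b y * (b \<bullet> fst u)) +
     (\<Sum>c\<in>onb. (X y (mom c) - (\<Sum>b\<in>onb. g b y * mom (br b c) y)) * (c \<bullet> snd u)))"
    by (intro C.smooth_at_add C.smooth_at_sum C.smooth_at_mult C.smooth_at_diff C.smooth_at_const x g
        mom_smooth[OF x] C.vf_smooth[OF X])
  then show ?thesis
  proof (rule C.smooth_at_cong[OF _ WU])
    fix y assume y: "y \<in> W \<inter> CS U"
    then have yp: "y \<in> points CB" "fst y \<in> U" "fst y \<in> points A" and Xy: "X y \<in> tangent_space CB y"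
      using C.mopen_subset[OF WU(1)] C.vf_tangent[OF X(1)] points_CB by auto
    have "differential CB A fst y (X y) \<in> tangent_space A (fst y)"
      by (rule differential_tangent[OF C.mfd_axioms A.mfd_axioms smap_proj[OF yp(1)] Xy])
    from A.ct_expand[OF U(1) yp(2) \<theta>_cotangent[OF yp(3)] this]
    have gy: "\<theta> b (fst y) (differential CB A fst y (X y)) = g b y" for b
      by (simp add: g_def differential_apply A.smooth_at_coord[OF U(1) yp(2)])
    have m: "mom (br (\<Sum>b\<in>onb. g b y *\<^sub>R b) c) y = (\<Sum>b\<in>onb. g b y * mom (br b c) y)" for c
      by (simp add: linear_sum[OF linear_br_left] linear_scale[OF linear_br_left] linear_sum[OF linear_mom[OF yp(1)]]
          linear_scale[OF linear_mom[OF yp(1)]])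
    show "(\<Sum>b\<in>onb. g b y * (b \<bullet> fst u)) + (\<Sum>c\<in>onb. (X y (mom c) - (\<Sum>b\<in>onb. g b y * mom (br b c) y)) * (c \<bullet> snd u)) =
        coeff y (X y) \<bullet> u"
      by (simp add: coeff_def Let_def gy m inner_prod_def inner_sum_left)
  qed
qed

lemma S_onb:
  assumes x: "x \<in> points CB" and w: "w \<in> tangent_space CB x" and h: "linear h"
  shows "S (h (coeff x w)) x = (\<Sum>b\<in>onb. fscale (coeff x w \<bullet> b) (S (h b) x))"
  by (subst linear_onb[OF h]) (simp add: S_sum[OF x] S_scale[OF x])

end

subsection \<open>Generalized complex structures that are constant in a frame\<close>

locale frame_gcs = frame_connection A E \<theta> br D for A :: "('a, 'e::findim_inner) atlas" and E \<theta> br D +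
  fixes \<J> :: "'a \<Rightarrow> 'a gvec \<Rightarrow> 'a gvec" and j :: "'e \<times> 'e \<Rightarrow> 'e \<times> 'e"
  assumes gcs: "skew_gen_complex_structure A \<J>"
    and J_gsec: "p \<in> points A \<Longrightarrow> \<J> p (gsec u p) = gsec (j u) p"
begin

lemma J_add: "p \<in> points A \<Longrightarrow> u \<in> gen_tangent A p \<Longrightarrow> v \<in> gen_tangent A p \<Longrightarrow> \<J> p (u + v) = \<J> p u + \<J> p v"
  and J_scale: "p \<in> points A \<Longrightarrow> u \<in> gen_tangent A p \<Longrightarrow> \<J> p (pscale c u) = pscale c (\<J> p u)"
  and J_skew: "p \<in> points A \<Longrightarrow> u \<in> gen_tangent A p \<Longrightarrow> v \<in> gen_tangent A p \<Longrightarrow> g_can (\<J> p u) v = - g_can u (\<J> p v)"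
  and J_J: "p \<in> points A \<Longrightarrow> u \<in> gen_tangent A p \<Longrightarrow> \<J> p (\<J> p u) = - u"
  and J_section: "gen_section A W s \<Longrightarrow> gen_section A W (\<lambda>p. \<J> p (s p))"
  using gcs unfolding skew_gen_complex_structure_def by blast+

lemma pscale_minus_one: "pscale (- 1) u = - u"
  by (simp add: pscale_def fscale_def prod_eq_iff fun_eq_iff)

lemma fscale_minus_one: "fscale (- 1) u = - u"
  by (simp add: fscale_def fun_eq_iff)

lemma gsec_uminus: "p \<in> points A \<Longrightarrow> gsec (- u) p = - gsec u p"
  using gsec_scale[of p "-1" u] by (simp add: pscale_minus_one)

lemma linear_j: "linear j"
proof -
  obtain p where p: "p \<in> points A" using ex_point ..
  show ?thesis
  proof (rule linearI)
    fix u v c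
    show "j (u + v) = j u + j v"
      by (rule gsec_inj[OF p]) (simp add: J_gsec[OF p, symmetric] gsec_add[OF p] J_add[OF p] gsec_tangent[OF p])
    show "j (c *\<^sub>R u) = c *\<^sub>R j u"
      by (rule gsec_inj[OF p]) (simp add: J_gsec[OF p, symmetric] gsec_scale[OF p] J_scale[OF p] gsec_tangent[OF p])
  qed
qed

lemma j_j: "j (j u) = - u"
proof -
  obtain p where p: "p \<in> points A" using ex_point ..
  show ?thesis
    by (rule gsec_inj[OF p]) (simp add: J_gsec[OF p, symmetric] gsec_uminus[OF p] J_J[OF p] gsec_tangent[OF p])
qed

abbreviation "JT \<equiv> cotangent_acs A \<J> D"

text \<open>\<open>cotangent_acs\<close> inverts \<open>lift_iso\<close> by \<open>inv_into\<close>,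
  so injectivity on the fibre is what makes the formula apply. It follows from \<open>S_inj\<close>,
  as each generalized tangent vector is a value of some \<open>gsec\<close>.\<close>

lemma JT_S:
  assumes x: "x \<in> points CB"
  shows "JT x (S u x) = S (j u) x"
proof -
  have p: "fst x \<in> points A" using points_CB[OF x] by simp
  have "inj_on (lift_iso A D x) (gen_tangent A (fst x))"
  proof (rule inj_onI)
    fix v w assume vw: "v \<in> gen_tangent A (fst x)" "w \<in> gen_tangent A (fst x)" "lift_iso A D x v = lift_iso A D x w"
    then have "S (gcoeff (fst x) v) x = S (gcoeff (fst x) w) x"
      by (simp add: S_def gsec_gcoeff p)
    then show "v = w" using S_inj[OF x] gsec_gcoeff[OF p] vw by metis
  qed
  from inv_into_f_f[OF this gsec_tangent[OF p, of u]] show ?thesis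
    by (simp add: cotangent_acs_def S_def J_gsec p)
qed

lemma JT_coeff: "x \<in> points CB \<Longrightarrow> w \<in> tangent_space CB x \<Longrightarrow> JT x w = S (j (coeff x w)) x"
  using JT_S[of x "coeff x w"] S_coeff[of x w] by simp

lemma JT_tangent: "x \<in> points CB \<Longrightarrow> w \<in> tangent_space CB x \<Longrightarrow> JT x w \<in> tangent_space CB x"
  by (simp add: JT_coeff S_tangent)

lemma S_uminus: "x \<in> points CB \<Longrightarrow> S (- u) x = - S u x"
  using S_scale[of x "-1" u] by (simp add: fscale_minus_one)

lemma JT_add:
  assumes x: "x \<in> points CB" and "v \<in> tangent_space CB x" "w \<in> tangent_space CB x"
  shows "JT x (v + w) = JT x v + JT x w"
proof -
  have "JT x (S (coeff x v) x + S (coeff x w) x) = S (j (coeff x v) + j (coeff x w)) x"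
    by (simp only: S_add[OF x, symmetric] JT_S[OF x] linear_add[OF linear_j])
  then show ?thesis using assms by (simp add: S_coeff S_add JT_coeff)
qed

lemma JT_scale:
  assumes x: "x \<in> points CB" and "v \<in> tangent_space CB x"
  shows "JT x (fscale c v) = fscale c (JT x v)"
proof -
  have "JT x (fscale c (S (coeff x v) x)) = S (c *\<^sub>R j (coeff x v)) x"
    by (simp only: S_scale[OF x, symmetric] JT_S[OF x] linear_scale[OF linear_j])
  then show ?thesis using assms by (simp add: S_coeff S_scale JT_coeff)
qed

lemma JT_JT: "x \<in> points CB \<Longrightarrow> v \<in> tangent_space CB x \<Longrightarrow> JT x (JT x v) = - v"
  by (simp add: JT_coeff[of x v] JT_S j_j S_uminus S_coeff)

text \<open>By linearity the image of X has the coefficients of X, taken with respect to the smooth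
  fields S (j b).\<close>

lemma JT_vf:
  assumes X: "vector_field CB W X"
  shows "vector_field CB W (\<lambda>x. JT x (X x))"
proof -
  have W: "mopen CB W" by (rule C.vf_mopen[OF X])
  have "vector_field CB W (\<lambda>x. \<Sum>b\<in>onb. fscale (coeff x (X x) \<bullet> b) (S (j b) x))"
    by (intro C.vf_sum W C.vf_scale coeff_smooth[OF X] C.vf_subset[OF S_vf W]) (auto dest: C.mopen_subset[OF W])
  then show ?thesis
    by (rule C.vf_cong)
       (simp add: JT_coeff C.mopen_subset[OF W] C.vf_tangent[OF X] S_onb[OF _ _ linear_j])
qed

lemma almost_complex_JT: "almost_complex_structure CB JT"
  unfolding almost_complex_structure_def
  by (simp add: JT_tangent JT_add JT_scale JT_JT JT_vf)

abbreviation "constant_nijenhuis_zero \<equiv>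
  \<forall>u v. bk (j u) (j v) - j (bk (j u) v) - j (bk u (j v)) - bk u v = 0"

text \<open>The Lie bracket satisfies the Leibniz rule exactly, so the defect data \<open>ip\<close>
  and \<open>dd\<close> are zero.\<close>

interpretation NT: acs_bracket fscale "points CB" "{X. vector_field CB (points CB) X}" "{f. smooth_fun CB (points CB) f}"
  "tangent_space CB" "lie_bracket CB" "\<lambda>v f. v f" "\<lambda>_ _. 0" "\<lambda>_ _. 0" JT
  unfolding acs_bracket_def acs_bracket_axioms_def
proof (intro conjI allI impI)
  show "section_space fscale (points CB) {X. vector_field CB (points CB) X} {f. smooth_fun CB (points CB) f}"
    by (rule C.section_space_vf)
  fix x s t t' f
  assume x: "x \<in> points CB"
  assume s: "s \<in> {X. vector_field CB (points CB) X}" and t: "t \<in> {X. vector_field CB (points CB) X}"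
  show "lie_bracket CB s t x \<in> tangent_space CB x"
    using C.lie_bracket_tangent[of "points CB" s x "points CB" t] s t x by simp
  show "lie_bracket CB t s x = - lie_bracket CB s t x" by (rule C.lie_bracket_antisym)
  show "lie_bracket CB s (\<lambda>q. fscale (f q) (t q)) x =
      fscale (f x) (lie_bracket CB s t x) + fscale (s x f) (t x) - fscale 0 0"
    if "f \<in> {f. smooth_fun CB (points CB) f}"
    using C.lie_bracket_scale[of "points CB" s x t f] s t x that by (simp add: C.smooth_fun_iff fscale_def fun_eq_iff)
  assume t': "t' \<in> {X. vector_field CB (points CB) X}"
  show "lie_bracket CB s (\<lambda>q. t q + t' q) x = lie_bracket CB s t x + lie_bracket CB s t' x"
    using C.lie_bracket_add[of "points CB" s x t t'] s t t' x by simp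
  show "lie_bracket CB s t x = lie_bracket CB s t' x" if "\<forall>q. q \<in> points CB \<longrightarrow> t q = t' q"
    using C.lie_bracket_cong[of "points CB" s t "points CB" x s t'] s t x that C.mopen_points by simp
qed (auto simp: C.tangent_add C.tangent_scale C.tangent_zero C.vf_tangent JT_add JT_scale JT_JT JT_vf)

lemma integrable_JT: "integrable_almost_complex_structure CB JT \<longleftrightarrow> constant_nijenhuis_zero"
proof -
  have "nijenhuis CB JT X Y x = NT.nij X Y x" for X Y x
    by (simp add: nijenhuis_def NT.nij_def Let_def)
  then have "integrable_almost_complex_structure CB JT \<longleftrightarrow>
    (\<forall>s\<in>{X. vector_field CB (points CB) X}. \<forall>t\<in>{X. vector_field CB (points CB) X}. \<forall>p\<in>points CB. NT.nij s t p = 0)"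
    by (auto simp: integrable_almost_complex_structure_def almost_complex_JT)
  also have "\<dots> \<longleftrightarrow> constant_nijenhuis_zero"
  proof -
    obtain p where p: "p \<in> points A" using ex_point ..
    have x: "(p, 0) \<in> points CB" using p by (simp add: points_cotangent_bundle A.cotangent_zero)
    show ?thesis
    proof (rule NT.nij_frame[of S, OF _ S_diff _ x bracket_S JT_S])
      show "S u \<in> {X. vector_field CB (points CB) X}" for u by (simp add: S_vf)
      show "u = 0" if "x \<in> points CB" "S u x = 0" for u x
        using S_inj[OF that(1), of u 0] S_diff[OF that(1), of 0 0] that(2) by simp
      fix X assume "X \<in> {X. vector_field CB (points CB) X}"
      then have X: "vector_field CB (points CB) X" by simp
      show "\<exists>c. (\<forall>b\<in>onb. c b \<in> {f. smooth_fun CB (points CB) f}) \<and>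
          (\<forall>q\<in>points CB. X q = (\<Sum>b\<in>onb. fscale (c b q) (S b q)))"
      proof (intro exI[of _ "\<lambda>b x. coeff x (X x) \<bullet> b"] conjI ballI)
        show "(\<lambda>x. coeff x (X x) \<bullet> b) \<in> {f. smooth_fun CB (points CB) f}" for b
          using coeff_smooth[OF X] by (simp add: C.smooth_fun_iff C.mopen_points)
        show "X q = (\<Sum>b\<in>onb. fscale (coeff q (X q) \<bullet> b) (S b q))" if q: "q \<in> points CB" for q
          using S_onb[OF q C.vf_tangent[OF X q] linear_ident] S_coeff[OF q C.vf_tangent[OF X q]] by simp
      qed
    qed
  qed
  finally show ?thesis .
qed

text \<open>The anchor is the projection to the vector part, and the defect of
  \<open>courant_scale\<close> supplies \<open>ip\<close> and \<open>dd\<close>; the assumption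
  \<open>ip_J\<close> becomes skewness with respect to \<open>g_can\<close>.\<close>

interpretation NG: acs_bracket pscale "points A" "{s. gen_section A (points A) s}" "{f. smooth_fun A (points A) f}"
  "gen_tangent A" "courant_bracket A" "\<lambda>u f. fst u f" g_can "\<lambda>f p. (0, fun_differential A f p)" \<J>
  unfolding acs_bracket_def acs_bracket_axioms_def
proof (intro conjI allI impI)
  show "section_space pscale (points A) {s. gen_section A (points A) s} {f. smooth_fun A (points A) f}"
    by (rule A.section_space_gen)
  fix p
  assume p: "p \<in> points A"
  show "(0, fun_differential A f p) \<in> gen_tangent A p" for f
    by (simp add: gen_tangent_def A.tangent_zero A.fun_differential_cotangent)
  show "g_can u (- v) = - g_can u v" if "u \<in> gen_tangent A p" "v \<in> gen_tangent A p" for u v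
    using that A.ct_uminus[of "snd u" p "fst v"] by (auto simp: g_can_def gen_tangent_def field_simps)
  fix s t t' f
  assume s: "s \<in> {s. gen_section A (points A) s}" and t: "t \<in> {s. gen_section A (points A) s}"
  show "courant_bracket A s t p \<in> gen_tangent A p" using courant_tangent[of s t p] s t p by simp
  show "courant_bracket A t s p = - courant_bracket A s t p" using courant_anti[of s t p] s t p by simp
  show "courant_bracket A s (\<lambda>q. pscale (f q) (t q)) p =
      pscale (f p) (courant_bracket A s t p) + pscale (fst (s p) f) (t p) - pscale (g_can (s p) (t p)) (0, fun_differential A f p)"
    if "f \<in> {f. smooth_fun A (points A) f}"
    using courant_scale[of s t p f] s t p that by (simp add: A.smooth_fun_iff)
  assume t': "t' \<in> {s. gen_section A (points A) s}"
  show "courant_bracket A s (\<lambda>q. t q + t' q) p = courant_bracket A s t p + courant_bracket A s t' p"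
    using courant_add[of s t t' p] s t t' p by simp
  show "courant_bracket A s t p = courant_bracket A s t' p" if "\<forall>q. q \<in> points A \<longrightarrow> t q = t' q"
    using courant_cong[of s t t' p] s t t' p that by simp
qed (auto simp: A.gen_tangent_add A.gen_tangent_scale A.gen_section_tangent J_add J_scale J_J J_section J_skew)

text \<open>For a + i b the eigenvalue equation says J a = - b and J b = a. The two are equivalent
  since J J = - 1, so the imaginary part b is free and determines the real part.\<close>

lemma holomorphic_section_iff:
  "holomorphic_section A \<J> z \<longleftrightarrow> gen_section A (points A) (\<lambda>p. fst (z p)) \<and> gen_section A (points A) (\<lambda>p. snd (z p)) \<and>
    (\<forall>p\<in>points A. fst (z p) = \<J> p (snd (z p)))"
proof -
  have "z p \<in> holomorphic_bundle A \<J> p \<longleftrightarrow> fst (z p) = \<J> p (snd (z p))"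
    if "p \<in> points A" "fst (z p) \<in> gen_tangent A p" "snd (z p) \<in> gen_tangent A p" for p
    using that J_J[of p "snd (z p)"]
    by (cases "z p") (auto simp: holomorphic_bundle_def i_times_def)
  then show ?thesis
    unfolding holomorphic_section_def o_def using A.gen_section_tangent by blast
qed

lemma courant_sections:
  assumes "gen_section A (points A) s" "gen_section A (points A) t" "gen_section A (points A) s'" "gen_section A (points A) t'"
  shows "gen_section A (points A) (\<lambda>p. courant_bracket A s t p - courant_bracket A s' t' p)"
    and "gen_section A (points A) (\<lambda>p. courant_bracket A s t p + courant_bracket A s' t' p)"
  using A.gen_section_add[OF A.gen_section_courant[OF assms(1,2)] A.gen_section_courant[OF assms(3,4)]]
    A.gen_section_add[OF A.gen_section_courant[OF assms(1,2)] A.gen_section_uminus[OF A.gen_section_courant[OF assms(3,4)]]]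
  by simp_all

lemma courant_cong2:
  assumes "gen_section A (points A) s" "gen_section A (points A) s'" "gen_section A (points A) t" "gen_section A (points A) t'"
    "p \<in> points A" "\<And>q. q \<in> points A \<Longrightarrow> s q = s' q" "\<And>q. q \<in> points A \<Longrightarrow> t q = t' q"
  shows "courant_bracket A s t p = courant_bracket A s' t' p"
  using courant_cong[OF assms(1,3,4,5,7)] courant_cong[OF assms(4,1,2,5,6)] courant_anti[of _ t' p] assms by simp

text \<open>With imaginary parts s and t, the bracket has real part [J s, J t] - [s, t] and
  imaginary part [J s, t] + [s, J t]. That the former is J of the latter is exactly the vanishing of
  the Nijenhuis expression.\<close>

lemma holomorphic_bracket_iff:
  assumes z: "holomorphic_section A \<J> z" and w: "holomorphic_section A \<J> w"
  shows "holomorphic_section A \<J> (complex_courant_bracket A z w) \<longleftrightarrow>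
    (\<forall>p\<in>points A. NG.nij (\<lambda>p. snd (z p)) (\<lambda>p. snd (w p)) p = 0)"
proof -
  define s t where "s = (\<lambda>p. snd (z p))" and "t = (\<lambda>p. snd (w p))"
  have st: "gen_section A (points A) s" "gen_section A (points A) t"
    and Z: "gen_section A (points A) (\<lambda>p. fst (z p))" "\<And>p. p \<in> points A \<Longrightarrow> fst (z p) = \<J> p (s p)"
    and W: "gen_section A (points A) (\<lambda>p. fst (w p))" "\<And>p. p \<in> points A \<Longrightarrow> fst (w p) = \<J> p (t p)"
    using z w by (simp_all add: holomorphic_section_iff s_def t_def)
  note Js = J_section[OF st(1)] and Jt = J_section[OF st(2)]
  have c: "complex_courant_bracket A z w p =
      (courant_bracket A (\<lambda>p. \<J> p (s p)) (\<lambda>p. \<J> p (t p)) p - courant_bracket A s t p,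
       courant_bracket A (\<lambda>p. \<J> p (s p)) t p + courant_bracket A s (\<lambda>p. \<J> p (t p)) p)" if p: "p \<in> points A" for p
  proof -
    have "complex_courant_bracket A z w p =
      (courant_bracket A (\<lambda>p. fst (z p)) (\<lambda>p. fst (w p)) p - courant_bracket A s t p,
       courant_bracket A (\<lambda>p. fst (z p)) t p + courant_bracket A s (\<lambda>p. fst (w p)) p)"
      unfolding complex_courant_bracket_def o_def s_def t_def ..
    then show ?thesis
      by (simp only: courant_cong2[OF Z(1) Js W(1) Jt p Z(2) W(2)] courant_cong2[OF Z(1) Js st(2) st(2) p Z(2) refl]
        courant_cong2[OF st(1) st(1) W(1) Jt p refl W(2)])
  qed
  have f: "gen_section A (points A) (\<lambda>p. fst (complex_courant_bracket A z w p))"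
    by (rule A.gen_section_cong[OF courant_sections(1)[OF Js Jt st]]) (simp add: c)
  have g: "gen_section A (points A) (\<lambda>p. snd (complex_courant_bracket A z w p))"
    by (rule A.gen_section_cong[OF courant_sections(2)[OF Js st(2) st(1) Jt]]) (simp add: c)
  have "fst (complex_courant_bracket A z w p) = \<J> p (snd (complex_courant_bracket A z w p)) \<longleftrightarrow> NG.nij s t p = 0"
    if p: "p \<in> points A" for p
    using J_add[OF p courant_tangent[OF Js st(2) p] courant_tangent[OF st(1) Jt p]]
    by (simp add: c[OF p] NG.nij_def diff_diff_eq2 algebra_simps)
  then show ?thesis
    unfolding holomorphic_section_iff using f g by (simp add: s_def t_def)
qed

lemma courant_integrable_iff: "courant_integrable A \<J> \<longleftrightarrow> constant_nijenhuis_zero"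
proof -
  \<comment> \<open>Every real section is the imaginary part of a holomorphic one, so closure of the
    holomorphic sections tests all pairs s, t.\<close>
  have hol: "holomorphic_section A \<J> (\<lambda>p. (\<J> p (s p), s p))" if "gen_section A (points A) s" for s
    using that J_section[OF that] by (simp add: holomorphic_section_iff)
  have "courant_integrable A \<J> \<longleftrightarrow>
    (\<forall>s\<in>{s. gen_section A (points A) s}. \<forall>t\<in>{s. gen_section A (points A) s}. \<forall>p\<in>points A. NG.nij s t p = 0)"
  proof (intro iffI ballI)
    fix s t p assume c: "courant_integrable A \<J>" and s: "s \<in> {s. gen_section A (points A) s}"
      and t: "t \<in> {s. gen_section A (points A) s}" and p: "p \<in> points A"
    note st = hol[of s] hol[of t]
    show "NG.nij s t p = 0"
      using c st holomorphic_bracket_iff[OF st] s t p by (simp add: courant_integrable_def)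
  next
    assume N: "\<forall>s\<in>{s. gen_section A (points A) s}. \<forall>t\<in>{s. gen_section A (points A) s}. \<forall>p\<in>points A. NG.nij s t p = 0"
    show "courant_integrable A \<J>"
      unfolding courant_integrable_def
    proof (intro allI impI)
      fix z w assume zw: "holomorphic_section A \<J> z \<and> holomorphic_section A \<J> w"
      then have "gen_section A (points A) (\<lambda>p. snd (z p))" "gen_section A (points A) (\<lambda>p. snd (w p))"
        by (simp_all add: holomorphic_section_iff)
      then show "holomorphic_section A \<J> (complex_courant_bracket A z w)"
        using holomorphic_bracket_iff[of z w] zw N by simp
    qed
  qed
  also have "\<dots> \<longleftrightarrow> constant_nijenhuis_zero"
  proof -
    obtain p where p: "p \<in> points A" using ex_point ..
    show ?thesis
    proof (rule NG.nij_frame[of gsec, OF _ gsec_diff _ p courant_gsec J_gsec])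
      show "gsec u \<in> {s. gen_section A (points A) s}" for u by (simp add: gsec_section)
      show "u = 0" if "p \<in> points A" "gsec u p = 0" for u p
        using gsec_inj[OF that(1), of u 0] gsec_diff[OF that(1), of 0 0] that(2) by simp
    qed (use gsec_frame in auto)
  qed
  finally show ?thesis .
qed

lemma courant_integrable_iff_JT:
  "courant_integrable A \<J> \<longleftrightarrow> integrable_almost_complex_structure (cotangent_bundle A) (cotangent_acs A \<J> D)"
  using courant_integrable_iff integrable_JT by simp

end

section \<open>Lie groups\<close>

text \<open>The chart around the identity identifies the Lie algebra with the model space: a
  corresponds to \<open>coord_vec A U \<phi> \<one> a\<close>.\<close>

locale lie_chart = group G + A: mfd A for G :: "('g, 'm) monoid_scheme" (structure) and A :: "('g, 'e::findim_inner) atlas" +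
  fixes U :: "'g set" and \<phi> :: "'g \<Rightarrow> 'e"
  assumes lie: "lie_group G A" and U: "(U, \<phi>) \<in> A" "\<one> \<in> U"
begin

sublocale AA: mfd2 A A ..
sublocale cotangent_mfd A ..

lemma carrier: "carrier G = points A"
  using lie by (simp add: lie_group_def)

lemma points_closed [simp]:
  "\<one> \<in> points A" "x \<in> points A \<Longrightarrow> y \<in> points A \<Longrightarrow> x \<otimes> y \<in> points A" "x \<in> points A \<Longrightarrow> inv x \<in> points A"
  using one_closed m_closed inv_closed by (auto simp: carrier)

lemmas group_points [simp] = l_one[unfolded carrier] r_one[unfolded carrier] l_inv[unfolded carrier] r_inv[unfolded carrier]
  inv_inv[unfolded carrier]
lemmas assoc = m_assoc[unfolded carrier]

lemma cancel_inv [simp]: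
  "x \<in> points A \<Longrightarrow> y \<in> points A \<Longrightarrow> x \<otimes> (inv x \<otimes> y) = y"
  "x \<in> points A \<Longrightarrow> y \<in> points A \<Longrightarrow> inv x \<otimes> (x \<otimes> y) = y"
  by (simp_all add: assoc[symmetric])

lemma smap_mult:
  assumes C: "mfd C" and F: "smap C A F p" and H: "smap C A H p"
  shows "smap C A (\<lambda>x. F x \<otimes> H x) p"
proof -
  have "(F p, H p) \<in> points (prod_atlas A A)" using F H by (simp add: smap_def points_prod_atlas)
  moreover have "smooth_map (prod_atlas A A) A (\<lambda>(g, h). g \<otimes> h)" using lie by (simp add: lie_group_def)
  ultimately have "smap (prod_atlas A A) A (\<lambda>(g, h). g \<otimes> h) (F p, H p)"
    by (intro smooth_map_smap AA.P.mfd_axioms A.mfd_axioms)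
  from smap_comp[OF AA.smap_Pair[OF C F H] this] show ?thesis by simp
qed

lemma smap_inv:
  assumes F: "smap C A F p"
  shows "smap C A (\<lambda>x. inv (F x)) p"
proof -
  have "smooth_map A A (\<lambda>g. inv g)" using lie by (simp add: lie_group_def)
  then have "smap A A (\<lambda>g. inv g) (F p)"
    using F by (intro smooth_map_smap A.mfd_axioms) (auto simp: smap_def)
  from smap_comp[OF F this] show ?thesis .
qed

lemma smap_left: "g \<in> points A \<Longrightarrow> h \<in> points A \<Longrightarrow> smap A A (\<lambda>k. g \<otimes> k) h"
  by (intro smap_mult A.mfd_axioms smap_const smap_id)

lemma smap_diagonal: "p \<in> points A \<Longrightarrow> smap A (prod_atlas A A) (\<lambda>q. (q, q)) p"
  by (intro AA.smap_Pair A.mfd_axioms smap_id)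

lemma left_push_apply: "smooth_at A (g \<otimes> h) f \<Longrightarrow> left_push G A g h v f = v (\<lambda>k. f (g \<otimes> k))"
  by (simp add: left_push_def differential_apply)

lemma left_push_not_smooth: "\<not> smooth_at A (g \<otimes> h) f \<Longrightarrow> left_push G A g h v f = 0"
  by (simp add: left_push_def differential_def)

lemma left_push_tangent:
  "g \<in> points A \<Longrightarrow> h \<in> points A \<Longrightarrow> v \<in> tangent_space A h \<Longrightarrow> left_push G A g h v \<in> tangent_space A (g \<otimes> h)"
  unfolding left_push_def by (rule differential_tangent[OF A.mfd_axioms A.mfd_axioms smap_left])

section \<open>The left-invariant frame and coframe\<close>

definition E :: "'e \<Rightarrow> 'g \<Rightarrow> 'g tvec" where
  "E a q = left_push G A q \<one> (coord_vec A U \<phi> \<one> a)"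

text \<open>The left-invariant one-form with coordinates w at the identity: v is carried to the
  identity by left translation with \<open>inv q\<close>, and its coordinates there are paired with
  w.\<close>

definition \<theta> :: "'e \<Rightarrow> 'g \<Rightarrow> 'g cvec" where
  "\<theta> w q = (\<lambda>v. if v \<in> tangent_space A q then \<Sum>b\<in>onb. (w \<bullet> b) * v (\<lambda>k. \<phi> (inv q \<otimes> k) \<bullet> b) else 0)"

lemma coord_tangent: "coord_vec A U \<phi> \<one> a \<in> tangent_space A \<one>"
  by (rule A.coord_vec_tangent[OF U])

lemma E_apply: "smooth_at A q f \<Longrightarrow> E a q f = coord_vec A U \<phi> \<one> a (\<lambda>k. f (q \<otimes> k))"
  using A.smooth_at_points by (simp add: E_def left_push_apply)

lemma E_tangent: "q \<in> points A \<Longrightarrow> E a q \<in> tangent_space A q"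
  unfolding E_def using left_push_tangent[OF _ _ coord_tangent, of q a] by simp

text \<open>(q, k) \<mapsto> f (q \<otimes> k) is jointly smooth, and E a q f is its derivative in k
  at the identity, hence smooth in q.\<close>

lemma E_vf: "vector_field A (points A) (E a)"
proof (rule A.vfI[OF A.mopen_points E_tangent])
  fix p f assume p: "p \<in> points A" and f: "smooth_at A p f"
  obtain W where W: "mopen A W" "p \<in> W" "\<And>q. q \<in> W \<Longrightarrow> smooth_at A q f"
    using A.smooth_at_nbhd[OF f] by blast
  have "smap (prod_atlas A A) A (\<lambda>z. fst z \<otimes> snd z) (p, \<one>)"
    using p by (intro smap_mult AA.P.mfd_axioms AA.smap_fst AA.smap_snd) auto
  from smapD[OF this, of f] have "smooth_at (prod_atlas A A) (p, \<one>) (\<lambda>z. f (fst z \<otimes> snd z))"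
    using f p by simp
  from AA.tangent_snd_smooth[OF coord_tangent this]
  have "smooth_at A p (\<lambda>q. coord_vec A U \<phi> \<one> a (\<lambda>k. f (q \<otimes> k)))" by simp
  then show "smooth_at A p (\<lambda>q. E a q f)"
    by (rule A.smooth_at_cong[OF _ W(1,2)]) (simp add: E_apply W(3))
qed

lemma E_left_push:
  assumes g: "g \<in> points A" "h \<in> points A"
  shows "E a (g \<otimes> h) = left_push G A g h (E a h)"
proof
  fix f
  show "E a (g \<otimes> h) f = left_push G A g h (E a h) f"
  proof (cases "smooth_at A (g \<otimes> h) f")
    case True
    have s: "smooth_at A h (\<lambda>k. f (g \<otimes> k))" by (rule smapD[OF smap_left[OF g] True])
    have s': "smooth_at A \<one> (\<lambda>k. f (g \<otimes> h \<otimes> k))"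
      using smapD[OF smap_left[of "g \<otimes> h" \<one>], of f] True g by simp
    have "coord_vec A U \<phi> \<one> a (\<lambda>k. f (g \<otimes> h \<otimes> k)) = coord_vec A U \<phi> \<one> a (\<lambda>k. f (g \<otimes> (h \<otimes> k)))"
      by (rule A.tv_cong[OF coord_tangent A.mopen_points _ s']) (simp_all add: assoc g)
    then show ?thesis by (simp add: E_apply True left_push_apply s)
  next
    case False
    then show ?thesis using A.tv_not_smooth[OF E_tangent] g by (simp add: left_push_not_smooth)
  qed
qed

lemma E_left_invariant: "left_invariant_field G A (E a)"
  using E_vf E_left_push by (simp add: left_invariant_field_def carrier)

lemma E_onb: "p \<in> points A \<Longrightarrow> E a p = (\<Sum>b\<in>onb. fscale (a \<bullet> b) (E b p))"
proof
  fix f assume p: "p \<in> points A"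
  show "E a p f = (\<Sum>b\<in>onb. fscale (a \<bullet> b) (E b p)) f"
  proof (cases "smooth_at A p f")
    case True
    show ?thesis unfolding sum_fun_apply fscale_def E_apply[OF True] by (rule A.coord_vec_onb[OF U])
  next
    case False
    then show ?thesis using A.tv_not_smooth[OF E_tangent[OF p]] by (simp add: sum_fun_apply fscale_def)
  qed
qed

lemma \<theta>_cotangent: "\<theta> w q \<in> cotangent_space A q"
  by (rule A.cotangentI)
     (auto simp: \<theta>_def A.tangent_add A.tangent_scale distrib_left sum.distrib, simp add: fscale_def sum_distrib_left mult.left_commute)

lemma \<theta>_of: "one_form A (points A) (\<theta> w)"
proof (rule A.ofI[OF A.mopen_points \<theta>_cotangent])
  fix V Y p assume Y: "vector_field A V Y" "V \<subseteq> points A" "p \<in> V"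
  have p: "p \<in> points A" using Y by auto
  have "smooth_at A p (\<lambda>q. Y q (\<lambda>k. \<phi> (inv q \<otimes> k) \<bullet> b))" for b
  proof -
    have "smap (prod_atlas A A) A (\<lambda>z. inv (fst z) \<otimes> snd z) (p, p)"
      using p by (intro smap_mult smap_inv AA.P.mfd_axioms AA.smap_fst AA.smap_snd) auto
    from smapD[OF this, of "\<lambda>k. \<phi> k \<bullet> b"]
    have "smooth_at (prod_atlas A A) (p, p) (\<lambda>z. \<phi> (inv (fst z) \<otimes> snd z) \<bullet> b)"
      using A.smooth_at_coord[OF U] p by simp
    \<comment> \<open>The point q occurs twice, inside \<open>inv q\<close> and as the point at
      which Y acts. The two occurrences are separated on the product and recombined along the
      diagonal.\<close>
    from smapD[OF smap_diagonal[OF p] AA.vf_snd_smooth[OF Y(1,3) this]] show ?thesis by simp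
  qed
  then have "smooth_at A p (\<lambda>q. \<Sum>b\<in>onb. (w \<bullet> b) * Y q (\<lambda>k. \<phi> (inv q \<otimes> k) \<bullet> b))"
    by (intro A.smooth_at_sum A.smooth_at_cmult p)
  then show "smooth_at A p (\<lambda>q. \<theta> w q (Y q))"
    by (rule A.smooth_at_cong[OF _ A.vf_mopen[OF Y(1)] Y(3)]) (simp add: \<theta>_def A.vf_tangent[OF Y(1)])
qed

lemma \<theta>_basis: "b \<in> onb \<Longrightarrow> v \<in> tangent_space A q \<Longrightarrow> \<theta> b q v = v (\<lambda>k. \<phi> (inv q \<otimes> k) \<bullet> b)"
proof -
  assume b: "b \<in> onb" and v: "v \<in> tangent_space A q"
  have "\<theta> b q v = (\<Sum>c\<in>onb. (b \<bullet> c) * v (\<lambda>k. \<phi> (inv q \<otimes> k) \<bullet> c))"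
    using v by (simp add: \<theta>_def)
  also have "\<dots> = (\<Sum>c\<in>onb. if c = b then v (\<lambda>k. \<phi> (inv q \<otimes> k) \<bullet> c) else 0)"
    by (rule sum.cong) (auto simp: inner_onb b)
  finally show "\<theta> b q v = v (\<lambda>k. \<phi> (inv q \<otimes> k) \<bullet> b)" using b by simp
qed

lemma \<theta>_onb: "\<theta> w p = (\<Sum>b\<in>onb. fscale (w \<bullet> b) (\<theta> b p))"
proof
  fix v
  show "\<theta> w p v = (\<Sum>b\<in>onb. fscale (w \<bullet> b) (\<theta> b p)) v"
  proof (cases "v \<in> tangent_space A p")
    case True
    then show ?thesis by (simp add: sum_fun_apply fscale_def \<theta>_basis) (simp add: \<theta>_def)
  qed (simp add: sum_fun_apply fscale_def \<theta>_def)
qed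

lemma translated_coord_smooth: "q \<in> points A \<Longrightarrow> smooth_at A q (\<lambda>k. \<phi> (inv q \<otimes> k) \<bullet> b)"
  using smapD[OF smap_left[of "inv q" q], of "\<lambda>k. \<phi> k \<bullet> b"] A.smooth_at_coord[OF U] by simp

lemma \<theta>_E:
  assumes q: "q \<in> points A"
  shows "\<theta> w q (E a q) = w \<bullet> a"
proof -
  have "E a q (\<lambda>k. \<phi> (inv q \<otimes> k) \<bullet> b) = a \<bullet> b" for b
  proof -
    have "coord_vec A U \<phi> \<one> a (\<lambda>k. \<phi> k \<bullet> b) = coord_vec A U \<phi> \<one> a (\<lambda>k. \<phi> (inv q \<otimes> (q \<otimes> k)) \<bullet> b)"
      by (rule A.tv_cong[OF coord_tangent A.mopen_points _ A.smooth_at_coord[OF U]]) (simp_all add: q)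
    then show ?thesis
      by (simp add: E_apply translated_coord_smooth[OF q] A.coord_vec_coord[OF U])
  qed
  then have "\<theta> w q (E a q) = (\<Sum>b\<in>onb. (w \<bullet> b) *\<^sub>R b) \<bullet> a"
    by (simp add: \<theta>_def E_tangent[OF q] inner_sum_left inner_commute[of a])
  then show ?thesis by (simp add: onb_expand)
qed

text \<open>The coordinate expansion at the identity, transported to q by left translation.\<close>

lemma E_expand:
  assumes q: "q \<in> points A" and v: "v \<in> tangent_space A q"
  shows "v = (\<Sum>b\<in>onb. fscale (\<theta> b q v) (E b q))"
proof (rule A.tangent_eqI[OF v])
  show "(\<Sum>b\<in>onb. fscale (\<theta> b q v) (E b q)) \<in> tangent_space A q"
    by (intro A.tangent_sum A.tangent_scale E_tangent q)
  fix f assume f: "smooth_at A q f"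
  have t: "left_push G A (inv q) q v \<in> tangent_space A \<one>"
    using left_push_tangent[of "inv q" q v] q v by simp
  have sf: "smooth_at A \<one> (\<lambda>k. f (q \<otimes> k))"
    using smapD[OF smap_left[of q \<one>], of f] f q by simp
  have "v f = v (\<lambda>k. f (q \<otimes> (inv q \<otimes> k)))"
    by (rule A.tv_cong[OF v A.mopen_points q f]) (simp add: q)
  also have "\<dots> = left_push G A (inv q) q v (\<lambda>k. f (q \<otimes> k))"
    using sf q by (simp add: left_push_apply)
  also have "\<dots> = (\<Sum>b\<in>onb. left_push G A (inv q) q v (\<lambda>k. \<phi> k \<bullet> b) * coord_vec A U \<phi> \<one> b (\<lambda>k. f (q \<otimes> k)))"
    by (rule A.tangent_expand[OF U t])
  also have "\<dots> = (\<Sum>b\<in>onb. \<theta> b q v * E b q f)"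
    using q A.smooth_at_coord[OF U] by (intro sum.cong refl) (simp add: left_push_apply \<theta>_basis[OF _ v] E_apply[OF f])
  finally show "v f = (\<Sum>b\<in>onb. fscale (\<theta> b q v) (E b q)) f"
    by (simp add: sum_fun_apply fscale_def)
qed

text \<open>Differentiate the constant k \<mapsto> g (k \<otimes> inv k) by the product rule
  \<open>tangent_Pair\<close>: its two partial derivatives must cancel.\<close>

lemma derivative_inverse:
  assumes v: "v \<in> tangent_space A \<one>" and g: "smooth_at A \<one> g"
  shows "v (\<lambda>k. g (inv k)) = - v g"
proof -
  have o: "\<one> \<in> points A" by simp
  have i: "smap A A (\<lambda>k. inv k) \<one>" by (intro smap_inv smap_id o)
  have "smap (prod_atlas A A) A (\<lambda>z. fst z \<otimes> snd z) (\<one>, \<one>)"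
    by (intro smap_mult AA.P.mfd_axioms AA.smap_fst AA.smap_snd o)
  from smapD[OF this, of g] g have "smooth_at (prod_atlas A A) (\<one>, inv \<one>) (\<lambda>z. g (fst z \<otimes> snd z))" by simp
  from AA.tangent_Pair[OF A.mfd_axioms smap_id[OF o] i v this]
  have 1: "v (\<lambda>k. g (k \<otimes> inv k)) = v (\<lambda>k. g (k \<otimes> inv \<one>)) + v (\<lambda>k. g (\<one> \<otimes> inv k))" by simp
  have "v (\<lambda>k. g \<one>) = v (\<lambda>k. g (k \<otimes> inv k))"
    by (rule A.tv_cong[OF v A.mopen_points o A.smooth_at_const[OF o]]) simp
  moreover have "v g = v (\<lambda>k. g (k \<otimes> inv \<one>))"
    by (rule A.tv_cong[OF v A.mopen_points o g]) simp
  moreover have "v (\<lambda>k. g (inv k)) = v (\<lambda>k. g (\<one> \<otimes> inv k))"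
    by (rule A.tv_cong[OF v A.mopen_points o]) (use smapD[OF i, of g] g in simp_all)
  ultimately show ?thesis using 1 A.tv_const[OF v o] by simp
qed

subsection \<open>Right-invariant one-forms\<close>

lemma smap_right_quotient:
  assumes C: "mfd C" and F: "smap C A F z" and H: "smap C A H z" and p: "p \<in> points A"
  shows "smap C A (\<lambda>x. F x \<otimes> inv (H x) \<otimes> p) z"
  using F H p by (intro smap_mult smap_inv C smap_const) (auto simp: smap_def)

lemma smap_right_translation:
  "q \<in> points A \<Longrightarrow> p \<in> points A \<Longrightarrow> smap A A (\<lambda>k. k \<otimes> inv q \<otimes> p) q"
  by (intro smap_right_quotient A.mfd_axioms smap_id smap_const)

lemma smooth_right_quotient:
  assumes p: "p \<in> points A" and q: "q \<in> points A" and f: "smooth_at A p f"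
  shows "smooth_at (prod_atlas A A) (q, q) (\<lambda>z. f (snd z \<otimes> inv (fst z) \<otimes> p))"
proof -
  have "smap (prod_atlas A A) A (\<lambda>z. snd z \<otimes> inv (fst z) \<otimes> p) (q, q)"
    by (intro smap_right_quotient AA.P.mfd_axioms AA.smap_fst AA.smap_snd p q)
  from smapD[OF this, of f] show ?thesis using f p q by simp
qed

text \<open>As for \<theta>, the two occurrences of r are separated on the product and recombined
  along the diagonal.\<close>

lemma smooth_right_quotient_field:
  assumes p: "p \<in> points A" and Y: "vector_field A V Y" "q \<in> V" and f: "smooth_at A p f"
  shows "smooth_at A q (\<lambda>r. Y r (\<lambda>k. f (k \<otimes> inv r \<otimes> p)))"
proof -
  have q: "q \<in> points A" by (rule A.mopen_subset[OF A.vf_mopen[OF Y(1)] Y(2)])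
  from smapD[OF smap_diagonal[OF q] AA.vf_snd_smooth[OF Y smooth_right_quotient[OF p q f]]]
  show ?thesis by simp
qed

text \<open>Differential at q of the right translation that carries q to p.\<close>

definition right_push :: "'g \<Rightarrow> 'g \<Rightarrow> 'g tvec \<Rightarrow> 'g tvec" where
  "right_push p q v = differential A A (\<lambda>k. k \<otimes> inv q \<otimes> p) q v"

lemma right_push_apply: "p \<in> points A \<Longrightarrow> q \<in> points A \<Longrightarrow> smooth_at A p f \<Longrightarrow> right_push p q v f = v (\<lambda>k. f (k \<otimes> inv q \<otimes> p))"
  by (simp add: right_push_def differential_apply)

lemma right_push_tangent:
  "p \<in> points A \<Longrightarrow> q \<in> points A \<Longrightarrow> v \<in> tangent_space A q \<Longrightarrow> right_push p q v \<in> tangent_space A p"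
  using differential_tangent[OF A.mfd_axioms A.mfd_axioms smap_right_translation, of q p v] by (simp add: right_push_def)

lemma right_push_self:
  assumes p: "p \<in> points A" and v: "v \<in> tangent_space A p"
  shows "right_push p p v = v"
proof (rule A.tangent_eqI[OF right_push_tangent[OF p p v] v])
  fix f assume f: "smooth_at A p f"
  have "v f = v (\<lambda>k. f (k \<otimes> inv p \<otimes> p))"
    by (rule A.tv_cong[OF v A.mopen_points p f]) (simp add: assoc p)
  then show "right_push p p v f = v f" by (simp add: right_push_apply p f)
qed

text \<open>The right-invariant one-form with value \<xi> at p.\<close>

definition right_form :: "'g \<Rightarrow> 'g cvec \<Rightarrow> 'g \<Rightarrow> 'g cvec" where
  "right_form p \<xi> q = (\<lambda>v. if v \<in> tangent_space A q then \<xi> (right_push p q v) else 0)"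

lemma right_form_self:
  assumes p: "p \<in> points A" and \<xi>: "\<xi> \<in> cotangent_space A p"
  shows "right_form p \<xi> p = \<xi>"
  by (rule ext) (simp add: right_form_def right_push_self[OF p] A.ct_outside[OF \<xi>])

lemma right_push_add: "right_push p q (v + w) = right_push p q v + right_push p q w"
  by (auto simp: right_push_def differential_def)

lemma right_push_scale: "right_push p q (fscale c v) = fscale c (right_push p q v)"
  by (auto simp: right_push_def differential_def fscale_def)

lemma right_form_expand:
  assumes p: "p \<in> points A" and \<xi>: "\<xi> \<in> cotangent_space A p" and q: "q \<in> points A"
    and V: "(V, \<psi>) \<in> A" "p \<in> V" and v: "v \<in> tangent_space A q"
  shows "right_form p \<xi> q v = (\<Sum>b\<in>onb. v (\<lambda>k. \<psi> (k \<otimes> inv q \<otimes> p) \<bullet> b) * \<xi> (coord_vec A V \<psi> p b))"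
  using A.ct_expand[OF V \<xi> right_push_tangent[OF p q v]] v
  by (simp add: right_form_def right_push_apply[OF p q] A.smooth_at_coord[OF V])

lemma right_form_of:
  assumes p: "p \<in> points A" and \<xi>: "\<xi> \<in> cotangent_space A p"
  shows "one_form A (points A) (right_form p \<xi>)"
proof (rule A.ofI[OF A.mopen_points])
  fix q assume q: "q \<in> points A"
  show "right_form p \<xi> q \<in> cotangent_space A q"
    by (rule A.cotangentI)
       (simp_all add: right_form_def A.tangent_add A.tangent_scale right_push_add right_push_scale A.ct_add[OF \<xi>] A.ct_scale[OF \<xi>]
          right_push_tangent p q)
next
  fix V Y q assume Y: "vector_field A V Y" "V \<subseteq> points A" "q \<in> V"
  obtain V' \<psi> where V': "(V', \<psi>) \<in> A" "p \<in> V'" using A.points_chart[OF p] by blast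
  have "smooth_at A q (\<lambda>r. \<Sum>b\<in>onb. Y r (\<lambda>k. \<psi> (k \<otimes> inv r \<otimes> p) \<bullet> b) * \<xi> (coord_vec A V' \<psi> p b))"
    using Y by (intro A.smooth_at_sum A.smooth_at_mult A.smooth_at_const
        smooth_right_quotient_field[where f = "\<lambda>k. \<psi> k \<bullet> b" for b, OF p Y(1,3) A.smooth_at_coord[OF V']]) auto
  then show "smooth_at A q (\<lambda>r. right_form p \<xi> r (Y r))"
    by (rule A.smooth_at_cong[OF _ A.vf_mopen[OF Y(1)] Y(3)])
       (use Y A.vf_tangent[OF Y(1)] in \<open>auto simp: right_form_expand[OF p \<xi> _ V'] subsetD\<close>)
qed

text \<open>The core computation: q occurs as the point of E c and inside \<open>inv q\<close>, and
  the product rule separates the two. Moving the point gives E_a E_c f. Moving the inverse gives -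
  E_c E_a f, after exchanging the derivatives and differentiating the inversion.\<close>

lemma derivative_right_quotient:
  assumes p: "p \<in> points A" and f: "smooth_at A p f"
  shows "E a p (\<lambda>q. E c q (\<lambda>k. f (k \<otimes> inv q \<otimes> p))) = lie_bracket A (E a) (E c) p f"
proof -
  let ?H = "\<lambda>z. f (snd z \<otimes> inv (fst z) \<otimes> p)"
  let ?K = "\<lambda>z. E c (snd z) (\<lambda>y. ?H (fst z, y))"
  have H: "smooth_at (prod_atlas A A) (p, p) ?H" by (rule smooth_right_quotient[OF p p f])
  have K: "smooth_at (prod_atlas A A) (p, p) ?K" by (rule AA.vf_snd_smooth[OF E_vf p H])
  obtain W where W: "mopen A W" "p \<in> W" "\<And>q. q \<in> W \<Longrightarrow> smooth_at A q f"
    using A.smooth_at_nbhd[OF f] by blast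
  have Wp: "q \<in> points A" if "q \<in> W" for q using A.mopen_subset[OF W(1) that] .
  have sE: "smooth_at A p (\<lambda>q. E b q f)" for b by (rule A.vf_smooth[OF E_vf p f])
  have "E a p (\<lambda>q. E c q (\<lambda>k. f (k \<otimes> inv q \<otimes> p))) = E a p (\<lambda>q. ?K (q, p)) + E a p (\<lambda>q. ?K (p, q))"
    using AA.tangent_Pair[OF A.mfd_axioms smap_id[OF p] smap_id[OF p] E_tangent[OF p] K] by simp
  also have "E a p (\<lambda>q. ?K (p, q)) = E a p (\<lambda>q. E c q f)"
  proof (rule A.tv_cong[OF E_tangent[OF p] W(1,2) sE, symmetric])
    fix q assume q: "q \<in> W"
    have "E c q f = E c q (\<lambda>k. f (k \<otimes> inv p \<otimes> p))"
      by (rule A.tv_cong[OF E_tangent[OF Wp[OF q]] A.mopen_points Wp[OF q] W(3)[OF q]]) (simp add: assoc p)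
    then show "E c q f = ?K (p, q)" by simp
  qed
  also have "E a p (\<lambda>q. ?K (q, p)) = E c p (\<lambda>y. E a p (\<lambda>x. f (y \<otimes> inv x \<otimes> p)))"
    using AA.mixed_derivatives[OF E_tangent[OF p] E_tangent[OF p] H, of a c] by simp
  also have "\<dots> = E c p (\<lambda>y. (-1) * E a y f)"
  proof (rule A.tv_cong[OF E_tangent[OF p] W(1,2) A.smooth_at_cmult[OF sE], symmetric])
    fix y assume y: "y \<in> W"
    have yp: "y \<in> points A" by (rule Wp[OF y])
    have s: "smooth_at A p (\<lambda>x. f (y \<otimes> inv x \<otimes> p))"
      using smapD[OF smap_right_quotient[OF A.mfd_axioms smap_const[OF A.mfd_axioms p yp] smap_id[OF p] p], of f] W(3)[OF y] p yp
      by (simp add: assoc)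
    have g: "smooth_at A \<one> (\<lambda>k. f (y \<otimes> k))"
      using smapD[OF smap_left[of y \<one>], of f] W(3)[OF y] yp by simp
    have s': "smooth_at A \<one> (\<lambda>k. f (y \<otimes> inv k))"
      using smapD[OF smap_inv[OF smap_id[of \<one> A]], of "\<lambda>k. f (y \<otimes> k)"] g by simp
    \<comment> \<open>At x = p \<otimes> k the product y \<otimes> inv x \<otimes> p equals y
      \<otimes> inv k, so the derivative of E a at p becomes one at the identity to which
      \<open>derivative_inverse\<close> applies.\<close>
    have "coord_vec A U \<phi> \<one> a (\<lambda>k. f (y \<otimes> inv k)) = coord_vec A U \<phi> \<one> a (\<lambda>k. f (y \<otimes> inv (p \<otimes> k) \<otimes> p))"
      by (rule A.tv_cong[OF coord_tangent A.mopen_points _ s'])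
         (use p yp inv_mult_group[unfolded carrier] in \<open>simp_all add: assoc\<close>)
    then show "(-1) * E a y f = E a p (\<lambda>x. f (y \<otimes> inv x \<otimes> p))"
      using derivative_inverse[OF coord_tangent g] by (simp add: E_apply[OF s] E_apply[OF W(3)[OF y]])
  qed
  also have "\<dots> = - E c p (\<lambda>y. E a y f)"
    using A.tv_cmult[OF E_tangent[OF p] sE, where c = "-1"] by simp
  finally show ?thesis by (simp add: A.lie_bracket_apply[OF f])
qed

text \<open>For a connection with \<open>D (E a) (E c)\<close> equal to the bracket, this is
  parallelism of the right-invariant form at p, tested on the frame. The proof reads it in
  coordinates at p, where \<open>derivative_right_quotient\<close> applies to each coordinate
  function.\<close>

lemma derivative_right_form:
  assumes p: "p \<in> points A" and \<xi>: "\<xi> \<in> cotangent_space A p"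
  shows "E a p (\<lambda>q. right_form p \<xi> q (E c q)) = \<xi> (lie_bracket A (E a) (E c) p)"
proof -
  obtain V \<psi> where V: "(V, \<psi>) \<in> A" "p \<in> V" using A.points_chart[OF p] by blast
  have s: "smooth_at A p (\<lambda>r. E c r (\<lambda>k. \<psi> (k \<otimes> inv r \<otimes> p) \<bullet> b))" for b
    by (rule smooth_right_quotient_field[where f = "\<lambda>k. \<psi> k \<bullet> b", OF p E_vf p A.smooth_at_coord[OF V]])
  have "E a p (\<lambda>q. right_form p \<xi> q (E c q)) =
      E a p (\<lambda>q. \<Sum>b\<in>onb. \<xi> (coord_vec A V \<psi> p b) * E c q (\<lambda>k. \<psi> (k \<otimes> inv q \<otimes> p) \<bullet> b))"
    by (rule A.tv_cong[OF E_tangent[OF p] A.mopen_points p A.of_smooth[OF right_form_of[OF p \<xi>] p E_vf p]])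
       (simp add: right_form_expand[OF p \<xi> _ V E_tangent] mult.commute)
  also have "\<dots> = (\<Sum>b\<in>onb. \<xi> (coord_vec A V \<psi> p b) * E a p (\<lambda>q. E c q (\<lambda>k. \<psi> (k \<otimes> inv q \<otimes> p) \<bullet> b)))"
    by (subst A.tv_sum[OF E_tangent[OF p] p]) (auto intro: A.smooth_at_cmult s simp: A.tv_cmult[OF E_tangent[OF p] s])
  also have "\<dots> = (\<Sum>b\<in>onb. lie_bracket A (E a) (E c) p (\<lambda>k. \<psi> k \<bullet> b) * \<xi> (coord_vec A V \<psi> p b))"
    by (simp add: derivative_right_quotient[OF p A.smooth_at_coord[OF V]] mult.commute)
  also have "\<dots> = \<xi> (lie_bracket A (E a) (E c) p)"
    by (rule A.ct_expand[OF V \<xi> A.lie_bracket_tangent[OF E_vf p E_vf p], symmetric])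
  finally show ?thesis .
qed

end

subsection \<open>The connection given by the bracket of left-invariant fields\<close>

locale lie_connection = lie_chart G A U \<phi> for G :: "('g, 'm) monoid_scheme" (structure)
    and A :: "('g, 'e::findim_inner) atlas" and U \<phi> +
  fixes D :: "('g \<Rightarrow> 'g tvec) \<Rightarrow> ('g \<Rightarrow> 'g tvec) \<Rightarrow> 'g \<Rightarrow> 'g tvec"
  assumes left_invariant: "left_invariant_connection G A D"
    and D_bracket: "left_invariant_field G A X \<Longrightarrow> left_invariant_field G A Y \<Longrightarrow> p \<in> carrier G
           \<Longrightarrow> D X Y p = lie_bracket A X Y p"
begin

lemma linear_D: "linear_connection A D"
  using left_invariant by (simp add: left_invariant_connection_def)

definition br :: "'e \<Rightarrow> 'e \<Rightarrow> 'e" where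
  "br a b = (\<Sum>c\<in>onb. lie_bracket A (E a) (E b) \<one> (\<lambda>k. \<phi> k \<bullet> c) *\<^sub>R c)"

text \<open>The bracket of two left-invariant fields is left-invariant because D agrees with it on
  such fields and D is a left-invariant connection. Its value at the identity then determines it
  everywhere.\<close>

lemma bracket_E:
  assumes p: "p \<in> points A"
  shows "lie_bracket A (E a) (E b) p = E (br a b) p"
proof -
  have o: "\<one> \<in> points A" by simp
  have D: "D (E a) (E b) q = lie_bracket A (E a) (E b) q" if "q \<in> points A" for q
    using D_bracket[OF E_left_invariant E_left_invariant] that by (simp add: carrier)
  have "left_invariant_field G A (D (E a) (E b))"
    using left_invariant E_left_invariant by (simp add: left_invariant_connection_def)
  then have "D (E a) (E b) (p \<otimes> \<one>) = left_push G A p \<one> (D (E a) (E b) \<one>)"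
    using p o by (simp only: left_invariant_field_def carrier)
  then have "lie_bracket A (E a) (E b) p = left_push G A p \<one> (lie_bracket A (E a) (E b) \<one>)"
    using p by (simp add: D)
  also have "lie_bracket A (E a) (E b) \<one> = coord_vec A U \<phi> \<one> (br a b)"
    unfolding coord_vec_onb_sum[OF U, of "br a b"]
    by (subst A.tangent_expand_sum[OF U A.lie_bracket_tangent[OF E_vf o E_vf o]])
       (simp add: br_def inner_sum_onb cong: sum.cong)
  finally show ?thesis by (simp only: E_def[of "br a b"])
qed

sublocale frame_mfd A E \<theta> br
proof
  show "points A \<noteq> {}" using points_closed(1) by blast
qed (auto intro: E_vf \<theta>_of E_onb \<theta>_onb \<theta>_E E_expand bracket_E)

lemma vf_frame:
  assumes X: "vector_field A (points A) X"
  shows "\<And>b. (\<lambda>q. \<theta> b q (X q)) \<in> {f. smooth_fun A (points A) f}"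
    and "\<And>q. q \<in> points A \<Longrightarrow> X q = (\<Sum>b\<in>onb. fscale (\<theta> b q (X q)) (E b q))"
  using A.of_smooth[OF \<theta>_of _ X] E_expand A.vf_tangent[OF X]
  by (auto simp: A.smooth_fun_iff A.mopen_points)

lemma D_rules:
  assumes X: "vector_field A (points A) X" and Y: "vector_field A (points A) Y" and Z: "vector_field A (points A) Z"
    and p: "p \<in> points A"
  shows "D X Y p \<in> tangent_space A p"
    and "D (\<lambda>q. X q + Z q) Y p = D X Y p + D Z Y p"
    and "D X (\<lambda>q. Y q + Z q) p = D X Y p + D X Z p"
    and "smooth_fun A (points A) f \<Longrightarrow> D (\<lambda>q. fscale (f q) (X q)) Y p = fscale (f p) (D X Y p)"
    and "smooth_fun A (points A) f \<Longrightarrow> D X (\<lambda>q. fscale (f q) (Y q)) p = fscale (X p f) (Y p) + fscale (f p) (D X Y p)"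
proof -
  note L = linear_D[unfolded linear_connection_def, rule_format, OF conjI[OF X Y]]
  show "D X Y p \<in> tangent_space A p" using L A.vf_tangent p by blast
  show "D (\<lambda>q. X q + Z q) Y p = D X Y p + D Z Y p" "D X (\<lambda>q. Y q + Z q) p = D X Y p + D X Z p"
    using L Z p unfolding plus_fun_def by blast+
  show "smooth_fun A (points A) f \<Longrightarrow> D (\<lambda>q. fscale (f q) (X q)) Y p = fscale (f p) (D X Y p)"
    "smooth_fun A (points A) f \<Longrightarrow> D X (\<lambda>q. fscale (f q) (Y q)) p = fscale (X p f) (Y p) + fscale (f p) (D X Y p)"
    using L p by blast+
qed

text \<open>Left- and right-invariant fields commute, which is why right-invariant one-forms are parallel.\<close>

lemma right_form_parallel:
  assumes p: "p \<in> points A" and \<xi>: "\<xi> \<in> cotangent_space A p"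
    and X: "vector_field A (points A) X" and Y: "vector_field A (points A) Y"
  shows "dual_connection D X (right_form p \<xi>) Y p = 0"
proof -
  define \<sigma> where "\<sigma> = right_form p \<xi>"
  have \<sigma>: "one_form A (points A) \<sigma>" "\<sigma> p = \<xi>"
    using right_form_of[OF p \<xi>] right_form_self[OF p \<xi>] by (simp_all add: \<sigma>_def)
  note \<sigma>Y = A.of_smooth[OF \<sigma>(1) p _ p]
  interpret V: section_space fscale "points A" "{X. vector_field A (points A) X}" "{f. smooth_fun A (points A) f}"
    by (rule A.section_space_vf)
  have smooth: "smooth_at A p f" if "f \<in> {f. smooth_fun A (points A) f}" for f
    using that p by (simp add: A.smooth_fun_iff)
  have EE: "dual_connection D (E a) \<sigma> (E c) p = 0" for a c
    using derivative_right_form[OF p \<xi>, of a c] D_bracket[OF E_left_invariant E_left_invariant, of p a c] p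
    by (simp add: dual_connection_def \<sigma>(2) carrier) (simp add: \<sigma>_def)
  \<comment> \<open>Parallelism extends from frame fields to arbitrary Y and then to arbitrary X by
    tensoriality: the terms with derivatives of the coefficient f of Y cancel between X (\<sigma> (f
    Y)) and \<sigma> (D_X (f Y)).\<close>
  have EY: "dual_connection D (E a) \<sigma> Y p = 0" if Y: "vector_field A (points A) Y" for a Y
  proof (rule V.tensor_eq_zero[where T = "\<lambda>Y. dual_connection D (E a) \<sigma> Y p" and S = E and K = onb and c = "\<lambda>b q. \<theta> b q (Y q)",
        OF _ _ p finite_onb vf_frame(1)[OF Y] _ EE _ vf_frame(2)[OF Y]])
    fix s t assume s: "s \<in> {X. vector_field A (points A) X}" and t: "t \<in> {X. vector_field A (points A) X}"
    have "E a p (\<lambda>q. \<sigma> q (s q) + \<sigma> q (t q)) = E a p (\<lambda>q. \<sigma> q (s q + t q))"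
      by (rule A.tv_cong[OF E_tangent[OF p] A.mopen_points p A.smooth_at_add[OF \<sigma>Y \<sigma>Y]])
         (use s t A.vf_tangent[of "points A" s] A.vf_tangent[of "points A" t] in \<open>simp_all add: A.ct_add[OF A.of_cotangent[OF \<sigma>(1)]]\<close>)
    then show "dual_connection D (E a) \<sigma> (\<lambda>q. s q + t q) p = dual_connection D (E a) \<sigma> s p + dual_connection D (E a) \<sigma> t p"
      using s t D_rules[OF E_vf[of a], of s t p] D_rules[OF E_vf[of a], of t s p] p \<xi>
      by (simp add: dual_connection_def A.tv_add[OF E_tangent[OF p]] \<sigma>Y \<sigma>(2) A.ct_add)
  next
    fix f s assume f: "f \<in> {f. smooth_fun A (points A) f}" and s: "s \<in> {X. vector_field A (points A) X}"
      and z: "dual_connection D (E a) \<sigma> s p = 0 \<or> f p = 0"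
    have "E a p (\<lambda>q. f q * \<sigma> q (s q)) = E a p (\<lambda>q. \<sigma> q (fscale (f q) (s q)))"
      by (rule A.tv_cong[OF E_tangent[OF p] A.mopen_points p A.smooth_at_mult[OF smooth[OF f] \<sigma>Y]])
         (use s A.vf_tangent[of "points A" s] in \<open>simp_all add: A.ct_scale[OF A.of_cotangent[OF \<sigma>(1)]]\<close>)
    then have "dual_connection D (E a) \<sigma> (\<lambda>q. fscale (f q) (s q)) p = f p * dual_connection D (E a) \<sigma> s p"
      using s f D_rules(1)[OF E_vf[of a], of s s p] D_rules(5)[OF E_vf[of a], of s s p f] p \<xi> A.vf_tangent[of "points A" s p]
      by (simp add: dual_connection_def A.tv_mult[OF E_tangent[OF p]] \<sigma>Y smooth \<sigma>(2) A.ct_add A.ct_scale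
          A.tangent_scale algebra_simps)
    then show "dual_connection D (E a) \<sigma> (\<lambda>q. fscale (f q) (s q)) p = 0" using z by auto
  qed (use Y E_vf in auto)
  have "dual_connection D X \<sigma> Y p = 0"
  proof (rule V.tensor_eq_zero[where T = "\<lambda>X. dual_connection D X \<sigma> Y p" and S = E and K = onb and c = "\<lambda>b q. \<theta> b q (X q)",
        OF _ _ p finite_onb vf_frame(1)[OF X] _ EY[OF Y] _ vf_frame(2)[OF X]])
    fix s t assume s: "s \<in> {X. vector_field A (points A) X}" and t: "t \<in> {X. vector_field A (points A) X}"
    show "dual_connection D (\<lambda>q. s q + t q) \<sigma> Y p = dual_connection D s \<sigma> Y p + dual_connection D t \<sigma> Y p"
      using s t D_rules[of s Y t p] D_rules[of t Y s p] Y p \<xi>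
      by (simp add: dual_connection_def \<sigma>(2) A.ct_add)
  next
    fix f s assume f: "f \<in> {f. smooth_fun A (points A) f}" and s: "s \<in> {X. vector_field A (points A) X}"
      and z: "dual_connection D s \<sigma> Y p = 0 \<or> f p = 0"
    have "dual_connection D (\<lambda>q. fscale (f q) (s q)) \<sigma> Y p = f p * dual_connection D s \<sigma> Y p"
      using s f D_rules(1)[of s Y s p] D_rules(4)[of s Y s p f] Y p \<xi>
      by (simp add: dual_connection_def \<sigma>(2) A.ct_scale) (simp add: fscale_def right_diff_distrib)
    then show "dual_connection D (\<lambda>q. fscale (f q) (s q)) \<sigma> Y p = 0" using z by auto
  qed (use X E_vf in auto)
  then show ?thesis by (simp add: \<sigma>_def)
qed

sublocale frame_connection A E \<theta> br D
proof
  fix p \<xi> assume p: "p \<in> points A" and \<xi>: "\<xi> \<in> cotangent_space A p"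
  show "\<exists>\<sigma>. one_form A (points A) \<sigma> \<and> \<sigma> p = \<xi> \<and>
      (\<forall>X Y. vector_field A (points A) X \<and> vector_field A (points A) Y \<longrightarrow> dual_connection D X \<sigma> Y p = 0)"
    using right_form_of[OF p \<xi>] right_form_self[OF p \<xi>] right_form_parallel[OF p \<xi>] by blast
next
  fix p a b assume p: "p \<in> points A"
  then show "D (E a) (E b) p = E (br a b) p"
    using D_bracket[OF E_left_invariant E_left_invariant, of p a b] bracket_E by (simp add: carrier)
qed

text \<open>Left translation preserves the frame of constant sections, so a left-invariant \<J> has
  the same matrix in it at every point.\<close>

lemma left_gen_push_gsec:
  assumes p: "p \<in> points A"
  shows "left_gen_push G A p \<one> (gsec u \<one>) = gsec u p"
proof -
  have o: "\<one> \<in> points A" by simp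
  have "(if w \<in> tangent_space A p then \<theta> (snd u) \<one> (left_push G A (inv p) p w) else 0) = \<theta> (snd u) p w" for w
  proof (cases "w \<in> tangent_space A p")
    case True
    have t: "left_push G A (inv p) p w \<in> tangent_space A \<one>"
      using left_push_tangent[of "inv p" p w] p True by simp
    have "left_push G A (inv p) p w (\<lambda>k. \<phi> (inv \<one> \<otimes> k) \<bullet> b) = w (\<lambda>k. \<phi> (inv p \<otimes> k) \<bullet> b)" for b
    proof -
      have "w (\<lambda>k. \<phi> (inv p \<otimes> k) \<bullet> b) = w (\<lambda>k. \<phi> (inv \<one> \<otimes> (inv p \<otimes> k)) \<bullet> b)"
        by (rule A.tv_cong[OF True A.mopen_points p translated_coord_smooth[OF p]]) (simp add: p)
      then show ?thesis
        using translated_coord_smooth[OF o, of b] p by (simp add: left_push_apply)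
    qed
    then show ?thesis using True t by (simp add: \<theta>_def)
  qed (simp add: \<theta>_def)
  moreover have p1: "p \<otimes> \<one> = p" using p by simp
  ultimately show ?thesis
    using E_left_push[OF p o, of "fst u"] unfolding left_gen_push_def gsec_def fst_conv snd_conv p1 by simp
qed

end

theorem mainTheorem7:
  fixes G :: "('g, 'm) monoid_scheme"
    and A :: "('g, 'e::findim_inner) atlas"
    and \<J> :: "'g \<Rightarrow> 'g gvec \<Rightarrow> 'g gvec"
    and D\<^sub>c :: "('g \<Rightarrow> 'g tvec) \<Rightarrow> ('g \<Rightarrow> 'g tvec) \<Rightarrow> ('g \<Rightarrow> 'g tvec)"
  assumes "lie_group G A"
    and "skew_gen_complex_structure A \<J>"
    and "left_invariant_gcs G A \<J>"
    and "left_invariant_connection G A D\<^sub>c"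
    and "\<And>X Y p. left_invariant_field G A X \<Longrightarrow> left_invariant_field G A Y \<Longrightarrow> p \<in> carrier G
           \<Longrightarrow> D\<^sub>c X Y p = lie_bracket A X Y p"
  shows "courant_integrable A \<J> \<longleftrightarrow>
         integrable_almost_complex_structure (cotangent_bundle A) (cotangent_acs A \<J> D\<^sub>c)"
proof -
  have G: "group G" and A: "mfd A" and c: "carrier G = points A"
    using assms(1) smooth_manifold_mfd by (auto simp: lie_group_def)
  interpret G: group G by fact
  interpret M: mfd A by fact
  obtain U \<phi> where U: "(U, \<phi>) \<in> A" "\<one>\<^bsub>G\<^esub> \<in> U"
    using M.points_chart[of "\<one>\<^bsub>G\<^esub>"] G.one_closed by (auto simp: c)
  interpret L: lie_connection G A U \<phi> D\<^sub>c
    by unfold_locales (use assms U in auto)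
  \<comment> \<open>The matrix of \<J> is read off at the identity; left invariance carries it to
    every other point.\<close>
  define j where "j u = L.gcoeff \<one>\<^bsub>G\<^esub> (\<J> \<one>\<^bsub>G\<^esub> (L.gsec u \<one>\<^bsub>G\<^esub>))" for u
  have o: "\<one>\<^bsub>G\<^esub> \<in> points A" by simp
  interpret F: frame_gcs A L.E L.\<theta> L.br D\<^sub>c \<J> j
  proof
    show "skew_gen_complex_structure A \<J>" by fact
    fix p u assume p: "p \<in> points A"
    have "\<J> \<one>\<^bsub>G\<^esub> (L.gsec u \<one>\<^bsub>G\<^esub>) \<in> gen_tangent A \<one>\<^bsub>G\<^esub>"
      using assms(2) L.gsec_tangent[OF o] o by (simp add: skew_gen_complex_structure_def)
    then have j: "\<J> \<one>\<^bsub>G\<^esub> (L.gsec u \<one>\<^bsub>G\<^esub>) = L.gsec (j u) \<one>\<^bsub>G\<^esub>"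
      by (simp add: j_def L.gsec_gcoeff)
    have "\<J> (p \<otimes>\<^bsub>G\<^esub> \<one>\<^bsub>G\<^esub>) (left_gen_push G A p \<one>\<^bsub>G\<^esub> (L.gsec u \<one>\<^bsub>G\<^esub>)) =
        left_gen_push G A p \<one>\<^bsub>G\<^esub> (\<J> \<one>\<^bsub>G\<^esub> (L.gsec u \<one>\<^bsub>G\<^esub>))"
      using assms(3) p o L.gsec_tangent[OF o] unfolding left_invariant_gcs_def c by blast
    then show "\<J> p (L.gsec u p) = L.gsec (j u) p"
      using p by (simp add: j L.left_gen_push_gsec)
  qed
  show ?thesis by (rule F.courant_integrable_iff_JT)
qed

end
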